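(* Let $H$ be a Hilbert space and let $[0,1]\ni t\mapsto T_t^+\in\mathcal{L}(H)$ be a path of bounded operators that is continuously differentiable in operator norm. Put $T_t^-:=(T_t^+)^*$, $R_t^-:=1-T_t^+T_t^-$, $R_t^+:=1-T_t^-T_t^+$, and on $H\oplus H$ put $$R_t:=\begin{pmatrix}R_t^+&0\\ 0&R_t^-\end{pmatrix},\qquad T_t:=\begin{pmatrix}0&T_t^-\\ T_t^+&0\end{pmatrix}.$$ Let $n\in\mathbb{N}$. Suppose that $(R_t^+)^n-(R_t^-)^n\in\mathcal{L}^1(H)$ for all $t\in[0,1]$. Suppose furthermore that $$\frac{d(R_t^n)}{dt}\in\mathcal{L}^1(H\oplus H)\quad\text{and}\quad\frac{dT_t}{dt}\cdot R_t^n\in\mathcal{L}^1(H\oplus H)$$ for all $t\in[0,1]$, and that the maps $t\mapsto\frac{d(R_t^n)}{dt}$ and $t\mapsto\frac{dT_t}{dt}\cdot R_t^n$ are continuous in trace norm. Then $(R_0^+)^n-(R_0^-)^n-(R_1^+)^n+(R_1^-)^n\in\mathcal{L}^1(H)$ determines the trivial element in $H_0^\lambda(K)$. In particular, the homological indices in degree $n$ of $T_0^+$ and $T_1^+$ coincide: $\mathrm{H\text{-}Ind}_n(T_0^+)=\mathrm{H\text{-}Ind}_n(T_1^+)$.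
   Context: $\mathbb{N}=\{1,2,\dots\}$; $\mathcal{L}(H)$ denotes the bounded operators and $\mathcal{L}^1(H)$ the trace class operators with trace norm $\|\cdot\|_1$ and trace $\mathrm{Tr}$. For $T\in\mathcal{L}(H)$ with $(1-T^*T)^n-(1-TT^* )^n\in\mathcal{L}^1(H)$, the homological index of $T$ in degree $n$ is $\mathrm{H\text{-}Ind}_n(T):=\mathrm{Tr}\big((1-T^*T)^n-(1-TT^* )^n\big)$. For $m\ge0$ let $\mathcal{K}_m\subset\mathcal{L}(H)^{\otimes(m+1)}$ be the linear span of the elementary tensors $x_0\otimes\cdots\otimes x_m$ such that $x_i\cdots x_m x_0\cdots x_{i-1}\in\mathcal{L}^1(H)$ for all $i\in\{0,\dots,m\}$. With $M(x_0\otimes\cdots\otimes x_m)=x_0\cdots x_m$ and $t(x_0\otimes\cdots\otimes x_m)=(-1)^m x_m\otimes x_0\otimes\cdots\otimes x_{m-1}$, define a norm on $\mathcal{K}_m$ by $$\|x\|_1=\inf\Big\{\sum_{j}\Big(\sum_{i=0}^m\|M(t^i(x_0^j\otimes\cdots\otimes x_m^j))\|_1+\|x_0^j\|\cdots\|x_m^j\|\Big)\ :\ x=\sum_j x_0^j\otimes\cdots\otimes x_m^j\Big\},$$ the infimum being over finite representations of $x$ by elementary tensors $x_0^j\otimes\cdots\otimes x_m^j$ such that $x_i^j\cdots x_m^j x_0^j\cdots x_{i-1}^j\in\mathcal{L}^1(H)$ for all $i\in\{0,\dots,m\}$. $K_m$ is the completion of $\mathcal{K}_m$; in particular $K_0=\mathcal{L}^1(H)$.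 The Hochschild boundary $$b(x_0\otimes\cdots\otimes x_m)=\sum_{i=0}^{m-1}(-1)^i x_0\otimes\cdots\otimes x_ix_{i+1}\otimes\cdots\otimes x_m+(-1)^m x_mx_0\otimes x_1\otimes\cdots\otimes x_{m-1}$$ extends to a continuous map $b:K_m\to K_{m-1}$. $H_*^\lambda(K)$ is the homology of the cyclic complex $C_m^\lambda(K)=K_m/\mathrm{Im}(1-t)$ with boundary induced by $b$; in degree $0$, $H_0^\lambda(K)=K_0/b(K_1)$. *)

theory Defs
  imports "HOL-Analysis.Analysis" "HOL-Library.Poly_Mapping" "HOL-Algebra.Coset"
begin

section \<open>Complex Hilbert spaces\<close>

class complex_vector = real_vector +
  fixes scaleC :: "complex \<Rightarrow> 'a \<Rightarrow> 'a" (infixr \<open>*\<^sub>C\<close> 75)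
  assumes scaleC_add_right: "c *\<^sub>C (x + y) = c *\<^sub>C x + c *\<^sub>C y"
    and scaleC_add_left: "(c + d) *\<^sub>C x = c *\<^sub>C x + d *\<^sub>C x"
    and scaleC_scaleC: "c *\<^sub>C d *\<^sub>C x = (c * d) *\<^sub>C x"
    and scaleC_one: "1 *\<^sub>C x = x"
    and scaleR_scaleC: "r *\<^sub>R x = complex_of_real r *\<^sub>C x"

abbreviation cspan :: "'a::complex_vector set \<Rightarrow> 'a set"
  where "cspan \<equiv> module.span (*\<^sub>C)"

lemma vector_space_scaleC: "vector_space ((*\<^sub>C) :: complex \<Rightarrow> 'a::complex_vector \<Rightarrow> 'a)"
  by standard (simp_all add: scaleC_add_right scaleC_add_left scaleC_scaleC scaleC_one)

interpretation cvec: vector_space "(*\<^sub>C) :: complex \<Rightarrow> 'a::complex_vector \<Rightarrow> 'a"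
  by (rule vector_space_scaleC)

text \<open>The inner product is conjugate linear in the first and linear in the second variable.
  No separability is assumed, and the zero space is allowed.\<close>

class complex_hilbert = complex_vector + banach +
  fixes cinner :: "'a \<Rightarrow> 'a \<Rightarrow> complex"
  assumes cinner_commute: "cinner x y = cnj (cinner y x)"
    and cinner_add_right: "cinner x (y + z) = cinner x y + cinner x z"
    and cinner_scaleC_right: "cinner x (c *\<^sub>C y) = c * cinner x y"
    and cinner_self: "cinner x x = complex_of_real ((norm x)\<^sup>2)"

instantiation prod :: (complex_vector, complex_vector) complex_vector
begin
definition scaleC_prod :: "complex \<Rightarrow> 'a \<times> 'b \<Rightarrow> 'a \<times> 'b"
  where "c *\<^sub>C p = (c *\<^sub>C fst p, c *\<^sub>C snd p)"
instance
  by standard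
    (simp_all add: scaleC_prod_def scaleC_add_right scaleC_add_left scaleC_scaleC scaleC_one
      scaleR_prod_def scaleR_scaleC)
end

text \<open>The product type is the Hilbert space direct sum: its library norm is
  \<open>sqrt (\<parallel>x\<parallel>\<^sup>2 + \<parallel>y\<parallel>\<^sup>2)\<close>.\<close>

instantiation prod :: (complex_hilbert, complex_hilbert) complex_hilbert
begin
definition cinner_prod :: "'a \<times> 'b \<Rightarrow> 'a \<times> 'b \<Rightarrow> complex"
  where "cinner p q = cinner (fst p) (fst q) + cinner (snd p) (snd q)"
instance
proof
  fix p q r :: "'a \<times> 'b" and c :: complex
  show "cinner p q = cnj (cinner q p)"
    unfolding cinner_prod_def
    by (metis cinner_commute complex_cnj_add)
  show "cinner p (q + r) = cinner p q + cinner p r"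
    by (simp add: cinner_prod_def cinner_add_right)
  show "cinner p (c *\<^sub>C q) = c * cinner p q"
    by (simp add: cinner_prod_def scaleC_prod_def cinner_scaleC_right distrib_left)
  show "cinner p p = complex_of_real ((norm p)\<^sup>2)"
    by (simp add: cinner_prod_def cinner_self norm_prod_def)
qed
end

lemma cinner_add_left: "cinner (x + y) z = cinner x z + cinner y z"
  by (metis cinner_add_right cinner_commute complex_cnj_add)

lemma cinner_scaleC_left: "cinner (c *\<^sub>C x) z = cnj c * cinner x z"
  by (metis cinner_scaleC_right cinner_commute complex_cnj_mult)

lemma norm_scaleC: "norm (c *\<^sub>C x) = cmod c * norm (x::'a::complex_hilbert)"
proof -
  have "complex_of_real ((norm (c *\<^sub>C x))\<^sup>2) = cnj c * c * complex_of_real ((norm x)\<^sup>2)"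
    by (simp only: cinner_self[symmetric] cinner_scaleC_left cinner_scaleC_right ac_simps)
  also have "\<dots> = complex_of_real ((cmod c * norm x)\<^sup>2)"
    by (simp add: power_mult_distrib complex_norm_square mult.commute del: of_real_power)
  finally have "(norm (c *\<^sub>C x))\<^sup>2 = (cmod c * norm x)\<^sup>2"
    by (simp only: of_real_eq_iff)
  then show ?thesis
    by (simp add: power2_eq_iff_nonneg)
qed


section \<open>Bounded operators\<close>

typedef (overloaded) ('a::complex_hilbert) bounded_op =
  "{A :: 'a \<Rightarrow>\<^sub>L 'a. \<forall>c x. blinfun_apply A (c *\<^sub>C x) = c *\<^sub>C blinfun_apply A x}"
  morphisms blinfun_of_op op_of_blinfun
  by (rule exI[of _ 0]) simp

setup_lifting type_definition_bounded_op

lift_definition op_apply :: "'a::complex_hilbert bounded_op \<Rightarrow> 'a \<Rightarrow> 'a" is blinfun_apply .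

instantiation bounded_op :: (complex_hilbert) real_normed_vector
begin
lift_definition zero_bounded_op :: "'a bounded_op" is 0 by simp
lift_definition plus_bounded_op :: "'a bounded_op \<Rightarrow> 'a bounded_op \<Rightarrow> 'a bounded_op" is "(+)"
  by (simp add: blinfun.add_left scaleC_add_right)
lift_definition minus_bounded_op :: "'a bounded_op \<Rightarrow> 'a bounded_op \<Rightarrow> 'a bounded_op" is "(-)"
  by (simp add: blinfun.diff_left cvec.scale_right_diff_distrib)
lift_definition uminus_bounded_op :: "'a bounded_op \<Rightarrow> 'a bounded_op" is uminus
  by (simp add: blinfun.minus_left)
lift_definition scaleR_bounded_op :: "real \<Rightarrow> 'a bounded_op \<Rightarrow> 'a bounded_op" is "(*\<^sub>R)"
  by (simp add: blinfun.scaleR_left scaleR_scaleC scaleC_scaleC mult.commute)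
lift_definition norm_bounded_op :: "'a bounded_op \<Rightarrow> real" is norm .
definition dist_bounded_op :: "'a bounded_op \<Rightarrow> 'a bounded_op \<Rightarrow> real"
  where "dist_bounded_op A B = norm (A - B)"
definition sgn_bounded_op :: "'a bounded_op \<Rightarrow> 'a bounded_op"
  where "sgn_bounded_op A = inverse (norm A) *\<^sub>R A"
definition uniformity_bounded_op :: "('a bounded_op \<times> 'a bounded_op) filter"
  where "uniformity_bounded_op = (INF e\<in>{0 <..}. principal {(A, B). dist A B < e})"
definition open_bounded_op :: "'a bounded_op set \<Rightarrow> bool"
  where "open_bounded_op S = (\<forall>A\<in>S. \<forall>\<^sub>F (A', B) in uniformity. A' = A \<longrightarrow> B \<in> S)"
instance
  apply standard
  unfolding dist_bounded_op_def open_bounded_op_def sgn_bounded_op_def uniformity_bounded_op_def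
  apply (rule refl | (transfer, simp add: algebra_simps norm_triangle_ineq))+
  done
end

lemma bounded_linear_scaleC: "bounded_linear (\<lambda>x::'a::complex_hilbert. c *\<^sub>C x)"
  by (rule bounded_linear_intro[where K = "cmod c"])
    (simp_all add: scaleC_add_right scaleR_scaleC scaleC_scaleC norm_scaleC mult.commute)

lemma bounded_linear_scaleC_blinfun [simp]:
  "bounded_linear (\<lambda>x. c *\<^sub>C blinfun_apply (A :: 'a::complex_hilbert \<Rightarrow>\<^sub>L 'a) x)"
  using bounded_linear_compose[OF bounded_linear_scaleC blinfun.bounded_linear_right[of A]] .

lemma op_eqI: "(\<And>x. op_apply A x = op_apply B x) \<Longrightarrow> A = B"
  by transfer (rule blinfun_eqI)

lemma op_apply_linear [simp]:
  "op_apply 0 x = 0"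
  "op_apply (A + B) x = op_apply A x + op_apply B x"
  "op_apply (A - B) x = op_apply A x - op_apply B x"
  "op_apply (- A) x = - op_apply A x"
  "op_apply (r *\<^sub>R A) x = r *\<^sub>R op_apply A x"
  by (transfer, simp add: blinfun.bilinear_simps)+

lemma op_apply_right [simp]:
  "op_apply A 0 = 0"
  "op_apply A (x + y) = op_apply A x + op_apply A y"
  "op_apply A (c *\<^sub>C x) = c *\<^sub>C op_apply A x"
  by (transfer, simp add: blinfun.bilinear_simps)+

instantiation bounded_op :: (complex_hilbert) complex_vector
begin
lift_definition scaleC_bounded_op :: "complex \<Rightarrow> 'a bounded_op \<Rightarrow> 'a bounded_op"
  is "\<lambda>c A. Blinfun (\<lambda>x. c *\<^sub>C blinfun_apply A x)"
  by (simp add: bounded_linear_Blinfun_apply scaleC_scaleC mult.commute)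

lemma op_apply_scaleC [simp]: "op_apply (c *\<^sub>C A) x = c *\<^sub>C op_apply A x"
  by transfer (simp add: bounded_linear_Blinfun_apply)

instance
proof
  fix A B :: "'a bounded_op" and c d :: complex and r :: real
  show "c *\<^sub>C (A + B) = c *\<^sub>C A + c *\<^sub>C B"
    by (rule op_eqI) (simp add: scaleC_add_right)
  show "(c + d) *\<^sub>C A = c *\<^sub>C A + d *\<^sub>C A"
    by (rule op_eqI) (simp add: scaleC_add_left)
  show "c *\<^sub>C d *\<^sub>C A = (c * d) *\<^sub>C A"
    by (rule op_eqI) (simp add: scaleC_scaleC)
  show "1 *\<^sub>C A = A"
    by (rule op_eqI) (simp add: scaleC_one)
  show "r *\<^sub>R A = complex_of_real r *\<^sub>C A"
    by (rule op_eqI) (simp add: scaleR_scaleC)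
qed
end

instantiation bounded_op :: (complex_hilbert) real_normed_algebra
begin
lift_definition times_bounded_op :: "'a bounded_op \<Rightarrow> 'a bounded_op \<Rightarrow> 'a bounded_op"
  is "(o\<^sub>L)" by simp

lemma op_apply_times [simp]: "op_apply (A * B) x = op_apply A (op_apply B x)"
  by transfer simp

instance
proof
  fix A B C :: "'a bounded_op" and r :: real
  show "A * B * C = A * (B * C)" by (rule op_eqI) simp
  show "(A + B) * C = A * C + B * C" by (rule op_eqI) simp
  show "A * (B + C) = A * B + A * C" by (rule op_eqI) simp
  show "r *\<^sub>R A * B = r *\<^sub>R (A * B)" by (rule op_eqI) simp
  show "A * r *\<^sub>R B = r *\<^sub>R (A * B)" by (rule op_eqI) (simp add: scaleR_scaleC)
  show "norm (A * B) \<le> norm A * norm B" by transfer (rule norm_blinfun_compose)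
qed
end

text \<open>The library class \<open>real_normed_algebra_1\<close> demands \<open>0 \<noteq> 1\<close> and so would exclude \<open>H = 0\<close>.\<close>

instantiation bounded_op :: (complex_hilbert) monoid_mult
begin
lift_definition one_bounded_op :: "'a bounded_op" is id_blinfun by simp

lemma op_apply_one [simp]: "op_apply 1 x = x"
  by transfer simp

instance
proof
  fix A :: "'a bounded_op"
  show "1 * A = A" by (rule op_eqI) simp
  show "A * 1 = A" by (rule op_eqI) simp
qed
end

lemma scaleC_mult_left: "(c *\<^sub>C A) * B = c *\<^sub>C (A * B)" for A B :: "'a::complex_hilbert bounded_op"
  by (rule op_eqI) simp

lemma scaleC_mult_right: "A * (c *\<^sub>C B) = c *\<^sub>C (A * B)" for A B :: "'a::complex_hilbert bounded_op"
  by (rule op_eqI) simp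

definition adj :: "'a::complex_hilbert bounded_op \<Rightarrow> 'a bounded_op"
  where "adj A = (THE B. \<forall>x y. cinner (op_apply B x) y = cinner x (op_apply A y))"

text \<open>The operator matrix with rows \<open>(A, B)\<close> and \<open>(C, D)\<close>.\<close>

lemma bounded_linear_block: "bounded_linear (\<lambda>p.
    (blinfun_apply A (fst p) + blinfun_apply B (snd p), blinfun_apply C (fst p) + blinfun_apply D (snd p)))"
  by (intro bounded_linear_Pair bounded_linear_add bounded_linear_blinfun_apply
      bounded_linear_fst bounded_linear_snd)

lift_definition block_op ::
  "'a::complex_hilbert bounded_op \<Rightarrow> 'a bounded_op \<Rightarrow> 'a bounded_op \<Rightarrow> 'a bounded_op \<Rightarrow> ('a \<times> 'a) bounded_op"
  is "\<lambda>A B C D. Blinfun (\<lambda>p.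
    (blinfun_apply A (fst p) + blinfun_apply B (snd p), blinfun_apply C (fst p) + blinfun_apply D (snd p)))"
  by (simp add: bounded_linear_Blinfun_apply bounded_linear_block scaleC_prod_def scaleC_add_right)

lemma op_apply_block_op:
  "op_apply (block_op A B C D) (x, y) = (op_apply A x + op_apply B y, op_apply C x + op_apply D y)"
  by transfer (simp add: bounded_linear_Blinfun_apply bounded_linear_block)


section \<open>Trace class operators\<close>

definition is_onb :: "'a::complex_hilbert set \<Rightarrow> bool"
  where "is_onb E \<longleftrightarrow> (\<forall>e\<in>E. \<forall>f\<in>E. cinner e f = (if e = f then 1 else 0)) \<and> closure (cspan E) = UNIV"

definition positive_op :: "'a::complex_hilbert bounded_op \<Rightarrow> bool"
  where "positive_op A \<longleftrightarrow> (\<forall>x. cinner x (op_apply A x) \<in> \<real>\<^sub>\<ge>\<^sub>0)"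

definition abs_op :: "'a::complex_hilbert bounded_op \<Rightarrow> 'a bounded_op"
  where "abs_op A = (THE P. positive_op P \<and> P * P = adj A * A)"

text \<open>Neither the summability nor the sums below depend on the choice of the orthonormal basis;
  \<open>infsum\<close> and \<open>summable_on\<close> are unconditional, so arbitrary orthonormal dimension is allowed.\<close>

definition trace_class :: "'a::complex_hilbert bounded_op \<Rightarrow> bool"
  where "trace_class A \<longleftrightarrow> (\<exists>E. is_onb E \<and> (\<lambda>e. cinner e (op_apply (abs_op A) e)) summable_on E)"

definition trace :: "'a::complex_hilbert bounded_op \<Rightarrow> complex"
  where "trace A = (let E = SOME E. is_onb E in \<Sum>\<^sub>\<infinity>e\<in>E. cinner e (op_apply A e))"

definition trace_norm :: "'a::complex_hilbert bounded_op \<Rightarrow> real"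
  where "trace_norm A = Re (trace (abs_op A))"

definition trace_norm_continuous_on :: "real set \<Rightarrow> (real \<Rightarrow> 'a::complex_hilbert bounded_op) \<Rightarrow> bool"
  where "trace_norm_continuous_on S F \<longleftrightarrow>
    (\<forall>t\<in>S. ((\<lambda>s. trace_norm (F s - F t)) \<longlongrightarrow> 0) (at t within S))"


section \<open>Algebraic tensor powers\<close>

text \<open>The type \<open>'v tensor\<close> is the direct sum of all algebraic tensor powers of \<open>'v\<close> over the complex
  numbers: the free complex vector space on words \<open>[x\<^sub>0, \<dots>, x\<^sub>m]\<close> modulo multilinearity in each
  letter. Words of length \<open>m + 1\<close> give the elementary tensors of the \<open>(m + 1)\<close>-fold tensor power.\<close>

definition free_scale :: "complex \<Rightarrow> ('b \<Rightarrow>\<^sub>0 complex) \<Rightarrow> ('b \<Rightarrow>\<^sub>0 complex)"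
  where "free_scale c p = Poly_Mapping.map ((*) c) p"

lemma lookup_free_scale: "Poly_Mapping.lookup (free_scale c p) k = c * Poly_Mapping.lookup p k"
  by (simp add: free_scale_def map.rep_eq when_def)

interpretation free: vector_space "free_scale :: complex \<Rightarrow> ('b \<Rightarrow>\<^sub>0 complex) \<Rightarrow> _"
  by standard (auto intro!: poly_mapping_eqI simp: lookup_free_scale lookup_add algebra_simps)

definition tensor_relators :: "('v::complex_vector list \<Rightarrow>\<^sub>0 complex) set"
  where "tensor_relators =
    {Poly_Mapping.single (xs[k := a + b]) 1 - Poly_Mapping.single (xs[k := a]) 1 - Poly_Mapping.single (xs[k := b]) 1 | xs k a b. k < length xs} \<union>
    {Poly_Mapping.single (xs[k := c *\<^sub>C a]) 1 - free_scale c (Poly_Mapping.single (xs[k := a]) 1) | xs k c a. k < length xs}"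

definition tensor_rel :: "('v::complex_vector list \<Rightarrow>\<^sub>0 complex) \<Rightarrow> ('v list \<Rightarrow>\<^sub>0 complex) \<Rightarrow> bool"
  where "tensor_rel p q \<longleftrightarrow> p - q \<in> module.span free_scale tensor_relators"

lemma equivp_tensor_rel: "equivp tensor_rel"
proof (rule equivpI)
  show "reflp tensor_rel"
    by (simp add: reflp_def tensor_rel_def free.span_zero)
  show "symp tensor_rel"
    unfolding symp_def tensor_rel_def by (metis free.span_neg minus_diff_eq)
  show "transp tensor_rel"
  proof (rule transpI)
    fix p q r
    assume "tensor_rel p q" "tensor_rel q r"
    then have "(p - q) + (q - r) \<in> free.span tensor_relators"
      unfolding tensor_rel_def by (rule free.span_add)
    then show "tensor_rel p r"
      by (simp add: tensor_rel_def)
  qed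
qed

quotient_type (overloaded) 'v tensor = "'v::complex_vector list \<Rightarrow>\<^sub>0 complex" / tensor_rel
  by (rule equivp_tensor_rel)

instantiation tensor :: (complex_vector) complex_vector
begin
lift_definition zero_tensor :: "'a tensor" is 0 .
lift_definition plus_tensor :: "'a tensor \<Rightarrow> 'a tensor \<Rightarrow> 'a tensor" is "(+)"
  unfolding tensor_rel_def add_diff_add by (rule free.span_add)
lift_definition uminus_tensor :: "'a tensor \<Rightarrow> 'a tensor" is uminus
  unfolding tensor_rel_def minus_diff_minus by (rule free.span_neg)
lift_definition minus_tensor :: "'a tensor \<Rightarrow> 'a tensor \<Rightarrow> 'a tensor" is "(-)"
proof -
  fix p p' q q' :: "'a list \<Rightarrow>\<^sub>0 complex"
  assume "tensor_rel p p'" "tensor_rel q q'"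
  then have "(p - p') - (q - q') \<in> free.span tensor_relators"
    unfolding tensor_rel_def by (rule free.span_diff)
  then show "tensor_rel (p - q) (p' - q')"
    unfolding tensor_rel_def by (simp add: algebra_simps)
qed
lift_definition scaleC_tensor :: "complex \<Rightarrow> 'a tensor \<Rightarrow> 'a tensor" is free_scale
  unfolding tensor_rel_def free.scale_right_diff_distrib[symmetric] by (rule free.span_scale)
lift_definition scaleR_tensor :: "real \<Rightarrow> 'a tensor \<Rightarrow> 'a tensor" is "\<lambda>r. free_scale (complex_of_real r)"
  unfolding tensor_rel_def free.scale_right_diff_distrib[symmetric] by (rule free.span_scale)
instance
  by standard (transfer; simp add: equivp_reflp[OF equivp_tensor_rel] algebra_simps
      free.scale_right_distrib free.scale_left_distrib)+
end

lift_definition elem_tensor :: "'v::complex_vector list \<Rightarrow> 'v tensor" is "\<lambda>xs. Poly_Mapping.single xs 1" .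

abbreviation clinear :: "('v::complex_vector \<Rightarrow> 'w::complex_vector) \<Rightarrow> bool"
  where "clinear \<equiv> Vector_Spaces.linear (*\<^sub>C) (*\<^sub>C)"

definition multilinear :: "('v::complex_vector list \<Rightarrow> 'w::complex_vector) \<Rightarrow> bool"
  where "multilinear f \<longleftrightarrow> (\<forall>xs. \<forall>k<length xs. clinear (\<lambda>a. f (xs[k := a])))"

text \<open>The linear map on tensors with values \<open>f xs\<close> on elementary tensors. It is computed on a
  representative, and for multilinear \<open>f\<close> the choice does not matter
  (\<open>clinear_tensor_lift\<close>, \<open>tensor_lift_elem\<close>).\<close>

definition free_lift :: "('b \<Rightarrow> 'w::complex_vector) \<Rightarrow> ('b \<Rightarrow>\<^sub>0 complex) \<Rightarrow> 'w"
  where "free_lift f p = (\<Sum>k\<in>Poly_Mapping.keys p. Poly_Mapping.lookup p k *\<^sub>C f k)"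

definition tensor_lift :: "('v::complex_vector list \<Rightarrow> 'w::complex_vector) \<Rightarrow> 'v tensor \<Rightarrow> 'w"
  where "tensor_lift f x = free_lift f (rep_tensor x)"

lemma free_lift_superset:
  assumes "finite S" "Poly_Mapping.keys p \<subseteq> S"
  shows "free_lift f p = (\<Sum>k\<in>S. Poly_Mapping.lookup p k *\<^sub>C f k)"
  unfolding free_lift_def using assms
  by (intro sum.mono_neutral_left) (auto simp: in_keys_iff)

lemma free_lift_add: "free_lift f (p + q) = free_lift f p + free_lift f q"
proof -
  let ?S = "Poly_Mapping.keys p \<union> Poly_Mapping.keys q"
  have "free_lift f (p + q) = (\<Sum>k\<in>?S. Poly_Mapping.lookup (p + q) k *\<^sub>C f k)"
    by (rule free_lift_superset) (simp_all add: Poly_Mapping.keys_add)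
  also have "\<dots> = (\<Sum>k\<in>?S. Poly_Mapping.lookup p k *\<^sub>C f k) + (\<Sum>k\<in>?S. Poly_Mapping.lookup q k *\<^sub>C f k)"
    by (simp add: lookup_add scaleC_add_left sum.distrib)
  also have "\<dots> = free_lift f p + free_lift f q"
    by (simp add: free_lift_superset[of ?S])
  finally show ?thesis .
qed

lemma free_lift_scale: "free_lift f (free_scale c p) = c *\<^sub>C free_lift f p"
proof -
  have "free_lift f (free_scale c p) =
      (\<Sum>k\<in>Poly_Mapping.keys p. Poly_Mapping.lookup (free_scale c p) k *\<^sub>C f k)"
    by (rule free_lift_superset) (auto simp: in_keys_iff lookup_free_scale)
  then show ?thesis
    by (simp add: lookup_free_scale free_lift_def cvec.scale_sum_right scaleC_scaleC)
qed

lemma free_lift_diff: "free_lift f (p - q) = free_lift f p - free_lift f q"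
  by (metis add_diff_cancel diff_add_cancel free_lift_add)

lemma free_lift_single: "free_lift f (Poly_Mapping.single xs 1) = f xs"
  by (simp add: free_lift_def scaleC_one)

lemma free_lift_relators:
  assumes "multilinear f" "p \<in> module.span free_scale tensor_relators"
  shows "free_lift f p = 0"
  using assms(2)
proof (induction rule: free.span_induct_alt)
  case base
  show ?case by (simp add: free_lift_def)
next
  case (step c r q)
  have "free_lift f r = 0"
    using step.hyps(1) assms(1) unfolding tensor_relators_def multilinear_def
    by (auto simp: free_lift_diff free_lift_scale free_lift_single
        Vector_Spaces.linear_iff)
  with step.IH show ?case
    by (simp add: free_lift_add free_lift_scale)
qed

lemma tensor_lift_abs:
  assumes "multilinear f"
  shows "tensor_lift f (abs_tensor p) = free_lift f p"
proof -
  have "tensor_rel (rep_tensor (abs_tensor p)) p"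
    using Quotient3_rep_abs[OF Quotient3_tensor] equivp_reflp[OF equivp_tensor_rel] by metis
  then have "free_lift f (rep_tensor (abs_tensor p) - p) = 0"
    unfolding tensor_rel_def by (rule free_lift_relators[OF assms])
  then show ?thesis
    by (simp add: tensor_lift_def free_lift_diff)
qed

lemma clinear_tensor_lift:
  assumes "multilinear f"
  shows "clinear (tensor_lift f)"
proof -
  have lift_rep: "tensor_lift f x = free_lift f (rep_tensor x)" "abs_tensor (rep_tensor x) = x" for x
    by (simp_all add: tensor_lift_def Quotient3_abs_rep[OF Quotient3_tensor])
  have "tensor_lift f (x + y) = tensor_lift f x + tensor_lift f y" for x y
    using tensor_lift_abs[OF assms, of "rep_tensor x + rep_tensor y"]
    by (simp add: lift_rep free_lift_add plus_tensor.abs_eq[symmetric])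
  moreover have "tensor_lift f (c *\<^sub>C x) = c *\<^sub>C tensor_lift f x" for c x
    using tensor_lift_abs[OF assms, of "free_scale c (rep_tensor x)"]
    by (simp add: lift_rep free_lift_scale scaleC_tensor.abs_eq[symmetric])
  ultimately show ?thesis
    by (simp add: Vector_Spaces.linear_iff vector_space_scaleC)
qed

lemma tensor_lift_elem: "multilinear f \<Longrightarrow> tensor_lift f (elem_tensor xs) = f xs"
  by (simp add: elem_tensor.abs_eq tensor_lift_abs free_lift_single)

lemma multilinear_elem_tensor: "multilinear elem_tensor"
proof -
  have add: "elem_tensor (xs[k := a + b]) = elem_tensor (xs[k := a]) + elem_tensor (xs[k := b])"
    if k: "k < length xs" for xs :: "'v::complex_vector list" and k a b
  proof -
    have "Poly_Mapping.single (xs[k := a + b]) 1 - Poly_Mapping.single (xs[k := a]) 1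
        - Poly_Mapping.single (xs[k := b]) 1 \<in> tensor_relators"
      using k unfolding tensor_relators_def by blast
    from free.span_base[OF this]
    have "tensor_rel (Poly_Mapping.single (xs[k := a + b]) 1)
        (Poly_Mapping.single (xs[k := a]) 1 + Poly_Mapping.single (xs[k := b]) 1)"
      unfolding tensor_rel_def by (simp only: diff_diff_eq)
    then show ?thesis
      by transfer
  qed
  have scale: "elem_tensor (xs[k := c *\<^sub>C a]) = c *\<^sub>C elem_tensor (xs[k := a])"
    if k: "k < length xs" for xs :: "'v::complex_vector list" and k c a
  proof -
    have "Poly_Mapping.single (xs[k := c *\<^sub>C a]) 1 - free_scale c (Poly_Mapping.single (xs[k := a]) 1)
        \<in> tensor_relators"
      using k unfolding tensor_relators_def by blast
    from free.span_base[OF this]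
    have "tensor_rel (Poly_Mapping.single (xs[k := c *\<^sub>C a]) 1)
        (free_scale c (Poly_Mapping.single (xs[k := a]) 1))"
      unfolding tensor_rel_def .
    then show ?thesis
      by transfer
  qed
  show ?thesis
    by (simp add: multilinear_def Vector_Spaces.linear_iff vector_space_scaleC add scale)
qed


section \<open>Multiplication, cyclic shift and Hochschild boundary\<close>

definition tensor_mult :: "'h::complex_hilbert bounded_op tensor \<Rightarrow> 'h bounded_op"
  where "tensor_mult = tensor_lift prod_list"

lemma prod_list_update_split:
  "k < length xs \<Longrightarrow> prod_list (xs[k := a]) = prod_list (take k xs) * a * prod_list (drop (Suc k) xs)"
  for xs :: "'a::monoid_mult list"
  by (simp add: upd_conv_take_nth_drop mult.assoc)

lemma tensor_mult_elem: "tensor_mult (elem_tensor xs) = prod_list xs"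
  unfolding tensor_mult_def
  by (rule tensor_lift_elem)
    (simp add: multilinear_def Vector_Spaces.linear_iff vector_space_scaleC prod_list_update_split
      distrib_left distrib_right scaleC_mult_left scaleC_mult_right)

definition cyclic_word :: "'v::complex_vector list \<Rightarrow> 'v tensor"
  where "cyclic_word xs = (- 1) ^ (length xs - 1) *\<^sub>C elem_tensor (last xs # butlast xs)"

definition cyclic_shift :: "'v::complex_vector tensor \<Rightarrow> 'v tensor"
  where "cyclic_shift = tensor_lift cyclic_word"

lemma multilinear_scaleC: "multilinear f \<Longrightarrow> multilinear (\<lambda>xs. c xs *\<^sub>C f xs)"
  if "\<And>xs k a. c (xs[k := a]) = c xs"
  using that
  by (simp add: multilinear_def Vector_Spaces.linear_iff vector_space_scaleC scaleC_add_right
      scaleC_scaleC mult.commute)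

lemma multilinear_elem_tensor_word:
  assumes "\<And>xs k. k < length xs \<Longrightarrow> \<exists>ys j L. j < length ys \<and> clinear L \<and> (\<forall>a. \<phi> (xs[k := a]) = ys[j := L a])"
  shows "multilinear (\<lambda>xs. elem_tensor (\<phi> xs))"
  unfolding multilinear_def
proof (intro allI impI)
  fix xs :: "'a list" and k
  assume "k < length xs"
  from assms[OF this] obtain ys j L
    where *: "j < length ys" "clinear L" "\<And>a. \<phi> (xs[k := a]) = ys[j := L a]" by blast
  have "clinear (\<lambda>b. elem_tensor (ys[j := b]))"
    using multilinear_elem_tensor *(1) unfolding multilinear_def by blast
  with *(2) show "clinear (\<lambda>a. elem_tensor (\<phi> (xs[k := a])))"
    unfolding *(3) by (simp add: Vector_Spaces.linear_iff)
qed

lemma clinear_id: "clinear (\<lambda>a. a)"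
  by (simp add: Vector_Spaces.linear_iff vector_space_scaleC)

lemma cyclic_shift_elem:
  "cyclic_shift (elem_tensor xs) = (- 1) ^ (length xs - 1) *\<^sub>C elem_tensor (last xs # butlast xs)"
proof -
  have "multilinear (\<lambda>xs::'a list. elem_tensor (last xs # butlast xs))"
  proof (rule multilinear_elem_tensor_word)
    fix xs :: "'a list" and k
    assume k: "k < length xs"
    then have "xs \<noteq> []" by auto
    show "\<exists>ys j L. j < length ys \<and> clinear L \<and>
        (\<forall>a. last (xs[k := a]) # butlast (xs[k := a]) = ys[j := L a])"
    proof (cases "k = length xs - 1")
      case True
      with k have "\<forall>a. last (xs[k := a]) # butlast (xs[k := a]) = (last xs # butlast xs)[0 := a]"
        using \<open>xs \<noteq> []\<close> by (simp add: last_list_update butlast_list_update)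
      then show ?thesis using clinear_id by fastforce
    next
      case False
      with k have "\<forall>a. last (xs[k := a]) # butlast (xs[k := a]) = (last xs # butlast xs)[Suc k := a]"
        using \<open>xs \<noteq> []\<close> by (simp add: last_list_update butlast_list_update)
      moreover have "Suc k < length (last xs # butlast xs)"
        using k False by auto
      ultimately show ?thesis using clinear_id by blast
    qed
  qed
  then have "multilinear (cyclic_word :: 'a list \<Rightarrow> _)"
    using multilinear_scaleC[of "\<lambda>xs. (- 1) ^ (length xs - 1)" "\<lambda>xs::'a list. elem_tensor (last xs # butlast xs)"]
    unfolding cyclic_word_def[abs_def] by simp
  then show ?thesis
    by (simp add: cyclic_shift_def tensor_lift_elem cyclic_word_def)
qed

text \<open>On words of length one the boundary vanishes, since the complex starts in degree \<open>0\<close>.\<close>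

definition boundary_word :: "'h::complex_hilbert bounded_op list \<Rightarrow> 'h bounded_op tensor"
  where "boundary_word xs = (let m = length xs - 1 in
    if m = 0 then 0
    else (\<Sum>i<m. (- 1) ^ i *\<^sub>C elem_tensor (take i xs @ [xs ! i * xs ! (i + 1)] @ drop (i + 2) xs))
       + (- 1) ^ m *\<^sub>C elem_tensor ([xs ! m * xs ! 0] @ take (m - 1) (drop 1 xs)))"

definition hochschild_boundary :: "'h::complex_hilbert bounded_op tensor \<Rightarrow> 'h bounded_op tensor"
  where "hochschild_boundary = tensor_lift boundary_word"

lemma clinear_mult_op:
  "clinear (\<lambda>a. a * b)" "clinear (\<lambda>a. b * a)" for b :: "'h::complex_hilbert bounded_op"
  by (simp_all add: Vector_Spaces.linear_iff vector_space_scaleC distrib_left distrib_right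
      scaleC_mult_left scaleC_mult_right)

lemma inner_face_update:
  fixes xs :: "'h::complex_hilbert bounded_op list"
  defines "\<phi> \<equiv> \<lambda>i xs. take i xs @ [xs ! i * xs ! (i + 1)] @ drop (i + 2) xs"
  assumes "i + 1 < length xs" "k < length xs"
  shows "\<exists>ys j L. j < length ys \<and> clinear L \<and> (\<forall>a. \<phi> i (xs[k := a]) = ys[j := L a])"
proof -
  have len: "length (\<phi> i xs) = length xs - 1"
    using assms(2) by (simp add: \<phi>_def)
  consider "k < i" | "k = i" | "k = i + 1" | "i + 1 < k" by linarith
  then show ?thesis
  proof cases
    case 1
    with assms(2) have "\<phi> i (xs[k := a]) = (\<phi> i xs)[k := a]" for a
      by (simp add: \<phi>_def list_update_append take_update_swap)
    moreover have "k < length (\<phi> i xs)" using 1 assms(2) len by linarith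
    ultimately show ?thesis using clinear_id by blast
  next
    case 2
    with assms(2) have "\<phi> i (xs[k := a]) = (\<phi> i xs)[i := a * xs ! (i + 1)]" for a
      by (simp add: \<phi>_def list_update_append)
    moreover have "i < length (\<phi> i xs)" using assms(2) len by linarith
    ultimately show ?thesis using clinear_mult_op(1) by blast
  next
    case 3
    with assms(2) have "\<phi> i (xs[k := a]) = (\<phi> i xs)[i := xs ! i * a]" for a
      by (simp add: \<phi>_def list_update_append)
    moreover have "i < length (\<phi> i xs)" using assms(2) len by linarith
    ultimately show ?thesis using clinear_mult_op(2) by blast
  next
    case 4
    then obtain d where d: "k = i + 2 + d" using less_eqE[of "i + 2" k] by auto
    with assms(2) have "\<phi> i (xs[k := a]) = (\<phi> i xs)[k - 1 := a]" for a
      by (simp add: \<phi>_def list_update_append drop_update_swap)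
    moreover have "k - 1 < length (\<phi> i xs)" using 4 assms(3) len by linarith
    ultimately show ?thesis using clinear_id by blast
  qed
qed

lemma outer_face_update:
  fixes xs :: "'h::complex_hilbert bounded_op list"
  defines "\<phi> \<equiv> \<lambda>m xs. [xs ! m * xs ! 0] @ take (m - 1) (drop 1 xs)"
  assumes "length xs = m + 1" "0 < m" "k < length xs"
  shows "\<exists>ys j L. j < length ys \<and> clinear L \<and> (\<forall>a. \<phi> m (xs[k := a]) = ys[j := L a])"
proof -
  have len: "length (\<phi> m xs) = m"
    using assms(2,3) by (simp add: \<phi>_def)
  consider "k = 0" | "k = m" | "0 < k" "k < m" using assms(2,4) by linarith
  then show ?thesis
  proof cases
    case 1
    with assms(2,3) have "\<phi> m (xs[k := a]) = (\<phi> m xs)[0 := xs ! m * a]" for a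
      by (simp add: \<phi>_def)
    then show ?thesis using clinear_mult_op(2) len assms(3) by metis
  next
    case 2
    with assms(2,3) have "\<phi> m (xs[k := a]) = (\<phi> m xs)[0 := a * xs ! 0]" for a
      by (simp add: \<phi>_def drop_update_swap)
    then show ?thesis using clinear_mult_op(1) len assms(3) by metis
  next
    case 3
    then obtain d where d: "k = Suc d" using gr0_implies_Suc by blast
    with 3 assms(2,3) have "\<phi> m (xs[k := a]) = (\<phi> m xs)[k := a]" for a
      by (simp add: \<phi>_def drop_update_swap take_update_swap)
    then show ?thesis using clinear_id len 3 by metis
  qed
qed

lemma clinear_sum: "(\<And>i. i \<in> I \<Longrightarrow> clinear (f i)) \<Longrightarrow> clinear (\<lambda>a. \<Sum>i\<in>I. f i a)"
  by (simp add: Vector_Spaces.linear_iff vector_space_scaleC sum.distrib cvec.scale_sum_right)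

lemma hochschild_boundary_elem:
  "hochschild_boundary (elem_tensor xs) = boundary_word xs"
  for xs :: "'h::complex_hilbert bounded_op list"
proof -
  have "multilinear (boundary_word :: 'h bounded_op list \<Rightarrow> _)"
    unfolding multilinear_def
  proof (intro allI impI)
    fix xs :: "'h bounded_op list" and k
    assume k: "k < length xs"
    define m where "m = length xs - 1"
    have comp: "clinear (\<lambda>a. c *\<^sub>C elem_tensor (\<psi> a))"
      if ex: "\<exists>ys j L. j < length ys \<and> clinear L \<and> (\<forall>a. \<psi> a = ys[j := L a])"
      for \<psi> :: "'h bounded_op \<Rightarrow> 'h bounded_op list" and c
    proof -
      obtain ys j L where *: "j < length ys" "clinear L" "\<And>a. \<psi> a = ys[j := L a]"
        using ex by blast
      have "clinear (\<lambda>b. elem_tensor (ys[j := b]))"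
        using multilinear_elem_tensor *(1) unfolding multilinear_def by blast
      with *(2) show ?thesis
        unfolding *(3) by (simp add: Vector_Spaces.linear_iff scaleC_add_right scaleC_scaleC mult.commute)
    qed
    show "clinear (\<lambda>a. boundary_word (xs[k := a]))"
    proof (cases "m = 0")
      case True
      then show ?thesis
        by (simp add: boundary_word_def Let_def m_def Vector_Spaces.linear_iff vector_space_scaleC)
    next
      case False
      with k have len: "length xs = m + 1" by (simp add: m_def)
      define inner where "inner = (\<lambda>a. \<Sum>i<m. (- 1) ^ i *\<^sub>C elem_tensor
        (take i (xs[k := a]) @ [xs[k := a] ! i * xs[k := a] ! (i + 1)] @ drop (i + 2) (xs[k := a])))"
      define outer where "outer = (\<lambda>a. (- 1) ^ m *\<^sub>C elem_tensor
        ([xs[k := a] ! m * xs[k := a] ! 0] @ take (m - 1) (drop 1 (xs[k := a]))))"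
      have "clinear inner"
        unfolding inner_def
      proof (rule clinear_sum, rule comp)
        fix i assume "i \<in> {..<m}"
        then show "\<exists>ys j L. j < length ys \<and> clinear L \<and> (\<forall>a. take i (xs[k := a]) @
            [xs[k := a] ! i * xs[k := a] ! (i + 1)] @ drop (i + 2) (xs[k := a]) = ys[j := L a])"
          using inner_face_update[of i xs k] k len by simp
      qed
      moreover have "clinear outer"
        unfolding outer_def using outer_face_update[OF len _ k] False by (intro comp) simp
      ultimately have "clinear (\<lambda>a. inner a + outer a)"
        by (simp add: Vector_Spaces.linear_iff scaleC_add_right)
      moreover have "boundary_word (xs[k := a]) = inner a + outer a" for a
        using False by (simp add: boundary_word_def len inner_def outer_def)
      ultimately show ?thesis by simp
    qed
  qed
  then show ?thesis
    by (simp add: hochschild_boundary_def tensor_lift_elem)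
qed


section \<open>The complex of completions\<close>

definition admissible :: "nat \<Rightarrow> 'h::complex_hilbert bounded_op list \<Rightarrow> bool"
  where "admissible m xs \<longleftrightarrow> length xs = m + 1 \<and> (\<forall>i\<le>m. trace_class (prod_list (drop i xs @ take i xs)))"

definition K_alg :: "nat \<Rightarrow> 'h::complex_hilbert bounded_op tensor set"
  where "K_alg m = cspan {elem_tensor xs | xs. admissible m xs}"

definition K_norm :: "nat \<Rightarrow> 'h::complex_hilbert bounded_op tensor \<Rightarrow> real"
  where "K_norm m x = Inf {(\<Sum>xs\<leftarrow>js. (\<Sum>i\<le>m. trace_norm (tensor_mult ((cyclic_shift ^^ i) (elem_tensor xs))))
                                  + prod_list (map norm xs))
    | js. (\<forall>xs\<in>set js. admissible m xs) \<and> x = (\<Sum>xs\<leftarrow>js. elem_tensor xs)}"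

text \<open>The completion is realised as Cauchy sequences modulo null sequences, a quotient of additive
  groups written with the multiplicative notation of HOL-Algebra.\<close>

definition cauchy_group :: "nat \<Rightarrow> (nat \<Rightarrow> 'h::complex_hilbert bounded_op tensor) monoid"
  where "cauchy_group m =
    \<lparr>carrier = {X. (\<forall>k. X k \<in> K_alg m) \<and> (\<forall>\<epsilon>>0. \<exists>N. \<forall>i\<ge>N. \<forall>j\<ge>N. K_norm m (X i - X j) < \<epsilon>)},
     monoid.mult = (\<lambda>X Y k. X k + Y k),
     one = (\<lambda>k. 0)\<rparr>"

definition null_sequences :: "nat \<Rightarrow> (nat \<Rightarrow> 'h::complex_hilbert bounded_op tensor) set"
  where "null_sequences m = {X \<in> carrier (cauchy_group m). (\<lambda>k. K_norm m (X k)) \<longlonglongrightarrow> 0}"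

definition K_completion :: "nat \<Rightarrow> (nat \<Rightarrow> 'h::complex_hilbert bounded_op tensor) set monoid"
  where "K_completion m = cauchy_group m Mod null_sequences m"

definition K_class :: "nat \<Rightarrow> (nat \<Rightarrow> 'h::complex_hilbert bounded_op tensor)
    \<Rightarrow> (nat \<Rightarrow> 'h bounded_op tensor) set"
  where "K_class m X = null_sequences m #>\<^bsub>cauchy_group m\<^esub> X"

text \<open>The continuous extension of the boundary acts termwise on Cauchy sequences; all members \<open>X\<close> of
  a class contribute the same class to the union.\<close>

definition K_boundary :: "nat \<Rightarrow> (nat \<Rightarrow> 'h::complex_hilbert bounded_op tensor) set
    \<Rightarrow> (nat \<Rightarrow> 'h bounded_op tensor) set"
  where "K_boundary m \<xi> = (\<Union>X\<in>\<xi>. K_class (m - 1) (\<lambda>k. hochschild_boundary (X k)))"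

text \<open>On \<open>K\<^sub>0\<close> the operator \<open>1 - t\<close> vanishes, so \<open>H\<^sub>0\<^sup>\<lambda>(K) = K\<^sub>0 / b(K\<^sub>1)\<close>.\<close>

definition boundaries0 :: "(nat \<Rightarrow> 'h::complex_hilbert bounded_op tensor) set set"
  where "boundaries0 = K_boundary 1 ` carrier (K_completion 1)"

definition H0_lambda :: "(nat \<Rightarrow> 'h::complex_hilbert bounded_op tensor) set set monoid"
  where "H0_lambda = K_completion 0 Mod boundaries0"

text \<open>A trace class operator, viewed in \<open>K\<^sub>0\<close> through the constant sequence, and its class.\<close>

definition K0_of :: "'h::complex_hilbert bounded_op \<Rightarrow> (nat \<Rightarrow> 'h bounded_op tensor) set"
  where "K0_of A = K_class 0 (\<lambda>_. elem_tensor [A])"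

definition H0_class :: "'h::complex_hilbert bounded_op \<Rightarrow> (nat \<Rightarrow> 'h bounded_op tensor) set set"
  where "H0_class A = boundaries0 #>\<^bsub>K_completion 0\<^esub> K0_of A"


section \<open>Homological index\<close>

definition R_plus :: "'h::complex_hilbert bounded_op \<Rightarrow> 'h bounded_op"
  where "R_plus T = 1 - adj T * T"

definition R_minus :: "'h::complex_hilbert bounded_op \<Rightarrow> 'h bounded_op"
  where "R_minus T = 1 - T * adj T"

definition R_total :: "'h::complex_hilbert bounded_op \<Rightarrow> ('h \<times> 'h) bounded_op"
  where "R_total T = block_op (R_plus T) 0 0 (R_minus T)"

definition T_total :: "'h::complex_hilbert bounded_op \<Rightarrow> ('h \<times> 'h) bounded_op"
  where "T_total T = block_op 0 (adj T) T 0"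

definition H_Ind :: "nat \<Rightarrow> 'h::complex_hilbert bounded_op \<Rightarrow> complex"
  where "H_Ind n T = trace ((1 - adj T * T) ^ n - (1 - T * adj T) ^ n)"

end

theory Submission
  imports Defs
begin

text \<open>
  Let \<open>u = T\<close>, \<open>v = T\<^sup>*\<close>, \<open>P = 1 - v u\<close>, \<open>M = 1 - u v\<close> at time \<open>t\<close>, let \<open>a\<close> and \<open>b\<close> be the derivatives of \<open>u\<close> and \<open>v\<close>, and
  \<open>X\<close> and \<open>W\<close> those of \<open>P\<^sup>n\<close> and \<open>M\<^sup>n\<close>. The hypotheses on \<open>H \<oplus> H\<close> say, entry by entry, that \<open>X\<close>, \<open>W\<close>, \<open>a P\<^sup>n\<close> and
  \<open>b M\<^sup>n\<close> are trace norm continuous paths in the trace class. With \<open>Q = 1 + M + \<dots> + M\<^sup>n\<^sup>-\<^sup>1\<close>, so that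
  \<open>1 - P\<^sup>n = v Q u\<close>, the intertwining relations \<open>u P = M u\<close>, \<open>v M = P v\<close> and the derivative of
  \<open>u P\<^sup>n = M\<^sup>n u\<close> show that \<open>X - W\<close> is a finite sum of commutators (\<open>derivative_difference_commutators\<close>). Each
  is of the form \<open>[A, B]\<close> with \<open>A\<close> trace class, except for the last one, \<open>[M\<^sup>n, a v Q]\<close>, of which only the two products
  are trace class. That is exactly what the complex allows: the words \<open>A \<otimes> B\<close> are admissible, and
  their sum \<open>\<Theta>\<^sub>t\<close> satisfies \<open>b \<Theta>\<^sub>t = X\<^sub>t - W\<^sub>t\<close>.

  The path \<open>\<Theta>\<close> is continuous for the norm of \<open>K\<^sub>1\<close>. For the word \<open>M\<^sup>n \<otimes> a v Q\<close> this uses that the increments of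
  \<open>M\<^sup>n\<close> are small in trace norm, although \<open>M\<^sup>n\<close> itself need not be trace class (\<open>K_path_word\<close>). Hence the Riemann
  sums of \<open>\<Theta>\<close> are Cauchy and define an element of \<open>K\<^sub>1\<close> (\<open>riemann_sums_cauchy\<close>), while those of \<open>X - W\<close> tend
  in trace norm to the increment of \<open>P\<^sup>n - M\<^sup>n\<close> over \<open>[0,1]\<close> (\<open>fundamental_theorem_trace_norm\<close>). Up to sign that
  increment is the operator in question, which is therefore a boundary.

  For the index it remains to see that every one of these commutators has trace zero. With a trace
  class factor this is the usual cyclicity of the trace. For \<open>[M\<^sup>n, a v Q]\<close> it follows from the self-adjointness of \<open>M\<^sup>n\<close>:
  inserting \<open>S (S\<^sup>2 + \<epsilon>)\<^sup>-\<^sup>1 S\<close> with \<open>S = M\<^sup>n\<close> reduces it to the former case, and \<open>\<epsilon> \<rightarrow> 0\<close> is harmless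
  (\<open>trace_selfadjoint_commute\<close>).

  All trace norm estimates rest on a description by duality: the trace norm of \<open>A\<close> is the
  supremum of \<open>\<bar>Tr (A F)\<bar>\<close> over finite rank contractions \<open>F\<close> (\<open>nuclear_le_iff\<close>). In this form the triangle
  inequality, the ideal property, lower semicontinuity and a mean value inequality are immediate. Only
  the identification with the definition through \<open>\<bar>A\<bar>\<close> and orthonormal bases takes work: square roots of
  positive operators, Parseval's identity, and an approximate polar decomposition.
\<close>


section \<open>Geometry of complex Hilbert spaces\<close>

lemma cinner_zero_right [simp]: "cinner x 0 = 0"
  using cinner_scaleC_right[of x 0 0] by simp

lemma cinner_zero_left [simp]: "cinner 0 x = 0"
  by (subst cinner_commute) simp

lemma cinner_minus_right: "cinner x (- y) = - cinner x y"
  using cinner_add_right[of x y "- y"] by (simp add: eq_neg_iff_add_eq_0 add.commute)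

lemma cinner_minus_left: "cinner (- x) y = - cinner x y"
  using cinner_add_left[of x "- x" y] by (simp add: eq_neg_iff_add_eq_0 add.commute)

lemma cinner_diff_right: "cinner x (y - z) = cinner x y - cinner x z"
  using cinner_add_right[of x y "- z"] by (simp add: cinner_minus_right)

lemma cinner_diff_left: "cinner (x - y) z = cinner x z - cinner y z"
  using cinner_add_left[of x "- y" z] by (simp add: cinner_minus_left)

lemma cinner_scaleR_right: "cinner x (r *\<^sub>R y) = of_real r * cinner x y"
  by (simp add: scaleR_scaleC cinner_scaleC_right)

lemma cinner_scaleR_left: "cinner (r *\<^sub>R x) y = of_real r * cinner x y"
  by (simp add: scaleR_scaleC cinner_scaleC_left)

lemma cinner_sum_right: "cinner x (\<Sum>i\<in>I. f i) = (\<Sum>i\<in>I. cinner x (f i))"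
  by (induction I rule: infinite_finite_induct) (simp_all add: cinner_add_right)

lemmas cinner_simps = cinner_add_right cinner_add_left cinner_diff_right cinner_diff_left
  cinner_minus_right cinner_minus_left cinner_scaleC_right cinner_scaleC_left
  cinner_scaleR_right cinner_scaleR_left

lemma norm_power2_cinner: "(norm x)\<^sup>2 = Re (cinner x x)"
  by (simp add: cinner_self)

lemma op_apply_more [simp]:
  "op_apply A (- x) = - op_apply A x"
  "op_apply A (x - y) = op_apply A x - op_apply A y"
  "op_apply A (r *\<^sub>R x) = r *\<^sub>R op_apply A x"
proof -
  show minus: "op_apply A (- x) = - op_apply A x" for x
    using op_apply_right(2)[of A x "- x"] by (simp add: eq_neg_iff_add_eq_0 add.commute)
  show "op_apply A (x - y) = op_apply A x - op_apply A y"
    using op_apply_right(2)[of A x "- y"] by (simp add: minus)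
  show "op_apply A (r *\<^sub>R x) = r *\<^sub>R op_apply A x"
    by (simp add: scaleR_scaleC)
qed

text \<open>Complex polarization: a form with real values on the diagonal is Hermitian.\<close>

lemma positive_op_hermitian:
  assumes "positive_op P"
  shows "cinner x (op_apply P y) = cinner (op_apply P x) y"
proof -
  have real: "Im (cinner z (op_apply P z)) = 0" for z
    using assms unfolding positive_op_def complex_nonneg_Reals_iff by simp
  have a: "Im (cinner x (op_apply P y)) = - Im (cinner y (op_apply P x))"
    using real[of "x + y"] real[of x] real[of y] by (simp add: cinner_simps)
  have b: "Re (cinner x (op_apply P y)) = Re (cinner y (op_apply P x))"
    using real[of "x + \<i> *\<^sub>C y"] real[of x] real[of y] by (simp add: cinner_simps)
  have "cinner x (op_apply P y) = cnj (cinner y (op_apply P x))"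
    using a b by (simp add: complex_eq_iff)
  then show ?thesis
    by (metis cinner_commute)
qed

lemma positive_opD: "positive_op P \<Longrightarrow> cinner x (op_apply P x) = of_real (Re (cinner x (op_apply P x)))"
  "positive_op P \<Longrightarrow> 0 \<le> Re (cinner x (op_apply P x))"
  unfolding positive_op_def complex_nonneg_Reals_iff by (simp_all add: complex_eq_iff)

text \<open>The Cauchy--Schwarz inequality for the semidefinite form of a positive operator; the
  identity operator gives the usual one.\<close>

lemma positive_op_cauchy_schwarz:
  assumes P: "positive_op P"
  shows "(cmod (cinner x (op_apply P y)))\<^sup>2 \<le> Re (cinner x (op_apply P x)) * Re (cinner y (op_apply P y))"
proof -
  define b where "b = cinner x (op_apply P y)"
  define a where "a = Re (cinner x (op_apply P x))"
  define c where "c = Re (cinner y (op_apply P y))"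
  have yx: "cinner y (op_apply P x) = cnj b"
    unfolding b_def by (metis positive_op_hermitian[OF P] cinner_commute)
  have a0: "0 \<le> a" and c0: "0 \<le> c"
    using positive_opD(2)[OF P] by (simp_all add: a_def c_def)
  have quad: "0 \<le> c - 2 * t * (cmod b)\<^sup>2 + t\<^sup>2 * (cmod b)\<^sup>2 * a" for t :: real
  proof -
    define s where "s = - complex_of_real t * b"
    have "0 \<le> Re (cinner (y + s *\<^sub>C x) (op_apply P (y + s *\<^sub>C x)))"
      by (rule positive_opD(2)[OF P])
    also have "cinner (y + s *\<^sub>C x) (op_apply P (y + s *\<^sub>C x))
       = cinner y (op_apply P y) + s * cnj b + cnj s * b + s * cnj s * cinner x (op_apply P x)"
      by (simp add: cinner_simps yx b_def[symmetric] algebra_simps)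
    also have "\<dots> = of_real c - of_real (2 * t) * (b * cnj b) + of_real (t\<^sup>2) * (b * cnj b) * of_real a"
      unfolding c_def a_def positive_opD(1)[OF P, symmetric]
      by (simp add: s_def algebra_simps power2_eq_square)
    also have "Re \<dots> = c - 2 * t * (cmod b)\<^sup>2 + t\<^sup>2 * (cmod b)\<^sup>2 * a"
      by (simp add: complex_norm_square[symmetric] flip: of_real_power of_real_mult)
    finally show ?thesis .
  qed
  have "(cmod b)\<^sup>2 \<le> a * c"
  proof (cases "a = 0")
    case True
    have "(cmod b)\<^sup>2 = 0"
    proof (rule ccontr)
      assume nz: "(cmod b)\<^sup>2 \<noteq> 0"
      have "0 \<le> c - 2 * ((c + 1) / (2 * (cmod b)\<^sup>2)) * (cmod b)\<^sup>2"
        using quad[of "(c + 1) / (2 * (cmod b)\<^sup>2)"] True by simp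
      with nz show False by (simp add: field_simps)
    qed
    with True show ?thesis by simp
  next
    case False
    with a0 have "a > 0" by simp
    with quad[of "1 / a"] show ?thesis by (simp add: field_simps power2_eq_square)
  qed
  then show ?thesis by (simp add: a_def b_def c_def)
qed

lemma positive_op_one: "positive_op 1"
  by (simp add: positive_op_def cinner_self)

lemma cinner_cauchy_schwarz: "cmod (cinner x y) \<le> norm x * norm y"
proof -
  have "(cmod (cinner x y))\<^sup>2 \<le> (norm x * norm y)\<^sup>2"
    using positive_op_cauchy_schwarz[OF positive_op_one, of x y]
    by (simp add: norm_power2_cinner[symmetric] power_mult_distrib)
  then show ?thesis
    by (rule power2_le_imp_le) simp
qed

lemma bounded_linear_cinner_right: "bounded_linear (cinner x)"
  by (rule bounded_linear_intro[where K = "norm x"])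
    (simp_all add: cinner_simps scaleR_conv_of_real mult.commute[of "norm _" "norm x"] cinner_cauchy_schwarz)

lemma parallelogram_law:
  "(norm (x + y))\<^sup>2 + (norm (x - y))\<^sup>2 = 2 * (norm x)\<^sup>2 + 2 * (norm y)\<^sup>2" for x y :: "'a::complex_hilbert"
  by (simp add: norm_power2_cinner cinner_simps)

lemma cinner_eq_zero_all: "(\<And>y. cinner y x = 0) \<Longrightarrow> x = 0"
  using norm_power2_cinner[of x] by simp

lemma cinner_extensionality: "(\<And>z. cinner z x = cinner z y) \<Longrightarrow> x = y"
  using cinner_eq_zero_all[of "x - y"] by (simp add: cinner_simps)

text \<open>Projection onto a closed subspace: by the parallelogram law almost minimizing points are close
  to each other, so completeness gives a minimizer.\<close>

lemma orthogonal_projection_exists: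
  fixes V :: "'a::complex_hilbert set"
  assumes "closed V" and sub: "cvec.subspace V"
  obtains p where "p \<in> V" "\<And>v. v \<in> V \<Longrightarrow> cinner v (x - p) = 0"
proof -
  define d where "d = infdist x V"
  have ne: "V \<noteq> {}" using cvec.subspace_0[OF sub] by blast
  have le: "d \<le> norm (x - v)" if "v \<in> V" for v
    using infdist_le[OF that, of x] by (simp add: d_def dist_norm)
  have d0: "0 \<le> d" by (simp add: d_def infdist_nonneg)
  define S where "S = (\<lambda>n::nat. V \<inter> cball x (d + 1 / (real n + 1)))"
  have close: "(norm (u - v))\<^sup>2 \<le> 4 * ((d + r)\<^sup>2 - d\<^sup>2)"
    if u: "u \<in> V" "norm (x - u) \<le> d + r" and v: "v \<in> V" "norm (x - v) \<le> d + r" for u v r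
  proof -
    have "(1/2) *\<^sub>R (u + v) \<in> V"
      using u v sub by (simp add: scaleR_scaleC cvec.subspace_scale cvec.subspace_add)
    from le[OF this] have "(2 * d)\<^sup>2 \<le> (2 * norm (x - (1/2) *\<^sub>R (u + v)))\<^sup>2"
      using d0 by (intro power_mono) auto
    also have "2 * norm (x - (1/2) *\<^sub>R (u + v)) = norm (2 *\<^sub>R (x - (1/2) *\<^sub>R (u + v)))" by simp
    also have "2 *\<^sub>R (x - (1/2) *\<^sub>R (u + v)) = (x - u) + (x - v)"
      by (simp add: algebra_simps scaleR_2)
    finally have "4 * d\<^sup>2 \<le> (norm ((x - u) + (x - v)))\<^sup>2" by (simp add: power_mult_distrib)
    moreover have "(norm ((x - u) + (x - v)))\<^sup>2 + (norm (u - v))\<^sup>2 = 2 * (norm (x - u))\<^sup>2 + 2 * (norm (x - v))\<^sup>2"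
      using parallelogram_law[of "x - u" "x - v"] by (simp add: norm_minus_commute)
    moreover have "(norm (x - u))\<^sup>2 \<le> (d + r)\<^sup>2" "(norm (x - v))\<^sup>2 \<le> (d + r)\<^sup>2"
      using u v by (auto intro: power_mono)
    ultimately show ?thesis by (simp add: algebra_simps)
  qed
  have "\<exists>a. \<forall>n. a \<in> S n"
  proof (rule decreasing_closed_nest)
    show "\<exists>a. \<forall>n. a \<in> S n" if "\<And>n. a \<in> S n" for a using that by blast
    show "closed (S n)" for n unfolding S_def using assms(1) by auto
    show "S n \<noteq> {}" for n
    proof -
      have "infdist x V < d + 1 / (real n + 1)" by (simp add: d_def)
      then have "\<exists>v\<in>V. dist x v < d + 1 / (real n + 1)"
        unfolding infdist_notempty[OF ne] by (subst (asm) cINF_less_iff) (auto simp: ne)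
      then obtain v where "v \<in> V" "dist x v < d + 1 / (real n + 1)" by blast
      then show ?thesis by (auto simp: S_def)
    qed
    show "S n \<subseteq> S m" if "m \<le> n" for m n
    proof -
      have "1 / (real n + 1) \<le> 1 / (real m + 1)" using that by (simp add: frac_le)
      then show ?thesis unfolding S_def by auto
    qed
    show "\<exists>n. \<forall>u\<in>S n. \<forall>v\<in>S n. dist u v < e" if e: "e > 0" for e
    proof -
      have "(\<lambda>n. 4 * ((d + 1 / (real n + 1))\<^sup>2 - d\<^sup>2)) \<longlonglongrightarrow> 4 * ((d + 0)\<^sup>2 - d\<^sup>2)"
        by (intro tendsto_intros LIMSEQ_inverse_real_of_nat[unfolded inverse_eq_divide Suc_eq_plus1 of_nat_add of_nat_1])
      then have "(\<lambda>n. 4 * ((d + 1 / (real n + 1))\<^sup>2 - d\<^sup>2)) \<longlonglongrightarrow> 0" by simp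
      then have "\<forall>\<^sub>F n in sequentially. 4 * ((d + 1 / (real n + 1))\<^sup>2 - d\<^sup>2) < e\<^sup>2"
        by (rule order_tendstoD) (use e in simp)
      then obtain n where n: "4 * ((d + 1 / (real n + 1))\<^sup>2 - d\<^sup>2) < e\<^sup>2"
        by (auto simp: eventually_sequentially)
      have "dist u v < e" if "u \<in> S n" "v \<in> S n" for u v
      proof -
        have "(norm (u - v))\<^sup>2 < e\<^sup>2"
          using close[of u "1 / (real n + 1)" v] that n by (auto simp: S_def dist_norm)
        then show ?thesis using e by (simp add: dist_norm power2_less_imp_less)
      qed
      then show ?thesis by blast
    qed
  qed
  then obtain p where p: "\<And>n. p \<in> V \<and> norm (x - p) \<le> d + 1 / (real n + 1)"
    by (auto simp: S_def dist_norm)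
  have "norm (x - p) \<le> d"
  proof (rule LIMSEQ_le_const)
    have "(\<lambda>n. d + 1 / (real n + 1)) \<longlonglongrightarrow> d + 0"
      by (intro tendsto_intros LIMSEQ_inverse_real_of_nat[unfolded inverse_eq_divide Suc_eq_plus1 of_nat_add of_nat_1])
    then show "(\<lambda>n. d + 1 / (real n + 1)) \<longlonglongrightarrow> d" by simp
    show "\<exists>N. \<forall>n\<ge>N. norm (x - p) \<le> d + 1 / (real n + 1)" using p by blast
  qed
  then have min: "norm (x - p) \<le> norm (x - v)" if "v \<in> V" for v using le[OF that] by linarith
  show thesis
  proof (rule that)
    show "p \<in> V" using p by blast
    fix v assume v: "v \<in> V"
    define b where "b = cinner v (x - p)"
    define t where "t = 1 / ((norm v)\<^sup>2 + 1)"
    have b': "cinner (x - p) v = cnj b" unfolding b_def by (metis cinner_commute)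
    have pos: "(norm v)\<^sup>2 + 1 > 0" by (simp add: add_nonneg_pos)
    have "p + (of_real t * b) *\<^sub>C v \<in> V"
      using \<open>p \<in> V\<close> v sub by (simp add: cvec.subspace_scale cvec.subspace_add)
    from min[OF this] have "(norm (x - p))\<^sup>2 \<le> (norm ((x - p) - (of_real t * b) *\<^sub>C v))\<^sup>2"
      by (simp add: diff_diff_eq)
    also have "\<dots> = (norm (x - p))\<^sup>2 - 2 * t * (cmod b)\<^sup>2 + t\<^sup>2 * (cmod b)\<^sup>2 * (norm v)\<^sup>2"
    proof -
      have "complex_of_real ((norm ((x - p) - (of_real t * b) *\<^sub>C v))\<^sup>2) =
        cinner (x - p) (x - p) - of_real (2 * t) * (b * cnj b) + of_real (t\<^sup>2) * (b * cnj b) * cinner v v"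
        unfolding cinner_self[symmetric]
        by (subst cinner_diff_left, subst (1 2) cinner_diff_right)
          (simp add: cinner_scaleC_left cinner_scaleC_right b' b_def[symmetric] power2_eq_square algebra_simps)
      also have "\<dots> = complex_of_real ((norm (x - p))\<^sup>2 - 2 * t * (cmod b)\<^sup>2 + t\<^sup>2 * (cmod b)\<^sup>2 * (norm v)\<^sup>2)"
        by (simp add: complex_norm_square[symmetric] cinner_self)
      finally show ?thesis by (simp only: of_real_eq_iff)
    qed
    finally have "2 * t * (cmod b)\<^sup>2 \<le> t * (t * (norm v)\<^sup>2) * (cmod b)\<^sup>2"
      by (simp add: power2_eq_square algebra_simps)
    moreover have "t * (norm v)\<^sup>2 \<le> 1" "t > 0" using pos by (simp_all add: t_def divide_simps)
    moreover from this have "t * (t * (norm v)\<^sup>2) * (cmod b)\<^sup>2 \<le> t * 1 * (cmod b)\<^sup>2"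
      by (intro mult_right_mono mult_left_mono) auto
    ultimately have "2 * t * (cmod b)\<^sup>2 \<le> t * 1 * (cmod b)\<^sup>2" by linarith
    with \<open>t > 0\<close> have "(cmod b)\<^sup>2 \<le> 0" by (simp add: mult_le_0_iff algebra_simps)
    then show "cinner v (x - p) = 0" by (simp add: b_def)
  qed
qed

text \<open>Off the trivial case, project a vector with \<open>\<phi> x \<noteq> 0\<close> onto the kernel of \<open>\<phi>\<close>; the component orthogonal to the
  kernel spans the complement and, rescaled, represents \<open>\<phi>\<close>.\<close>

lemma riesz_representation:
  fixes \<phi> :: "'a::complex_hilbert \<Rightarrow> complex"
  assumes bl: "bounded_linear \<phi>" and homog: "\<And>c x. \<phi> (c *\<^sub>C x) = c * \<phi> x"
  obtains u where "\<And>x. \<phi> x = cinner u x"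
proof (cases "\<forall>x. \<phi> x = 0")
  case True
  then show ?thesis using that[of 0] by simp
next
  case False
  then obtain x where x: "\<phi> x \<noteq> 0" by blast
  interpret bounded_linear \<phi> by (rule bl)
  define V where "V = {y. \<phi> y = 0}"
  have "closed V" unfolding V_def
    by (intro closed_Collect_eq continuous_on continuous_on_const continuous_on_id)
  moreover have "cvec.subspace V"
    by (simp add: cvec.subspace_def V_def add homog zero)
  ultimately obtain p where p: "p \<in> V" "\<And>v. v \<in> V \<Longrightarrow> cinner v (x - p) = 0"
    using orthogonal_projection_exists[of V x] by blast
  define w where "w = x - p"
  have w: "\<phi> w = \<phi> x" using p(1) by (simp add: w_def diff V_def)
  have w0: "cinner w w \<noteq> 0" using x w by (auto simp: cinner_self zero)
  show ?thesis
  proof (rule that)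
    fix y
    have "y - (\<phi> y / \<phi> w) *\<^sub>C w \<in> V"
      using x w by (simp add: V_def diff homog)
    from p(2)[OF this] have "cinner w (y - (\<phi> y / \<phi> w) *\<^sub>C w) = 0"
      by (metis w_def cinner_commute complex_cnj_zero)
    then have "cinner w y = \<phi> y / \<phi> w * cinner w w" by (simp add: cinner_simps)
    then show "\<phi> y = cinner (cnj (\<phi> w / cinner w w) *\<^sub>C w) y"
      using w0 x w by (simp add: cinner_simps)
  qed
qed


section \<open>Bounded operators and adjoints\<close>

lemma norm_op_apply: "norm (op_apply A x) \<le> norm A * norm x"
  by transfer (rule norm_blinfun)

lemma norm_op_bound: "0 \<le> K \<Longrightarrow> (\<And>x. norm (op_apply A x) \<le> K * norm x) \<Longrightarrow> norm A \<le> K"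
  by transfer (rule norm_blinfun_bound)

lemma op_of_function:
  fixes f :: "'a::complex_hilbert \<Rightarrow> 'a"
  assumes "\<And>x y. f (x + y) = f x + f y" "\<And>c x. f (c *\<^sub>C x) = c *\<^sub>C f x" "\<And>x. norm (f x) \<le> K * norm x"
  obtains A where "\<And>x. op_apply A x = f x"
proof -
  have bl: "bounded_linear f"
    using assms(1,3) by (intro bounded_linear_intro[where K = K]) (simp_all add: scaleR_scaleC assms(2) mult.commute)
  have "op_apply (op_of_blinfun (Blinfun f)) x = f x" for x
    unfolding op_apply.rep_eq
    by (subst op_of_blinfun_inverse) (simp_all add: bounded_linear_Blinfun_apply bl assms(2))
  then show thesis by (rule that)
qed

text \<open>The operator \<open>adj A\<close> is a definite description, so nothing is known about it before this. Existence comes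
  from Riesz representation of the functionals \<open>y \<mapsto> \<langle>x, A y\<rangle>\<close>.\<close>

lemma adj_exists: "\<exists>!B. \<forall>x y. cinner (op_apply B x) y = cinner x (op_apply A y)"
proof (rule ex_ex1I)
  have "\<exists>u. \<forall>y. cinner u y = cinner x (op_apply A y)" for x
  proof -
    have "bounded_linear (\<lambda>y. cinner x (op_apply A y))"
    proof (rule bounded_linear_compose[OF bounded_linear_cinner_right])
      show "bounded_linear (op_apply A)"
        by (rule bounded_linear_intro[where K = "norm A"])
          (simp_all add: norm_op_apply mult.commute[of "norm (_::'a)"])
    qed
    from riesz_representation[OF this] obtain u where "\<And>y. cinner x (op_apply A y) = cinner u y"
      by (auto simp: cinner_simps)
    then show ?thesis by metis
  qed
  then obtain f where f: "\<And>x y. cinner (f x) y = cinner x (op_apply A y)" by metis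
  have f': "cinner y (f x) = cinner (op_apply A y) x" for x y
    using f[of x y] by (metis cinner_commute)
  have bound: "norm (f x) \<le> norm A * norm x" for x
  proof (cases "f x = 0")
    case False
    have "norm (f x) * norm (f x) = cmod (cinner (f x) (f x))"
      by (simp add: cinner_self power2_eq_square norm_mult)
    also have "\<dots> = cmod (cinner x (op_apply A (f x)))" by (simp add: f)
    also have "\<dots> \<le> norm x * (norm A * norm (f x))"
      by (rule order.trans[OF cinner_cauchy_schwarz]) (simp add: mult_left_mono norm_op_apply)
    finally show ?thesis using False by (simp add: mult_ac)
  qed simp
  have add: "f (x + y) = f x + f y" for x y
    by (rule cinner_extensionality) (simp only: f' cinner_add_right)
  have scale: "f (c *\<^sub>C x) = c *\<^sub>C f x" for c x
    by (rule cinner_extensionality) (simp only: f' cinner_scaleC_right)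
  obtain B where B: "\<And>x. op_apply B x = f x"
    using op_of_function[of f, OF add scale bound] by blast
  then show "\<exists>B. \<forall>x y. cinner (op_apply B x) y = cinner x (op_apply A y)"
    by (intro exI[of _ B]) (simp add: B f)
next
  fix B C
  assume "\<forall>x y. cinner (op_apply B x) y = cinner x (op_apply A y)"
    "\<forall>x y. cinner (op_apply C x) y = cinner x (op_apply A y)"
  then show "B = C"
    by (intro op_eqI cinner_extensionality) (metis cinner_commute)
qed

lemma cinner_adj_left: "cinner (op_apply (adj A) x) y = cinner x (op_apply A y)"
  unfolding adj_def using theI'[OF adj_exists] by blast

lemma cinner_adj_right: "cinner x (op_apply (adj A) y) = cinner (op_apply A x) y"
  by (metis cinner_adj_left cinner_commute)

lemma adj_eqI: "(\<And>x y. cinner (op_apply B x) y = cinner x (op_apply A y)) \<Longrightarrow> adj A = B"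
  using adj_exists[of A] cinner_adj_left by blast

lemma adj_adj [simp]: "adj (adj A) = A"
  by (rule adj_eqI) (simp add: cinner_adj_right)

lemma adj_add: "adj (A + B) = adj A + adj B"
  by (rule adj_eqI) (simp add: cinner_simps cinner_adj_left)

lemma adj_diff: "adj (A - B) = adj A - adj B"
  by (rule adj_eqI) (simp add: cinner_simps cinner_adj_left)

lemma adj_scaleR: "adj (r *\<^sub>R A) = r *\<^sub>R adj A"
  by (rule adj_eqI) (simp add: cinner_simps cinner_adj_left)

lemma adj_mult: "adj (A * B) = adj B * adj A"
  by (rule adj_eqI) (simp add: cinner_adj_left)

lemma adj_one [simp]: "adj 1 = 1"
  by (rule adj_eqI) simp

lemma adj_zero [simp]: "adj 0 = 0"
  by (rule adj_eqI) simp

lemma adj_power: "adj (A ^ n) = adj A ^ n"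
  by (induction n) (simp_all add: adj_mult power_commutes)

lemma positive_op_adj: "positive_op P \<Longrightarrow> adj P = P"
  by (rule adj_eqI) (simp add: positive_op_hermitian)

lemma norm_adj_le: "norm (adj A) \<le> norm A"
proof (rule norm_op_bound)
  fix x
  show "norm (op_apply (adj A) x) \<le> norm A * norm x"
  proof (cases "op_apply (adj A) x = 0")
    case False
    define z where "z = op_apply (adj A) x"
    have "norm z * norm z = cmod (cinner z z)"
      by (simp add: cinner_self power2_eq_square norm_mult)
    also have "\<dots> = cmod (cinner x (op_apply A z))" by (simp add: z_def cinner_adj_left)
    also have "\<dots> \<le> norm x * (norm A * norm z)"
      by (rule order.trans[OF cinner_cauchy_schwarz]) (simp add: mult_left_mono norm_op_apply)
    finally show ?thesis using False by (simp add: z_def mult_ac)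
  qed simp
qed simp

lemma norm_adj: "norm (adj A) = norm A"
  using norm_adj_le[of A] norm_adj_le[of "adj A"] by simp

lemma bounded_linear_adj: "bounded_linear adj"
  by (rule bounded_linear_intro[where K = 1]) (simp_all add: adj_add adj_scaleR norm_adj)

text \<open>Complex linearity is a closed condition, so the operators are complete.\<close>

instance bounded_op :: (complex_hilbert) banach
proof
  fix X :: "nat \<Rightarrow> 'a bounded_op"
  assume X: "Cauchy X"
  have dist: "dist (blinfun_of_op A) (blinfun_of_op B) = dist A B" for A B :: "'a bounded_op"
    unfolding dist_norm norm_bounded_op.rep_eq minus_bounded_op.rep_eq by (rule refl)
  have "Cauchy (\<lambda>n. blinfun_of_op (X n))"
    using X unfolding Cauchy_def dist by blast
  then obtain L where L: "(\<lambda>n. blinfun_of_op (X n)) \<longlonglongrightarrow> L"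
    using Cauchy_convergent convergent_def by blast
  have app: "(\<lambda>n. blinfun_apply (blinfun_of_op (X n)) x) \<longlonglongrightarrow> blinfun_apply L x" for x
    by (rule bounded_linear.tendsto[OF blinfun.bounded_linear_left L])
  have "blinfun_apply L (c *\<^sub>C x) = c *\<^sub>C blinfun_apply L x" for c x
  proof (rule LIMSEQ_unique[OF app])
    have "blinfun_apply (blinfun_of_op (X n)) (c *\<^sub>C x) = c *\<^sub>C blinfun_apply (blinfun_of_op (X n)) x" for n
      using blinfun_of_op[of "X n"] by simp
    then show "(\<lambda>n. blinfun_apply (blinfun_of_op (X n)) (c *\<^sub>C x)) \<longlonglongrightarrow> c *\<^sub>C blinfun_apply L x"
      using bounded_linear.tendsto[OF bounded_linear_scaleC app[of x], of c] by simp
  qed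
  then have "L = blinfun_of_op (op_of_blinfun L)"
    using op_of_blinfun_inverse[of L] by simp
  then obtain A where A: "L = blinfun_of_op A" by blast
  have "X \<longlonglongrightarrow> A"
    using L unfolding A tendsto_iff dist .
  then show "convergent X" by (auto simp: convergent_def)
qed


section \<open>Inverses and square roots of positive operators\<close>

text \<open>The Cauchy--Schwarz inequality of the form of \<open>P\<close>, at the vectors \<open>P x\<close> and \<open>x\<close>, bounds \<open>\<parallel>P x\<parallel>\<^sup>4\<close> by the product
  of the two diagonal values.\<close>

lemma norm_positive_op_le:
  assumes P: "positive_op P" and M: "0 \<le> M" and le: "\<And>x. Re (cinner x (op_apply P x)) \<le> M * (norm x)\<^sup>2"
  shows "norm P \<le> M"
proof (rule norm_op_bound[OF M])
  fix x
  define y where "y = op_apply P x"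
  have "((norm y)\<^sup>2)\<^sup>2 = (cmod (cinner y (op_apply P x)))\<^sup>2"
    by (simp add: y_def cinner_self norm_power)
  also have "\<dots> \<le> Re (cinner y (op_apply P y)) * Re (cinner x (op_apply P x))"
    by (rule positive_op_cauchy_schwarz[OF P])
  also have "\<dots> \<le> (M * (norm y)\<^sup>2) * (M * (norm x)\<^sup>2)"
    using le positive_opD(2)[OF P] M by (intro mult_mono) auto
  finally have *: "(norm y)\<^sup>2 * (norm y)\<^sup>2 \<le> (M * norm x)\<^sup>2 * (norm y)\<^sup>2"
    by (simp add: power2_eq_square mult_ac)
  have "(norm y)\<^sup>2 \<le> (M * norm x)\<^sup>2"
  proof (cases "y = 0")
    case False
    then have "(norm y)\<^sup>2 > 0" by simp
    with * show ?thesis by (rule mult_right_le_imp_le)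
  qed simp
  then show "norm (op_apply P x) \<le> M * norm x"
    unfolding y_def by (rule power2_le_imp_le) (simp add: M)
qed

lemma Re_cinner_le: "Re (cinner x (op_apply A x)) \<le> norm A * (norm x)\<^sup>2"
proof -
  have "Re (cinner x (op_apply A x)) \<le> norm x * norm (op_apply A x)"
    by (rule order.trans[OF complex_Re_le_cmod cinner_cauchy_schwarz])
  also have "\<dots> \<le> norm x * (norm A * norm x)"
    by (intro mult_left_mono norm_op_apply) simp
  finally show ?thesis by (simp add: power2_eq_square mult_ac)
qed

lemma positive_op_scaleR: "positive_op P \<Longrightarrow> 0 \<le> r \<Longrightarrow> positive_op (r *\<^sub>R P)"
  by (simp add: positive_op_def cinner_simps complex_nonneg_Reals_iff)

lemma positive_op_selfadjointI:
  assumes "adj A = A" "\<And>x. 0 \<le> Re (cinner x (op_apply A x))"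
  shows "positive_op A"
proof -
  have "cinner x (op_apply A x) = cnj (cinner x (op_apply A x))" for x
    by (metis assms(1) cinner_adj_left cinner_commute)
  then have "Im (cinner x (op_apply A x)) = 0" for x
    by (metis Reals_cnj_iff complex_is_Real_iff)
  then show ?thesis
    using assms(2) by (simp add: positive_op_def complex_nonneg_Reals_iff)
qed

lemma positive_op_adj_mult: "positive_op (adj A * A)"
  by (rule positive_op_selfadjointI) (simp_all add: adj_mult cinner_adj_right cinner_self)

lemma norm_one_minus_positive_le:
  assumes P: "positive_op P" and M: "norm P \<le> M"
  shows "norm (M *\<^sub>R 1 - P) \<le> M"
proof (rule norm_positive_op_le)
  show "0 \<le> M" using M norm_ge_zero order.trans by blast
  have *: "Re (cinner x (op_apply P x)) \<le> M * (norm x)\<^sup>2" for x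
    using Re_cinner_le[of x P] mult_right_mono[OF M, of "(norm x)\<^sup>2"] by simp
  show "positive_op (M *\<^sub>R 1 - P)"
    using * by (intro positive_op_selfadjointI)
      (simp_all add: adj_diff adj_scaleR positive_op_adj[OF P] cinner_simps cinner_self)
  show "Re (cinner x (op_apply (M *\<^sub>R 1 - P) x)) \<le> M * (norm x)\<^sup>2" for x
    using positive_opD(2)[OF P, of x] by (simp add: cinner_simps cinner_self)
qed

text \<open>The one-sided inverses are the fixed points of the contractions \<open>z \<mapsto> 1 + D z\<close> and \<open>z \<mapsto> 1 + z D\<close>. This way
  the zero space, where \<open>1 = 0\<close>, is no exception.\<close>

lemma one_minus_invertible:
  fixes D :: "'a::complex_hilbert bounded_op"
  assumes "norm D < 1"
  obtains Z where "(1 - D) * Z = 1" "Z * (1 - D) = 1"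
proof -
  have "\<exists>!z. 1 + D * z = z"
  proof (rule banach_fix_type[of "norm D"])
    show "\<forall>x y. dist (1 + D * x) (1 + D * y) \<le> norm D * dist x y"
      by (auto simp: dist_norm right_diff_distrib[symmetric] norm_mult_ineq)
  qed (use assms in auto)
  then obtain z where "1 + D * z = z" by blast
  then have z: "(1 - D) * z = 1" by (simp add: algebra_simps)
  have "\<exists>!z. 1 + z * D = z"
  proof (rule banach_fix_type[of "norm D"])
    show "\<forall>x y. dist (1 + x * D) (1 + y * D) \<le> norm D * dist x y"
      by (auto simp: dist_norm left_diff_distrib[symmetric] mult.commute[of "norm D"] norm_mult_ineq)
  qed (use assms in auto)
  then obtain w where "1 + w * D = w" by blast
  then have w: "w * (1 - D) = 1" by (simp add: algebra_simps)
  have "w = w * ((1 - D) * z)" by (simp add: z)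
  also have "\<dots> = z" by (simp only: mult.assoc[symmetric] w mult_1)
  finally show thesis using that z w by blast
qed

text \<open>The resolvent \<open>Z\<close> of a positive operator \<open>P\<close> at \<open>-\<epsilon>\<close>. That \<open>P Z\<close> and \<open>\<epsilon> Z\<close>, which add up to the identity, are
  contractions follows from \<open>\<parallel>P z\<parallel>\<^sup>2 + \<parallel>\<epsilon> z\<parallel>\<^sup>2 \<le> \<parallel>P z + \<epsilon> z\<parallel>\<^sup>2\<close>. As \<open>\<epsilon> \<rightarrow> 0\<close> these operators stand in for the
  spectral projections onto the support and the kernel of \<open>P\<close>.\<close>

lemma positive_resolvent:
  fixes P :: "'a::complex_hilbert bounded_op"
  assumes P: "positive_op P" and \<epsilon>: "0 < \<epsilon>"
  obtains Z where "P * Z + \<epsilon> *\<^sub>R Z = 1" "Z * P + \<epsilon> *\<^sub>R Z = 1"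
    "norm (P * Z) \<le> 1" "norm (\<epsilon> *\<^sub>R Z) \<le> 1" "adj Z = Z"
proof -
  define M where "M = norm P"
  define D where "D = (1 / (M + \<epsilon>)) *\<^sub>R (M *\<^sub>R 1 - P)"
  have M: "0 \<le> M" by (simp add: M_def)
  have "norm D \<le> M / (M + \<epsilon>)"
    using norm_one_minus_positive_le[OF P, of M] M \<epsilon> by (simp add: D_def M_def divide_right_mono)
  also have "\<dots> < 1" using M \<epsilon> by simp
  finally obtain Y where Y: "(1 - D) * Y = 1" "Y * (1 - D) = 1"
    by (rule one_minus_invertible)
  have "(M + \<epsilon>) *\<^sub>R D = M *\<^sub>R 1 - P"
    using M \<epsilon> by (simp add: D_def)
  then have sum: "(M + \<epsilon>) *\<^sub>R (1 - D) = P + \<epsilon> *\<^sub>R 1"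
    by (simp add: scaleR_diff_right scaleR_add_left)
  define Z where "Z = (1 / (M + \<epsilon>)) *\<^sub>R Y"
  have "(P + \<epsilon> *\<^sub>R 1) * Z = 1" "Z * (P + \<epsilon> *\<^sub>R 1) = 1"
    using M \<epsilon> unfolding sum[symmetric] by (simp_all add: Z_def Y)
  then have Z: "P * Z + \<epsilon> *\<^sub>R Z = 1" "Z * P + \<epsilon> *\<^sub>R Z = 1"
    by (simp_all add: distrib_left distrib_right)
  have sq: "(norm (op_apply (P * Z) x))\<^sup>2 + (norm (op_apply (\<epsilon> *\<^sub>R Z) x))\<^sup>2 \<le> (norm x)\<^sup>2" for x
  proof -
    define z where "z = op_apply Z x"
    have x: "x = op_apply P z + \<epsilon> *\<^sub>R z"
      using arg_cong[OF Z(1), of "\<lambda>A. op_apply A x"] by (simp add: z_def)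
    have "(norm x)\<^sup>2 = (norm (op_apply P z))\<^sup>2 + (norm (\<epsilon> *\<^sub>R z))\<^sup>2 + 2 * \<epsilon> * Re (cinner z (op_apply P z))"
      unfolding x norm_power2_cinner
      by (simp add: cinner_simps positive_op_hermitian[OF P] distrib_left)
    then show ?thesis
      using positive_opD(2)[OF P, of z] \<epsilon> by (simp add: z_def)
  qed
  show thesis
  proof (rule that[OF Z])
    show "norm (P * Z) \<le> 1"
    proof (rule norm_op_bound)
      show "norm (op_apply (P * Z) x) \<le> 1 * norm x" for x
        unfolding mult_1 using sq[of x] zero_le_power2[of "norm (op_apply (\<epsilon> *\<^sub>R Z) x)"]
        by (intro power2_le_imp_le[OF _ norm_ge_zero]) linarith
    qed simp
    show "norm (\<epsilon> *\<^sub>R Z) \<le> 1"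
    proof (rule norm_op_bound)
      show "norm (op_apply (\<epsilon> *\<^sub>R Z) x) \<le> 1 * norm x" for x
        unfolding mult_1 using sq[of x] zero_le_power2[of "norm (op_apply (P * Z) x)"]
        by (intro power2_le_imp_le[OF _ norm_ge_zero]) linarith
    qed simp
    have "adj (Z * P + \<epsilon> *\<^sub>R Z) = 1" by (simp add: Z)
    then have adjZ: "P * adj Z + \<epsilon> *\<^sub>R adj Z = 1"
      by (simp add: adj_add adj_mult adj_scaleR positive_op_adj[OF P])
    have "Z = Z * (P * adj Z + \<epsilon> *\<^sub>R adj Z)" by (simp add: adjZ)
    also have "\<dots> = (Z * P + \<epsilon> *\<^sub>R Z) * adj Z" by (simp add: algebra_simps)
    finally show "adj Z = Z" by (simp add: Z)
  qed
qed

text \<open>The iteration \<open>y \<mapsto> (C + y\<^sup>2) / 2\<close> for \<open>1 - sqrt (1 - C)\<close> is dominated in norm, increments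
  included, by the scalar iteration with \<open>C\<close> replaced by \<open>1\<close>; the latter increases to a limit, so the
  former is Cauchy.\<close>

lemma sqrt_iteration_converges:
  fixes C :: "'a::complex_hilbert bounded_op"
  assumes C: "norm C \<le> 1" "adj C = C"
  obtains Y where "norm Y \<le> 1" "adj Y = Y" "2 *\<^sub>R Y = C + Y * Y" "\<And>B. B * C = C * B \<Longrightarrow> B * Y = Y * B"
proof -
  define y where "y = rec_nat (0 :: 'a bounded_op) (\<lambda>_ y. (1/2) *\<^sub>R (C + y * y))"
  define s where "s = rec_nat (0 :: real) (\<lambda>_ s. (1/2) * (1 + s * s))"
  have y: "y 0 = 0" "y (Suc k) = (1/2) *\<^sub>R (C + y k * y k)" for k by (simp_all add: y_def)
  have s: "s 0 = 0" "s (Suc k) = (1/2) * (1 + s k * s k)" for k by (simp_all add: s_def)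
  have s01: "0 \<le> s k \<and> s k \<le> 1" for k
    by (induction k) (auto simp: s mult_le_one)
  have ys: "norm (y k) \<le> s k" for k
  proof (induction k)
    case (Suc k)
    have "norm (C + y k * y k) \<le> 1 + s k * s k"
      using C(1) norm_mult_ineq[of "y k" "y k"] mult_mono[OF Suc Suc] s01[of k]
      by (intro order.trans[OF norm_triangle_ineq] add_mono) auto
    then show ?case by (simp add: y s)
  qed (simp add: y s)
  have step: "norm (y (Suc k) - y k) \<le> s (Suc k) - s k" for k
  proof (induction k)
    case 0
    show ?case using C by (simp add: y s)
  next
    case (Suc k)
    define u where "u = y (Suc k)"
    define v where "v = y k"
    have "y (Suc (Suc k)) - y (Suc k) = (1/2) *\<^sub>R (C + u * u) - (1/2) *\<^sub>R (C + v * v)"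
      unfolding u_def v_def by (simp only: y(2))
    also have "\<dots> = (1/2) *\<^sub>R (u * (u - v) + (u - v) * v)"
      unfolding scaleR_diff_right[symmetric] by (simp add: algebra_simps)
    also have "norm \<dots> \<le> (1/2) * (s (Suc k) * (s (Suc k) - s k) + (s (Suc k) - s k) * s k)"
    proof -
      have "norm (u * (u - v)) \<le> s (Suc k) * (s (Suc k) - s k)"
        using ys[of "Suc k"] Suc s01[of "Suc k"]
        by (intro order.trans[OF norm_mult_ineq] mult_mono) (auto simp: u_def v_def)
      moreover have "norm ((u - v) * v) \<le> (s (Suc k) - s k) * s k"
        using ys[of k] Suc s01[of k] order.trans[OF norm_ge_zero Suc]
        by (intro order.trans[OF norm_mult_ineq] mult_mono) (auto simp: u_def v_def)
      ultimately have "norm (u * (u - v) + (u - v) * v) \<le> s (Suc k) * (s (Suc k) - s k) + (s (Suc k) - s k) * s k"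
        by (intro order.trans[OF norm_triangle_ineq] add_mono)
      then show ?thesis by simp
    qed
    also have "\<dots> = s (Suc (Suc k)) - s (Suc k)"
      by (simp add: s(2)[of "Suc k"] s(2)[of k] algebra_simps)
    finally show ?case .
  qed
  have inc: "s k \<le> s (Suc k)" for k
    using step[of k] norm_ge_zero[of "y (Suc k) - y k"] by linarith
  have diff: "norm (y (n + k) - y n) \<le> s (n + k) - s n" for n k
  proof (induction k)
    case (Suc k)
    have "norm (y (n + Suc k) - y n) \<le> norm (y (Suc (n + k)) - y (n + k)) + norm (y (n + k) - y n)"
      using norm_triangle_ineq[of "y (Suc (n + k)) - y (n + k)" "y (n + k) - y n"] by simp
    with Suc step[of "n + k"] show ?case by simp
  qed simp
  have "incseq s" using inc by (simp add: incseq_SucI)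
  then obtain l where "s \<longlonglongrightarrow> l"
    using incseq_convergent[of s 1] s01 by blast
  then have "Cauchy s" by (rule LIMSEQ_imp_Cauchy)
  have "Cauchy y"
  proof (rule metric_CauchyI)
    fix e :: real assume "0 < e"
    with \<open>Cauchy s\<close> obtain N where N: "\<And>m n. m \<ge> N \<Longrightarrow> n \<ge> N \<Longrightarrow> dist (s m) (s n) < e"
      unfolding Cauchy_def by blast
    have le: "dist (y m) (y n) < e" if "n \<ge> N" "m \<ge> n" for m n
    proof -
      have "dist (y m) (y n) \<le> s m - s n"
        using diff[of n "m - n"] that by (simp add: dist_norm)
      also have "\<dots> \<le> dist (s m) (s n)" by (simp add: dist_real_def)
      also have "\<dots> < e" using N that by simp
      finally show ?thesis .
    qed
    show "\<exists>N. \<forall>m\<ge>N. \<forall>n\<ge>N. dist (y m) (y n) < e"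
      using le by (metis dist_commute nle_le)
  qed
  then obtain Y where Y: "y \<longlonglongrightarrow> Y"
    using Cauchy_convergent convergent_def by blast
  show thesis
  proof (rule that)
    show "norm Y \<le> 1"
      using ys s01 by (intro LIMSEQ_le_const2[OF tendsto_norm[OF Y]]) (meson order.trans)
    have "adj (y k) = y k" for k
      by (induction k) (simp_all add: y adj_scaleR adj_add adj_mult C)
    then show "adj Y = Y"
      using bounded_linear.tendsto[OF bounded_linear_adj Y] Y LIMSEQ_unique by auto
    have "(\<lambda>k. y (Suc k)) \<longlonglongrightarrow> (1/2) *\<^sub>R (C + Y * Y)"
      unfolding y(2) by (intro tendsto_intros Y)
    then have "Y = (1/2) *\<^sub>R (C + Y * Y)"
      using LIMSEQ_Suc[OF Y] LIMSEQ_unique by blast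
    then show "2 *\<^sub>R Y = C + Y * Y"
      by (metis scaleR_scaleR scaleR_one field_sum_of_halves mult_2 nonzero_mult_div_cancel_left times_divide_eq_right zero_neq_numeral mult.right_neutral)
    show "B * Y = Y * B" if B: "B * C = C * B" for B
    proof -
      have "B * y k = y k * B" for k
      proof (induction k)
        case (Suc k)
        have "B * (y k * y k) = (y k * y k) * B"
          by (metis Suc mult.assoc)
        with B show ?case by (simp add: y distrib_left distrib_right)
      qed (simp add: y)
      moreover have "(\<lambda>k. B * y k) \<longlonglongrightarrow> B * Y" "(\<lambda>k. y k * B) \<longlonglongrightarrow> Y * B"
        by (intro tendsto_intros Y)+
      ultimately show ?thesis using LIMSEQ_unique by simp
    qed
  qed
qed

text \<open>Rescaled to norm at most one, \<open>A\<close> is \<open>1 - C\<close>, and a fixed point \<open>Y\<close> of the iteration satisfies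
  \<open>(1 - Y)\<^sup>2 = 1 - C\<close>.\<close>

lemma positive_sqrt_exists:
  assumes A: "positive_op A"
  obtains Q where "positive_op Q" "Q * Q = A" "\<And>B. B * A = A * B \<Longrightarrow> B * Q = Q * B"
proof -
  define M where "M = norm A + 1"
  have M: "M > 0" "norm A \<le> M" by (simp_all add: M_def add_nonneg_pos)
  define C where "C = (1 / M) *\<^sub>R (M *\<^sub>R 1 - A)"
  have MC: "M *\<^sub>R C = M *\<^sub>R 1 - A" using M by (simp add: C_def)
  have "norm C \<le> 1"
    using norm_one_minus_positive_le[OF A M(2)] M by (simp add: C_def)
  moreover have "adj C = C" by (simp add: C_def adj_scaleR adj_diff positive_op_adj[OF A])
  ultimately obtain Y where Y: "norm Y \<le> 1" "adj Y = Y" "2 *\<^sub>R Y = C + Y * Y"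
    "\<And>B. B * C = C * B \<Longrightarrow> B * Y = Y * B"
    using sqrt_iteration_converges[of C] by blast
  have pos: "positive_op (1 - Y)"
  proof (rule positive_op_selfadjointI)
    show "adj (1 - Y) = 1 - Y" by (simp add: adj_diff Y)
    have "Re (cinner x (op_apply Y x)) \<le> (norm x)\<^sup>2" for x
      using Re_cinner_le[of x Y] mult_right_mono[OF Y(1), of "(norm x)\<^sup>2"] by simp
    then show "0 \<le> Re (cinner x (op_apply (1 - Y) x))" for x
      by (simp add: cinner_simps cinner_self)
  qed
  show thesis
  proof (rule that)
    show "positive_op (sqrt M *\<^sub>R (1 - Y))"
      using pos M by (simp add: positive_op_scaleR)
    have "(1 - Y) * (1 - Y) = 1 - (2 *\<^sub>R Y - Y * Y)"
      by (simp add: algebra_simps scaleR_2)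
    also have "\<dots> = 1 - C" by (simp add: Y(3))
    finally have "M *\<^sub>R ((1 - Y) * (1 - Y)) = M *\<^sub>R (1 - C)" by simp
    also have "\<dots> = A" by (simp add: scaleR_diff_right MC)
    finally show "(sqrt M *\<^sub>R (1 - Y)) * (sqrt M *\<^sub>R (1 - Y)) = A"
      using M by simp
    fix B assume "B * A = A * B"
    then have "B * C = C * B" by (simp add: C_def right_diff_distrib left_diff_distrib)
    from Y(4)[OF this] show "B * (sqrt M *\<^sub>R (1 - Y)) = (sqrt M *\<^sub>R (1 - Y)) * B"
      by (simp add: right_diff_distrib left_diff_distrib)
  qed
qed

lemma positive_op_kernel:
  assumes "positive_op P" "Re (cinner x (op_apply P x)) = 0"
  shows "op_apply P x = 0"
proof (rule cinner_eq_zero_all)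
  fix y
  have "(cmod (cinner y (op_apply P x)))\<^sup>2 \<le> 0"
    using positive_op_cauchy_schwarz[OF assms(1), of y x] assms(2) by simp
  then show "cinner y (op_apply P x) = 0" by simp
qed

text \<open>The square root just constructed commutes with every operator commuting with its square, in
  particular with any other positive square root \<open>P\<close>. On \<open>y = (P - Q) x\<close> the forms of \<open>P\<close> and \<open>Q\<close> then
  add up to \<open>\<langle>y, (P\<^sup>2 - Q\<^sup>2) x\<rangle> = 0\<close>.\<close>

lemma positive_sqrt_unique:
  assumes P: "positive_op P" and Q: "positive_op Q" and eq: "P * P = Q * Q"
    and Q_comm: "\<And>B. B * (Q * Q) = (Q * Q) * B \<Longrightarrow> B * Q = Q * B"
  shows "P = Q"
proof (rule op_eqI)
  fix x
  define y where "y = op_apply (P - Q) x"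
  have comm: "P * Q = Q * P" by (rule Q_comm) (simp add: eq[symmetric] mult.assoc)
  have "op_apply P y + op_apply Q y = op_apply ((P + Q) * (P - Q)) x"
    by (simp add: y_def)
  also have "(P + Q) * (P - Q) = 0" by (simp add: algebra_simps eq comm)
  finally have "Re (cinner y (op_apply P y)) + Re (cinner y (op_apply Q y)) = 0"
    by (metis cinner_add_right cinner_zero_right op_apply_linear(1) plus_complex.sel(1) zero_complex.sel(1))
  then have "Re (cinner y (op_apply P y)) = 0" "Re (cinner y (op_apply Q y)) = 0"
    using positive_opD(2)[OF P, of y] positive_opD(2)[OF Q, of y] by linarith+
  then have "op_apply (P - Q) y = 0"
    by (simp add: positive_op_kernel[OF P] positive_op_kernel[OF Q])
  then have "cinner (op_apply (P - Q) x) (op_apply (P - Q) x) = 0"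
    using positive_op_hermitian[OF P] positive_op_hermitian[OF Q]
    by (metis y_def adj_diff cinner_adj_left cinner_zero_right positive_op_adj[OF P] positive_op_adj[OF Q])
  then show "op_apply P x = op_apply Q x" by (simp add: cinner_self)
qed

lemma abs_op_eqI:
  assumes "positive_op P" "P * P = adj A * A"
  shows "abs_op A = P"
proof -
  obtain Q where Q: "positive_op Q" "Q * Q = adj A * A" "\<And>B. B * (adj A * A) = (adj A * A) * B \<Longrightarrow> B * Q = Q * B"
    using positive_sqrt_exists[OF positive_op_adj_mult] by metis
  have "P' = Q" if "positive_op P'" "P' * P' = adj A * A" for P'
  proof (rule positive_sqrt_unique[OF that(1) Q(1)])
    show "P' * P' = Q * Q" by (simp only: that(2) Q(2))
    show "B * Q = Q * B" if "B * (Q * Q) = Q * Q * B" for B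
      using that unfolding Q(2) by (rule Q(3))
  qed
  then show ?thesis
    unfolding abs_op_def using assms by (intro the_equality) auto
qed

lemma abs_op_positive: "positive_op (abs_op A)" and abs_op_square: "abs_op A * abs_op A = adj A * A"
  using positive_sqrt_exists[OF positive_op_adj_mult[of A]] abs_op_eqI by metis+

lemma norm_abs_op_apply: "norm (op_apply (abs_op A) x) = norm (op_apply A x)"
proof -
  have "(norm (op_apply (abs_op A) x))\<^sup>2 = Re (cinner x (op_apply (abs_op A * abs_op A) x))"
    by (simp add: norm_power2_cinner positive_op_hermitian[OF abs_op_positive])
  also have "\<dots> = (norm (op_apply A x))\<^sup>2"
    by (simp add: abs_op_square cinner_adj_right norm_power2_cinner)
  finally show ?thesis by simp
qed


section \<open>Orthonormal bases\<close>

lemma subspace_closure: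
  fixes V :: "'a::complex_hilbert set"
  assumes V: "cvec.subspace V"
  shows "cvec.subspace (closure V)"
  unfolding cvec.subspace_def
proof (intro conjI ballI allI)
  show "0 \<in> closure V" using cvec.subspace_0[OF V] closure_subset by blast
  fix x y c assume "x \<in> closure V"
  then obtain X where X: "\<And>n. X n \<in> V" "X \<longlonglongrightarrow> x" by (auto simp: closure_sequential)
  show "x + y \<in> closure V" if "y \<in> closure V"
  proof -
    from that obtain Y where Y: "\<And>n. Y n \<in> V" "Y \<longlonglongrightarrow> y" by (auto simp: closure_sequential)
    have "(\<lambda>n. X n + Y n) \<longlonglongrightarrow> x + y" by (intro tendsto_intros X Y)
    moreover have "\<forall>n. X n + Y n \<in> V" using X(1) Y(1) cvec.subspace_add[OF V] by simp
    ultimately show ?thesis unfolding closure_sequential by (intro exI[of _ "\<lambda>n. X n + Y n"]) simp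
  qed
  have "(\<lambda>n. c *\<^sub>C X n) \<longlonglongrightarrow> c *\<^sub>C x" by (rule bounded_linear.tendsto[OF bounded_linear_scaleC X(2)])
  moreover have "\<forall>n. c *\<^sub>C X n \<in> V" using X(1) cvec.subspace_scale[OF V] by simp
  ultimately show "c *\<^sub>C x \<in> closure V"
    unfolding closure_sequential by (intro exI[of _ "\<lambda>n. c *\<^sub>C X n"]) simp
qed

text \<open>A maximal orthonormal set is total: a vector outside its closed span would have a nonzero component
  orthogonal to it, which could be normalized and added.\<close>

lemma is_onb_exists: "\<exists>E :: 'a::complex_hilbert set. is_onb E"
proof -
  define ortho where "ortho = (\<lambda>E :: 'a set. \<forall>e\<in>E. \<forall>f\<in>E. cinner e f = (if e = f then 1 else 0))"
  have "\<exists>E\<in>{E. ortho E}. \<forall>X\<in>{E. ortho E}. E \<subseteq> X \<longrightarrow> X = E"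
  proof (rule subset_Zorn_nonempty)
    show "{E. ortho E} \<noteq> {}" by (auto simp: ortho_def intro: exI[of _ "{}"])
    fix \<C> assume "\<C> \<noteq> {}" and chain: "subset.chain {E. ortho E} \<C>"
    have "cinner e f = (if e = f then 1 else 0)" if "e \<in> X" "X \<in> \<C>" "f \<in> Y" "Y \<in> \<C>" for e f X Y
    proof -
      have "X \<subseteq> Y \<or> Y \<subseteq> X" "ortho X" "ortho Y"
        using chain that by (auto simp: subset.chain_def)
      then show ?thesis using that unfolding ortho_def by (metis subsetD)
    qed
    then show "\<Union> \<C> \<in> {E. ortho E}" unfolding ortho_def by blast
  qed
  then obtain E where E: "ortho E" "\<And>X. ortho X \<Longrightarrow> E \<subseteq> X \<Longrightarrow> X = E" by blast
  have "x \<in> closure (cspan E)" for x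
  proof (rule ccontr)
    assume x: "x \<notin> closure (cspan E)"
    obtain p where p: "p \<in> closure (cspan E)" "\<And>v. v \<in> closure (cspan E) \<Longrightarrow> cinner v (x - p) = 0"
      using orthogonal_projection_exists[OF closed_closure subspace_closure[OF cvec.subspace_span], of E x] by blast
    define w where "w = (1 / norm (x - p)) *\<^sub>R (x - p)"
    have ne: "norm (x - p) \<noteq> 0" using x p(1) by auto
    have w1: "cinner w w = 1"
      using ne by (simp add: w_def cinner_simps cinner_self power2_eq_square del: of_real_mult) 
    have we: "cinner e w = 0" if "e \<in> E" for e
      using p(2)[of e] that closure_subset cvec.span_base[of e E] by (force simp: w_def cinner_simps)
    have ew: "cinner w e = 0" if "e \<in> E" for e
      using we[OF that] by (metis cinner_commute complex_cnj_zero)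
    have "w \<notin> E" using we w1 by fastforce
    moreover have "ortho (insert w E)"
      using E(1) w1 we ew \<open>w \<notin> E\<close> unfolding ortho_def by auto
    ultimately show False using E(2)[of "insert w E"] by blast
  qed
  then have "is_onb E" using E(1) by (auto simp: is_onb_def ortho_def)
  then show ?thesis by blast
qed

text \<open>The partial sum over a finite \<open>Y\<close> is the best approximation to \<open>x\<close> from the span of \<open>Y\<close>. So it is at least as
  good as any given vector of that span, and the span of the whole basis is dense.\<close>

lemma onb_expansion:
  fixes x :: "'a::complex_hilbert"
  assumes E: "is_onb E"
  shows "((\<lambda>e. cinner e x *\<^sub>C e) has_sum x) E"
  unfolding has_sum_def
proof (rule tendstoI)
  fix \<epsilon> :: real assume \<epsilon>: "0 < \<epsilon>"
  have "x \<in> closure (cspan E)" using E by (simp add: is_onb_def)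
  then obtain z where z: "z \<in> cspan E" "dist z x < \<epsilon>" using \<epsilon> by (auto simp: closure_approachable)
  obtain t r where t: "finite t" "t \<subseteq> E" "z = (\<Sum>a\<in>t. r a *\<^sub>C a)"
    using z(1) unfolding cvec.span_explicit by blast
  have "dist (\<Sum>e\<in>Y. cinner e x *\<^sub>C e) x < \<epsilon>" if Y: "finite Y" "t \<subseteq> Y" "Y \<subseteq> E" for Y
  proof -
    define S where "S = (\<Sum>e\<in>Y. cinner e x *\<^sub>C e)"
    have S: "cinner f S = cinner f x" if f: "f \<in> Y" for f
    proof -
      have fe: "cinner f e = (if e = f then 1 else 0)" if "e \<in> Y" for e
        using E Y(3) f that unfolding is_onb_def by (metis subsetD)
      have "cinner f S = (\<Sum>e\<in>Y. cinner e x * cinner f e)" by (simp add: S_def cinner_sum_right cinner_simps)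
      also have "\<dots> = (\<Sum>e\<in>Y. if e = f then cinner f x else 0)"
        by (intro sum.cong) (simp_all add: fe)
      also have "\<dots> = cinner f x" using Y f by simp
      finally show ?thesis .
    qed
    have orth: "cinner v (x - S) = 0" if "v \<in> cspan Y" for v
      using that
      by (induction rule: cvec.span_induct_alt) (simp_all add: cinner_simps S)
    have "S - z \<in> cspan Y"
      unfolding S_def t(3) using t(2) Y
      by (intro cvec.span_diff cvec.span_sum cvec.span_scale cvec.span_base) auto
    then have o: "cinner (S - z) (x - S) = 0" by (rule orth)
    then have "cinner (x - S) (S - z) = 0" by (metis cinner_commute complex_cnj_zero)
    with o have "(norm ((x - S) + (S - z)))\<^sup>2 = (norm (x - S))\<^sup>2 + (norm (S - z))\<^sup>2"
      unfolding norm_power2_cinner by (simp only: cinner_add_left cinner_add_right) simp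
    then have "(norm (x - S))\<^sup>2 \<le> (norm (x - z))\<^sup>2" by simp
    then have "norm (x - S) \<le> norm (x - z)" by (rule power2_le_imp_le) simp
    then show ?thesis using z(2) by (simp add: S_def dist_norm norm_minus_commute)
  qed
  then show "\<forall>\<^sub>F Y in finite_subsets_at_top E. dist (\<Sum>e\<in>Y. cinner e x *\<^sub>C e) x < \<epsilon>"
    unfolding eventually_finite_subsets_at_top using t by blast
qed

lemma parseval:
  assumes "is_onb E"
  shows "((\<lambda>e. cinner y e * cinner e x) has_sum cinner y x) E"
  using has_sum_bounded_linear[OF bounded_linear_cinner_right onb_expansion[OF assms], of y x]
  by (simp add: cinner_simps mult.commute)

lemma parseval_norm:
  assumes "is_onb E"
  shows "((\<lambda>e. (cmod (cinner e x))\<^sup>2) has_sum (norm x)\<^sup>2) E"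
proof -
  have "((\<lambda>e. Re (cinner x e * cinner e x)) has_sum Re (cinner x x)) E"
    by (rule has_sum_bounded_linear[OF bounded_linear_Re parseval[OF assms]])
  moreover have "Re (cinner x e * cinner e x) = (cmod (cinner e x))\<^sup>2" for e
    by (subst cinner_commute) (simp add: cmod_power2 power2_eq_square[of "Re _"] power2_eq_square[of "Im _"])
  ultimately show ?thesis by (simp add: norm_power2_cinner)
qed


section \<open>The trace norm by duality with finite rank contractions\<close>

text \<open>The form of the finite rank operator \<open>u \<mapsto> \<Sum>\<^sub>i \<langle>y\<^sub>i, u\<rangle> x\<^sub>i\<close> is bounded by \<open>c\<close>. Using \<open>'a\<close> itself as index type
  is enough and lets finite subsets of an orthonormal basis serve as families.\<close>

definition finite_rank_le :: "real \<Rightarrow> 'a::complex_hilbert set \<Rightarrow> ('a \<Rightarrow> 'a) \<Rightarrow> ('a \<Rightarrow> 'a) \<Rightarrow> bool"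
  where "finite_rank_le c I x y \<longleftrightarrow> finite I \<and>
    (\<forall>u v. cmod (\<Sum>i\<in>I. cinner v (x i) * cinner (y i) u) \<le> c * norm u * norm v)"

text \<open>\<open>nuclear_le A K\<close> says that \<open>A\<close> is trace class with trace norm at most \<open>K\<close> (\<open>nuclear_le_iff\<close>).
  As a family of bounds on functionals that are continuous in the operator norm, it is visibly
  subadditive, two-sided submultiplicative, and stable under limits in operator norm.\<close>

definition nuclear_le :: "'a::complex_hilbert bounded_op \<Rightarrow> real \<Rightarrow> bool"
  where "nuclear_le A K \<longleftrightarrow> (\<forall>I x y. finite_rank_le 1 I x y \<longrightarrow>
    cmod (\<Sum>i\<in>I. cinner (y i) (op_apply A (x i))) \<le> K)"

lemma nuclear_leD: "nuclear_le A K \<Longrightarrow> finite_rank_le 1 I x y \<Longrightarrow> cmod (\<Sum>i\<in>I. cinner (y i) (op_apply A (x i))) \<le> K"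
  unfolding nuclear_le_def by blast

lemma nuclear_le_nonneg:
  assumes "nuclear_le A K"
  shows "0 \<le> K"
  using nuclear_leD[OF assms, of "{}"] by (simp add: finite_rank_le_def)

lemma nuclear_le_mono: "nuclear_le A K \<Longrightarrow> K \<le> L \<Longrightarrow> nuclear_le A L"
  unfolding nuclear_le_def by (meson order.trans)

lemma nuclear_le_zero: "nuclear_le 0 0"
  by (simp add: nuclear_le_def)

lemma nuclear_le_add: "nuclear_le A K \<Longrightarrow> nuclear_le B L \<Longrightarrow> nuclear_le (A + B) (K + L)"
  unfolding nuclear_le_def
  by (simp add: cinner_simps sum.distrib) (meson add_mono norm_triangle_ineq order.trans)

lemma nuclear_le_scaleC:
  assumes "nuclear_le A K"
  shows "nuclear_le (c *\<^sub>C A) (cmod c * K)"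
  unfolding nuclear_le_def
proof (intro allI impI)
  fix I x y assume "finite_rank_le 1 I x (y :: 'a \<Rightarrow> 'a)"
  from nuclear_leD[OF assms this]
  show "cmod (\<Sum>i\<in>I. cinner (y i) (op_apply (c *\<^sub>C A) (x i))) \<le> cmod c * K"
    by (simp add: cinner_simps sum_distrib_left[symmetric] norm_mult mult_left_mono)
qed

lemma nuclear_le_scaleR: "nuclear_le A K \<Longrightarrow> nuclear_le (r *\<^sub>R A) (\<bar>r\<bar> * K)"
  using nuclear_le_scaleC[of A K "of_real r"] by (simp add: scaleR_scaleC)

lemma nuclear_le_minus: "nuclear_le A K \<Longrightarrow> nuclear_le (- A) K"
  using nuclear_le_scaleR[of A K "- 1"] by simp

lemma nuclear_le_diff: "nuclear_le A K \<Longrightarrow> nuclear_le B L \<Longrightarrow> nuclear_le (A - B) (K + L)"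
  using nuclear_le_add[OF _ nuclear_le_minus] by (metis diff_conv_add_uminus)

lemma nuclear_le_sum:
  "(\<And>i. i \<in> J \<Longrightarrow> nuclear_le (A i) (K i)) \<Longrightarrow> nuclear_le (\<Sum>i\<in>J. A i) (\<Sum>i\<in>J. K i)"
  by (induction J rule: infinite_finite_induct) (simp_all add: nuclear_le_zero nuclear_le_add)

lemma nuclear_le_finite_rank:
  assumes A: "nuclear_le A K" and c: "0 < c" and fr: "finite_rank_le c I x y"
  shows "cmod (\<Sum>i\<in>I. cinner (y i) (op_apply A (x i))) \<le> c * K"
proof -
  have "finite_rank_le 1 I (\<lambda>i. (1 / c) *\<^sub>R x i) y"
    using fr c unfolding finite_rank_le_def
    by (simp add: cinner_simps mult.assoc sum_distrib_left[symmetric] norm_mult sum_divide_distrib[symmetric] norm_divide divide_simps)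
       (simp add: mult_ac)
  from nuclear_leD[OF A this] have "cmod (\<Sum>i\<in>I. cinner (y i) (op_apply A (x i))) / c \<le> K"
    using c by (simp add: cinner_simps sum_divide_distrib[symmetric] norm_divide)
  then show ?thesis using c by (simp add: divide_simps mult_ac)
qed

lemma nuclear_le_mult_left:
  assumes A: "nuclear_le A K"
  shows "nuclear_le (B * A) (norm B * K)"
proof (cases "B = 0")
  case True
  then show ?thesis by (simp add: nuclear_le_zero)
next
  case False
  show ?thesis
    unfolding nuclear_le_def
  proof (intro allI impI)
    fix I and x y :: "'a \<Rightarrow> 'a" assume fr: "finite_rank_le 1 I x y"
    have "finite_rank_le (norm B) I x (\<lambda>i. op_apply (adj B) (y i))"
      unfolding finite_rank_le_def cinner_adj_left
    proof (intro conjI allI)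
      fix u v
      have "cmod (\<Sum>i\<in>I. cinner v (x i) * cinner (y i) (op_apply B u)) \<le> norm (op_apply B u) * norm v"
        using fr by (simp add: finite_rank_le_def)
      also have "\<dots> \<le> norm B * norm u * norm v"
        by (intro mult_right_mono norm_op_apply) simp
      finally show "cmod (\<Sum>i\<in>I. cinner v (x i) * cinner (y i) (op_apply B u)) \<le> norm B * norm u * norm v" .
    qed (use fr in \<open>simp add: finite_rank_le_def\<close>)
    from nuclear_le_finite_rank[OF A _ this] False
    show "cmod (\<Sum>i\<in>I. cinner (y i) (op_apply (B * A) (x i))) \<le> norm B * K"
      by (simp add: cinner_adj_left)
  qed
qed

text \<open>Passing to the adjoint exchanges the two families, a condition symmetric in \<open>x\<close> and \<open>y\<close>.\<close>

lemma nuclear_le_adj: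
  assumes A: "nuclear_le A K"
  shows "nuclear_le (adj A) K"
  unfolding nuclear_le_def
proof (intro allI impI)
  fix I and x y :: "'a \<Rightarrow> 'a" assume fr: "finite_rank_le 1 I x y"
  have "finite_rank_le 1 I y x"
    unfolding finite_rank_le_def
  proof (intro conjI allI)
    fix u v
    have "(\<Sum>i\<in>I. cinner v (y i) * cinner (x i) u) = cnj (\<Sum>i\<in>I. cinner u (x i) * cinner (y i) v)"
      by (simp add: mult.commute cinner_commute[of "x _" u] cinner_commute[of v])
    then have "cmod (\<Sum>i\<in>I. cinner v (y i) * cinner (x i) u) = cmod (\<Sum>i\<in>I. cinner u (x i) * cinner (y i) v)"
      by (simp only: complex_mod_cnj)
    moreover have "cmod (\<Sum>i\<in>I. cinner u (x i) * cinner (y i) v) \<le> 1 * norm v * norm u"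
      using fr unfolding finite_rank_le_def by blast
    ultimately show "cmod (\<Sum>i\<in>I. cinner v (y i) * cinner (x i) u) \<le> 1 * norm u * norm v"
      by (simp add: mult.commute)
  qed (use fr in \<open>simp add: finite_rank_le_def\<close>)
  note le = nuclear_leD[OF A this]
  have "(\<Sum>i\<in>I. cinner (y i) (op_apply (adj A) (x i))) = cnj (\<Sum>i\<in>I. cinner (x i) (op_apply A (y i)))"
    by (simp add: cinner_adj_right cinner_commute[of "op_apply A _"])
  with le show "cmod (\<Sum>i\<in>I. cinner (y i) (op_apply (adj A) (x i))) \<le> K"
    by (simp only: complex_mod_cnj)
qed

lemma nuclear_le_mult_right:
  assumes A: "nuclear_le A K"
  shows "nuclear_le (A * B) (K * norm B)"
  using nuclear_le_adj[OF nuclear_le_mult_left[OF nuclear_le_adj[OF A], of "adj B"]]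
  by (simp add: adj_mult norm_adj mult.commute)

lemma norm_le_nuclear_le:
  assumes A: "nuclear_le A K"
  shows "norm A \<le> K"
proof (rule norm_op_bound[OF nuclear_le_nonneg[OF A]])
  fix x
  define z where "z = op_apply A x"
  show "norm (op_apply A x) \<le> K * norm x"
  proof (cases "x = 0 \<or> z = 0")
    case False
    have "finite_rank_le (norm x * norm z) {0} (\<lambda>_. x) (\<lambda>_. z)"
      unfolding finite_rank_le_def
    proof (intro conjI allI)
      fix u v
      have "cmod (cinner v x) * cmod (cinner z u) \<le> (norm v * norm x) * (norm z * norm u)"
        by (intro mult_mono cinner_cauchy_schwarz) auto
      then show "cmod (\<Sum>i\<in>{0}. cinner v x * cinner z u) \<le> norm x * norm z * norm u * norm v"
        by (simp add: norm_mult mult_ac)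
    qed simp
    from nuclear_le_finite_rank[OF A _ this] False
    have "cmod (cinner z (op_apply A x)) \<le> norm x * norm z * K" by simp
    then have "norm z * norm z \<le> norm z * (K * norm x)"
      by (simp add: z_def cinner_self power2_eq_square mult_ac norm_mult)
    then show ?thesis using False by (simp add: z_def)
  qed (use nuclear_le_nonneg[OF A] in \<open>auto simp: z_def\<close>)
qed

lemma tendsto_op_apply: "(A \<longlongrightarrow> L) F \<Longrightarrow> ((\<lambda>n. op_apply (A n) x) \<longlongrightarrow> op_apply L x) F"
  by (rule bounded_linear.tendsto[rotated], assumption)
    (rule bounded_linear_intro[where K = "norm x"], simp_all add: norm_op_apply)

lemma nuclear_le_limit:
  assumes "A \<longlonglongrightarrow> L" "\<And>n. nuclear_le (A n) K"
  shows "nuclear_le L K"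
  unfolding nuclear_le_def
proof (intro allI impI)
  fix I and x y :: "'a \<Rightarrow> 'a" assume fr: "finite_rank_le 1 I x y"
  have "(\<lambda>n. \<Sum>i\<in>I. cinner (y i) (op_apply (A n) (x i))) \<longlonglongrightarrow> (\<Sum>i\<in>I. cinner (y i) (op_apply L (x i)))"
    by (intro tendsto_sum bounded_linear.tendsto[OF bounded_linear_cinner_right] tendsto_op_apply assms(1))
  then show "cmod (\<Sum>i\<in>I. cinner (y i) (op_apply L (x i))) \<le> K"
    using nuclear_leD[OF assms(2) fr] by (intro LIMSEQ_le_const2[OF tendsto_norm]) blast+
qed

text \<open>Lower semicontinuity in the form needed for the approximate polar decomposition.\<close>

lemma nuclear_le_approximation:
  assumes "\<And>\<epsilon>. 0 < \<epsilon> \<Longrightarrow> \<exists>B. nuclear_le B K \<and> norm (B - A) \<le> \<epsilon> * c"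
  shows "nuclear_le A K"
proof -
  have "\<forall>n. \<exists>B. nuclear_le B K \<and> norm (B - A) \<le> (1 / (real n + 1)) * c"
    by (intro allI assms) simp
  then obtain B where B: "\<And>n. nuclear_le (B n) K" "\<And>n. norm (B n - A) \<le> (1 / (real n + 1)) * c"
    by metis
  have "(\<lambda>n. (1 / (real n + 1)) * c) \<longlonglongrightarrow> 0 * c"
    by (intro tendsto_intros LIMSEQ_inverse_real_of_nat[unfolded inverse_eq_divide Suc_eq_plus1 of_nat_add of_nat_1])
  then have "(\<lambda>n. B n - A) \<longlonglongrightarrow> 0"
    using B(2) by (intro Lim_null_comparison[of "\<lambda>n. B n - A" "\<lambda>n. (1 / (real n + 1)) * c"]) simp_all
  then have "B \<longlonglongrightarrow> A" by (simp add: LIM_zero_iff)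
  then show ?thesis by (rule nuclear_le_limit[OF _ B(1)])
qed

text \<open>In place of the partial isometry of the polar decomposition \<open>A = U \<bar>A\<bar>\<close> serve the contractions
  \<open>A (\<bar>A\<bar> + \<epsilon>)\<^sup>-\<^sup>1\<close>.\<close>

lemma polar_contraction:
  assumes "0 < \<epsilon>"
  obtains U where "norm U \<le> 1" "norm (U * abs_op A - A) \<le> \<epsilon>" "norm (adj U * A - abs_op A) \<le> \<epsilon>"
proof -
  let ?P = "abs_op A"
  obtain Z where Z: "?P * Z + \<epsilon> *\<^sub>R Z = 1" "Z * ?P + \<epsilon> *\<^sub>R Z = 1"
    "norm (?P * Z) \<le> 1" "norm (\<epsilon> *\<^sub>R Z) \<le> 1" "adj Z = Z"
    using positive_resolvent[OF abs_op_positive[of A] assms] by blast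
  define U where "U = A * Z"
  have U: "norm U \<le> 1"
  proof (rule norm_op_bound)
    fix x
    have "norm (op_apply U x) = norm (op_apply (?P * Z) x)"
      by (simp add: U_def norm_abs_op_apply)
    also have "\<dots> \<le> norm (?P * Z) * norm x" by (rule norm_op_apply)
    also have "\<dots> \<le> 1 * norm x" using Z(3) by (rule mult_right_mono) simp
    finally show "norm (op_apply U x) \<le> 1 * norm x" .
  qed simp
  have ZP: "Z * ?P = 1 - \<epsilon> *\<^sub>R Z" using Z(2) by (simp add: eq_diff_eq)
  have PZ: "?P * Z = 1 - \<epsilon> *\<^sub>R Z" using Z(1) by (simp add: eq_diff_eq)
  have "U * ?P - A = - (\<epsilon> *\<^sub>R U)"
    by (simp add: U_def mult.assoc ZP right_diff_distrib)
  then have 1: "norm (U * ?P - A) \<le> \<epsilon>" using U assms by (simp add: mult_left_le)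
  have "adj U * A = Z * (?P * ?P)" by (simp add: U_def adj_mult Z(5) mult.assoc abs_op_square)
  also have "\<dots> = ?P - \<epsilon> *\<^sub>R (?P * Z)"
    by (simp add: mult.assoc[symmetric] ZP PZ left_diff_distrib)
  finally have "adj U * A - ?P = - (\<epsilon> *\<^sub>R (?P * Z))" by simp
  then have 2: "norm (adj U * A - ?P) \<le> \<epsilon>" using Z(3) assms by (simp add: mult_left_le)
  show thesis using that U 1 2 by blast
qed

lemma nuclear_le_abs_op:
  assumes "nuclear_le A K"
  shows "nuclear_le (abs_op A) K"
proof (rule nuclear_le_approximation)
  fix \<epsilon> :: real assume "0 < \<epsilon>"
  then obtain U where U: "norm U \<le> 1" "norm (adj U * A - abs_op A) \<le> \<epsilon>"
    by (rule polar_contraction)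
  have "nuclear_le (adj U * A) K"
    by (rule nuclear_le_mono[OF nuclear_le_mult_left[OF assms]])
      (use U nuclear_le_nonneg[OF assms] in \<open>simp add: norm_adj mult_left_le_one_le\<close>)
  then show "\<exists>B. nuclear_le B K \<and> norm (B - abs_op A) \<le> \<epsilon> * 1" using U by auto
qed

text \<open>The factor \<open>G\<close> will be \<open>1\<close> or the complement of a finite rank projection.\<close>

lemma nuclear_le_of_abs_op_mult:
  assumes "nuclear_le (abs_op A * G) K"
  shows "nuclear_le (A * G) K"
proof (rule nuclear_le_approximation)
  fix \<epsilon> :: real assume "0 < \<epsilon>"
  then obtain U where U: "norm U \<le> 1" "norm (U * abs_op A - A) \<le> \<epsilon>"
    by (rule polar_contraction)
  have "nuclear_le (U * (abs_op A * G)) K"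
    by (rule nuclear_le_mono[OF nuclear_le_mult_left[OF assms]])
      (use U nuclear_le_nonneg[OF assms] in \<open>simp add: mult_left_le_one_le\<close>)
  moreover have "norm (U * (abs_op A * G) - A * G) \<le> \<epsilon> * norm G"
    using U(2) norm_mult_ineq[of "U * abs_op A - A" G]
    by (simp add: mult.assoc[symmetric] left_diff_distrib[symmetric]) (meson mult_right_mono norm_ge_zero order.trans)
  ultimately show "\<exists>B. nuclear_le B K \<and> norm (B - A * G) \<le> \<epsilon> * norm G" by blast
qed


section \<open>Hilbert--Schmidt bounds and the trace class\<close>

definition hilbert_schmidt_le :: "'a::complex_hilbert set \<Rightarrow> 'a bounded_op \<Rightarrow> real \<Rightarrow> bool"
  where "hilbert_schmidt_le E A K \<longleftrightarrow> (\<forall>F. finite F \<longrightarrow> F \<subseteq> E \<longrightarrow> (\<Sum>e\<in>F. (norm (op_apply A e))\<^sup>2) \<le> K)"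

lemma has_sum_finite_sum:
  fixes f :: "'i \<Rightarrow> 'b \<Rightarrow> 'c::topological_comm_monoid_add"
  assumes "finite I" "\<And>i. i \<in> I \<Longrightarrow> (f i has_sum s i) A"
  shows "((\<lambda>e. \<Sum>i\<in>I. f i e) has_sum (\<Sum>i\<in>I. s i)) A"
  using assms by (induction I rule: finite_induct) (simp_all add: has_sum_add)

lemma has_sum_norm_le:
  fixes f :: "'b \<Rightarrow> 'c::real_normed_vector"
  assumes "(f has_sum s) A" "\<And>F. finite F \<Longrightarrow> F \<subseteq> A \<Longrightarrow> norm (sum f F) \<le> K"
  shows "norm s \<le> K"
  using assms
  by (intro tendsto_upperbound[OF tendsto_norm[OF assms(1)[unfolded has_sum_def]]]
      eventually_finite_subsets_at_top_weakI) auto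

lemma bessel_finite:
  assumes "is_onb E" "finite F" "F \<subseteq> E"
  shows "(\<Sum>e\<in>F. (cmod (cinner e x))\<^sup>2) \<le> (norm x)\<^sup>2"
  using finite_sum_le_has_sum[OF parseval_norm[OF assms(1)] assms(2,3)] by simp

text \<open>Both Hilbert--Schmidt norms are the same double sum of the \<open>\<bar>\<langle>f, D e\<rangle>\<bar>\<^sup>2\<close>.\<close>

lemma hilbert_schmidt_le_adj:
  assumes E: "is_onb E" and D: "hilbert_schmidt_le E D K"
  shows "hilbert_schmidt_le E (adj D) K"
  unfolding hilbert_schmidt_le_def
proof (intro allI impI)
  fix F assume F: "finite F" "F \<subseteq> E"
  have "((\<lambda>e. \<Sum>f\<in>F. (cmod (cinner e (op_apply (adj D) f)))\<^sup>2) has_sum (\<Sum>f\<in>F. (norm (op_apply (adj D) f))\<^sup>2)) E"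
    by (intro has_sum_finite_sum parseval_norm E F)
  then show "(\<Sum>f\<in>F. (norm (op_apply (adj D) f))\<^sup>2) \<le> K"
  proof (rule has_sum_le_finite_sums)
    fix G assume G: "finite G" "G \<subseteq> E"
    have "(\<Sum>e\<in>G. \<Sum>f\<in>F. (cmod (cinner e (op_apply (adj D) f)))\<^sup>2) \<le> (\<Sum>e\<in>G. (norm (op_apply D e))\<^sup>2)"
    proof (rule sum_mono)
      fix e
      have "cmod (cinner e (op_apply (adj D) f)) = cmod (cinner f (op_apply D e))" for f
        by (metis cinner_adj_right cinner_commute complex_mod_cnj)
      then show "(\<Sum>f\<in>F. (cmod (cinner e (op_apply (adj D) f)))\<^sup>2) \<le> (norm (op_apply D e))\<^sup>2"
        using bessel_finite[OF E F] by simp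
    qed
    also have "\<dots> \<le> K" using D G by (simp add: hilbert_schmidt_le_def)
    finally show "(\<Sum>e\<in>G. \<Sum>f\<in>F. (cmod (cinner e (op_apply (adj D) f)))\<^sup>2) \<le> K" .
  qed
qed

text \<open>Parseval's identity moves the form of a finite rank contraction from its vectors to the basis:
  \<open>\<Sum>\<^sub>i \<langle>y\<^sub>i, C D x\<^sub>i\<rangle> = \<Sum>\<^sub>e \<Sum>\<^sub>i \<langle>D\<^sup>* e, x\<^sub>i\<rangle> \<langle>y\<^sub>i, C e\<rangle>\<close>, and each inner sum is at most \<open>\<parallel>C e\<parallel> \<parallel>D\<^sup>* e\<parallel>\<close>.\<close>

lemma nuclear_le_hilbert_schmidt_mult:
  assumes E: "is_onb E" and C: "hilbert_schmidt_le E C (a\<^sup>2)" and D: "hilbert_schmidt_le E (adj D) (b\<^sup>2)"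
    and ab: "0 \<le> a" "0 \<le> b"
  shows "nuclear_le (C * D) (a * b)"
  unfolding nuclear_le_def
proof (intro allI impI)
  fix I and x y :: "'a \<Rightarrow> 'a" assume fr: "finite_rank_le 1 I x y"
  define g where "g = (\<lambda>e. \<Sum>i\<in>I. cinner (op_apply (adj C) (y i)) e * cinner e (op_apply D (x i)))"
  have "(g has_sum (\<Sum>i\<in>I. cinner (op_apply (adj C) (y i)) (op_apply D (x i)))) E"
    unfolding g_def using fr by (intro has_sum_finite_sum parseval E) (simp add: finite_rank_le_def)
  then have sum: "(g has_sum (\<Sum>i\<in>I. cinner (y i) (op_apply (C * D) (x i)))) E"
    by (simp add: cinner_adj_left)
  have g: "cmod (g e) \<le> norm (op_apply C e) * norm (op_apply (adj D) e)" for e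
  proof -
    have "g e = (\<Sum>i\<in>I. cinner (op_apply (adj D) e) (x i) * cinner (y i) (op_apply C e))"
      by (simp add: g_def cinner_adj_left mult.commute)
    then show ?thesis using fr by (simp add: finite_rank_le_def)
  qed
  show "cmod (\<Sum>i\<in>I. cinner (y i) (op_apply (C * D) (x i))) \<le> a * b"
  proof (rule has_sum_norm_le[OF sum])
    fix F assume F: "finite F" "F \<subseteq> E"
    have "cmod (sum g F) \<le> (\<Sum>e\<in>F. norm (op_apply C e) * norm (op_apply (adj D) e))"
      by (intro sum_norm_le g)
    also have "\<dots> = (\<Sum>e\<in>F. \<bar>norm (op_apply C e)\<bar> * \<bar>norm (op_apply (adj D) e)\<bar>)" by simp
    also have "\<dots> \<le> L2_set (\<lambda>e. norm (op_apply C e)) F * L2_set (\<lambda>e. norm (op_apply (adj D) e)) F"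
      by (rule L2_set_mult_ineq)
    also have "\<dots> \<le> a * b"
      unfolding L2_set_def using C D F ab
      by (intro mult_mono real_le_lsqrt) (auto simp: hilbert_schmidt_le_def sum_nonneg)
    finally show "cmod (sum g F) \<le> a * b" .
  qed
qed

text \<open>The finite rank contraction that multiplies each \<open>e\<close> by a suitable phase turns the sum of the diagonal
  entries into the sum of their absolute values.\<close>

lemma nuclear_le_diagonal:
  assumes A: "nuclear_le A K" and E: "is_onb E" and F: "finite F" "F \<subseteq> E"
  shows "(\<Sum>e\<in>F. cmod (cinner e (op_apply A e))) \<le> K"
proof -
  define c where "c = (\<lambda>e. cnj (sgn (cinner e (op_apply A e))))"
  have c1: "cmod (c e) \<le> 1" for e by (simp add: c_def norm_sgn)
  have "finite_rank_le 1 F (\<lambda>e. c e *\<^sub>C e) (\<lambda>e. e)"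
    unfolding finite_rank_le_def
  proof (intro conjI allI)
    fix u v
    have "cmod (\<Sum>e\<in>F. cinner v (c e *\<^sub>C e) * cinner e u) \<le> (\<Sum>e\<in>F. \<bar>cmod (cinner e v)\<bar> * \<bar>cmod (cinner e u)\<bar>)"
    proof (rule sum_norm_le)
      fix e
      have "cmod (cinner v e) = cmod (cinner e v)" by (metis cinner_commute complex_mod_cnj)
      then have "cmod (cinner v (c e *\<^sub>C e) * cinner e u) = cmod (c e) * (cmod (cinner e v) * cmod (cinner e u))"
        by (simp add: cinner_simps norm_mult)
      also have "\<dots> \<le> 1 * (cmod (cinner e v) * cmod (cinner e u))"
        by (intro mult_right_mono c1) simp
      finally show "cmod (cinner v (c e *\<^sub>C e) * cinner e u) \<le> \<bar>cmod (cinner e v)\<bar> * \<bar>cmod (cinner e u)\<bar>" by simp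
    qed
    also have "\<dots> \<le> L2_set (\<lambda>e. cmod (cinner e v)) F * L2_set (\<lambda>e. cmod (cinner e u)) F"
      by (rule L2_set_mult_ineq)
    also have "\<dots> \<le> norm v * norm u"
      unfolding L2_set_def
      by (intro mult_mono real_le_lsqrt bessel_finite[OF E F]) (simp_all add: sum_nonneg)
    finally show "cmod (\<Sum>e\<in>F. cinner v (c e *\<^sub>C e) * cinner e u) \<le> 1 * norm u * norm v"
      by (simp add: mult.commute)
  qed (rule F)
  from nuclear_leD[OF A this]
  have "cmod (\<Sum>e\<in>F. c e * cinner e (op_apply A e)) \<le> K" by (simp add: cinner_simps)
  moreover have "c e * cinner e (op_apply A e) = of_real (cmod (cinner e (op_apply A e)))" for e
    unfolding c_def by (simp add: sgn_eq complex_norm_square[symmetric] mult.commute power2_eq_square)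
  ultimately have "cmod (of_real (\<Sum>e\<in>F. cmod (cinner e (op_apply A e)))) \<le> K" by simp
  then show ?thesis unfolding norm_of_real by simp
qed

lemma positive_sqrt_norm:
  assumes "positive_op Q"
  shows "(norm (op_apply Q e))\<^sup>2 = Re (cinner e (op_apply (Q * Q) e))"
  by (simp add: norm_power2_cinner positive_op_hermitian[OF assms])

text \<open>With \<open>P = Q\<^sup>2\<close> for positive \<open>Q\<close>, the diagonal sum of \<open>P\<close> is the squared Hilbert--Schmidt norm of \<open>Q\<close>.\<close>

lemma nuclear_le_positive:
  assumes E: "is_onb E" and P: "positive_op P"
    and le: "\<And>F. finite F \<Longrightarrow> F \<subseteq> E \<Longrightarrow> (\<Sum>e\<in>F. Re (cinner e (op_apply P e))) \<le> K"
  shows "nuclear_le P K"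
proof -
  obtain Q where Q: "positive_op Q" "Q * Q = P" using positive_sqrt_exists[OF P] by metis
  have K: "0 \<le> K" using le[of "{}"] by simp
  have hs: "hilbert_schmidt_le E Q ((sqrt K)\<^sup>2)"
    using le K by (simp add: hilbert_schmidt_le_def positive_sqrt_norm[OF Q(1)] Q(2))
  have "nuclear_le (Q * Q) (sqrt K * sqrt K)"
    by (rule nuclear_le_hilbert_schmidt_mult[OF E hs]) (use hs K in \<open>simp_all add: positive_op_adj[OF Q(1)]\<close>)
  then show ?thesis using K by (simp add: Q)
qed

lemma nuclear_le_summable:
  assumes A: "nuclear_le A K" and E: "is_onb E"
  shows "(\<lambda>e. cinner e (op_apply A e)) summable_on E" "cmod (\<Sum>\<^sub>\<infinity>e\<in>E. cinner e (op_apply A e)) \<le> K"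
proof -
  have "(\<lambda>e. norm (cinner e (op_apply A e))) summable_on E"
    by (rule nonneg_bdd_above_summable_on)
      (auto intro!: bdd_aboveI[of _ K] nuclear_le_diagonal[OF A E])
  then show s: "(\<lambda>e. cinner e (op_apply A e)) summable_on E" by (rule abs_summable_summable)
  show "cmod (\<Sum>\<^sub>\<infinity>e\<in>E. cinner e (op_apply A e)) \<le> K"
  proof (rule has_sum_norm_le[OF has_sum_infsum[OF s]])
    fix F assume "finite F" "F \<subseteq> E"
    then show "cmod (\<Sum>e\<in>F. cinner e (op_apply A e)) \<le> K"
      by (intro order.trans[OF norm_sum] nuclear_le_diagonal[OF A E])
  qed
qed

definition trace_basis :: "'a::complex_hilbert set"
  where "trace_basis = (SOME E. is_onb E)"

lemma trace_basis: "is_onb trace_basis"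
  unfolding trace_basis_def using is_onb_exists by (rule someI_ex)

lemma trace_eq: "trace A = (\<Sum>\<^sub>\<infinity>e\<in>trace_basis. cinner e (op_apply A e))"
  by (simp add: trace_def trace_basis_def)

lemma nuclear_le_of_summable:
  assumes E: "is_onb E" and s: "(\<lambda>e. cinner e (op_apply (abs_op A) e)) summable_on E"
  shows "nuclear_le A (Re (\<Sum>\<^sub>\<infinity>e\<in>E. cinner e (op_apply (abs_op A) e)))"
proof -
  have "((\<lambda>e. Re (cinner e (op_apply (abs_op A) e))) has_sum Re (\<Sum>\<^sub>\<infinity>e\<in>E. cinner e (op_apply (abs_op A) e))) E"
    by (rule has_sum_Re[OF has_sum_infsum[OF s]])
  then have "nuclear_le (abs_op A) (Re (\<Sum>\<^sub>\<infinity>e\<in>E. cinner e (op_apply (abs_op A) e)))"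
    by (intro nuclear_le_positive[OF E abs_op_positive] finite_sum_le_has_sum)
      (auto intro: positive_opD(2)[OF abs_op_positive])
  then show ?thesis using nuclear_le_of_abs_op_mult[of A 1] by simp
qed

text \<open>The definition of the trace class asks for some orthonormal basis, that of the trace norm uses a chosen one.
  Since \<open>nuclear_le\<close> mentions no basis, it mediates between the two.\<close>

lemma nuclear_le_iff: "nuclear_le A K \<longleftrightarrow> trace_class A \<and> trace_norm A \<le> K"
proof
  assume "nuclear_le A K"
  from nuclear_le_summable[OF nuclear_le_abs_op[OF this] trace_basis]
  have "(\<lambda>e. cinner e (op_apply (abs_op A) e)) summable_on trace_basis" "cmod (trace (abs_op A)) \<le> K"
    by (simp_all add: trace_eq)
  then show "trace_class A \<and> trace_norm A \<le> K"
    using trace_basis complex_Re_le_cmod[of "trace (abs_op A)"] by (auto simp: trace_class_def trace_norm_def)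
next
  assume A: "trace_class A \<and> trace_norm A \<le> K"
  then obtain E where "is_onb E" "(\<lambda>e. cinner e (op_apply (abs_op A) e)) summable_on E"
    by (auto simp: trace_class_def)
  then have "\<exists>L. nuclear_le A L" using nuclear_le_of_summable by blast
  then obtain L where "nuclear_le A L" by blast
  from nuclear_le_summable(1)[OF nuclear_le_abs_op[OF this] trace_basis]
  have "nuclear_le A (trace_norm A)"
    unfolding trace_norm_def trace_eq by (rule nuclear_le_of_summable[OF trace_basis])
  then show "nuclear_le A K" using A nuclear_le_mono by blast
qed

lemma trace_class_iff: "trace_class A \<longleftrightarrow> (\<exists>K. nuclear_le A K)"
  using nuclear_le_iff by blast

lemma nuclear_le_trace_norm: "trace_class A \<Longrightarrow> nuclear_le A (trace_norm A)"
  by (simp add: nuclear_le_iff)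

lemma trace_norm_nonneg: "trace_class A \<Longrightarrow> 0 \<le> trace_norm A"
  using nuclear_le_trace_norm nuclear_le_nonneg by blast

lemma trace_class_zero [simp]: "trace_class 0"
  using nuclear_le_zero trace_class_iff by blast

lemma trace_class_add: "trace_class A \<Longrightarrow> trace_class B \<Longrightarrow> trace_class (A + B)"
  using nuclear_le_add trace_class_iff by metis

lemma trace_class_minus: "trace_class A \<Longrightarrow> trace_class (- A)"
  using nuclear_le_minus trace_class_iff by metis

lemma trace_class_diff: "trace_class A \<Longrightarrow> trace_class B \<Longrightarrow> trace_class (A - B)"
  using nuclear_le_diff trace_class_iff by metis

lemma trace_class_scaleC: "trace_class A \<Longrightarrow> trace_class (c *\<^sub>C A)"
  using nuclear_le_scaleC trace_class_iff by metis

lemma trace_class_mult_left: "trace_class A \<Longrightarrow> trace_class (B * A)"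
  using nuclear_le_mult_left trace_class_iff by metis

lemma trace_class_mult_right: "trace_class A \<Longrightarrow> trace_class (A * B)"
  using nuclear_le_mult_right trace_class_iff by metis

lemma trace_class_adj: "trace_class A \<Longrightarrow> trace_class (adj A)"
  using nuclear_le_adj trace_class_iff by metis

lemma trace_class_sum: "(\<And>i. i \<in> J \<Longrightarrow> trace_class (A i)) \<Longrightarrow> trace_class (\<Sum>i\<in>J. A i)"
  by (induction J rule: infinite_finite_induct) (simp_all add: trace_class_add)

lemma trace_norm_minus [simp]: "trace_class A \<Longrightarrow> trace_norm (- A) = trace_norm A"
  by (metis minus_minus nuclear_le_iff nuclear_le_minus order.antisym order_refl)


section \<open>The trace\<close>

lemma trace_has_sum:
  "trace_class A \<Longrightarrow> ((\<lambda>e. cinner e (op_apply A e)) has_sum trace A) trace_basis"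
  unfolding trace_eq by (intro has_sum_infsum nuclear_le_summable(1)[OF nuclear_le_trace_norm trace_basis])

lemma cmod_trace_le: "nuclear_le A K \<Longrightarrow> cmod (trace A) \<le> K"
  unfolding trace_eq by (rule nuclear_le_summable(2)[OF _ trace_basis])

lemma trace_add: "trace_class A \<Longrightarrow> trace_class B \<Longrightarrow> trace (A + B) = trace A + trace B"
  using has_sum_add[OF trace_has_sum[of A] trace_has_sum[of B]] trace_has_sum[OF trace_class_add[of A B]]
  by (auto simp: cinner_simps intro: has_sum_unique)

lemma trace_scaleC: "trace_class A \<Longrightarrow> trace (c *\<^sub>C A) = c * trace A"
  using has_sum_cmult_right[OF trace_has_sum[of A], of c] trace_has_sum[OF trace_class_scaleC[of A c]]
  by (auto simp: cinner_simps intro: has_sum_unique)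

lemma trace_minus: "trace_class A \<Longrightarrow> trace (- A) = - trace A"
  using trace_scaleC[of A "- 1"] by (simp add: scaleC_one)

lemma trace_diff: "trace_class A \<Longrightarrow> trace_class B \<Longrightarrow> trace (A - B) = trace A - trace B"
  using trace_add[of A "- B"] by (simp add: trace_class_minus trace_minus)

lemma trace_zero [simp]: "trace 0 = 0"
  by (simp add: trace_eq)

lemma trace_sum: "(\<And>i. i \<in> J \<Longrightarrow> trace_class (A i)) \<Longrightarrow> trace (\<Sum>i\<in>J. A i) = (\<Sum>i\<in>J. trace (A i))"
  by (induction J rule: infinite_finite_induct) (simp_all add: trace_add trace_class_sum)

lemma trace_adj: "trace_class A \<Longrightarrow> trace (adj A) = cnj (trace A)"
proof -
  assume A: "trace_class A"
  have "cinner e (op_apply (adj A) e) = cnj (cinner e (op_apply A e))" for e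
    by (metis cinner_adj_right cinner_commute)
  then show ?thesis by (simp add: trace_eq)
qed

lemma rank_one_exists: "\<exists>!A. \<forall>u. op_apply A u = cinner y u *\<^sub>C x"
proof (rule ex_ex1I)
  obtain A where "\<And>u. op_apply A u = cinner y u *\<^sub>C x"
  proof (rule op_of_function[of "\<lambda>u. cinner y u *\<^sub>C x" "norm y * norm x"])
    show "norm (cinner y u *\<^sub>C x) \<le> norm y * norm x * norm u" for u
      using mult_right_mono[OF cinner_cauchy_schwarz[of y u], of "norm x"] by (simp add: norm_scaleC mult_ac)
  qed (auto simp: cinner_simps scaleC_add_left scaleC_scaleC)
  then show "\<exists>A. \<forall>u. op_apply A u = cinner y u *\<^sub>C x" by blast
qed (auto intro: op_eqI)

definition rank_one :: "'a::complex_hilbert \<Rightarrow> 'a \<Rightarrow> 'a bounded_op"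
  where "rank_one x y = (THE A. \<forall>u. op_apply A u = cinner y u *\<^sub>C x)"

lemma op_apply_rank_one [simp]: "op_apply (rank_one x y) u = cinner y u *\<^sub>C x"
  using theI'[OF rank_one_exists[of y x]] unfolding rank_one_def by blast

lemma mult_rank_one: "A * rank_one x y = rank_one (op_apply A x) y"
  by (rule op_eqI) simp

lemma rank_one_mult: "rank_one x y * A = rank_one x (op_apply (adj A) y)"
  by (rule op_eqI) (simp add: cinner_adj_left)

lemma trace_class_rank_one: "trace_class (rank_one x y)"
proof -
  have "nuclear_le (rank_one x y) (norm x * norm y)"
    unfolding nuclear_le_def
  proof (intro allI impI)
    fix I and f g :: "'a \<Rightarrow> 'a" assume "finite_rank_le 1 I f g"
    then have "cmod (\<Sum>i\<in>I. cinner y (f i) * cinner (g i) x) \<le> 1 * norm x * norm y"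
      unfolding finite_rank_le_def by blast
    then show "cmod (\<Sum>i\<in>I. cinner (g i) (op_apply (rank_one x y) (f i))) \<le> norm x * norm y"
      by (simp add: cinner_simps)
  qed
  then show ?thesis using trace_class_iff by blast
qed

lemma trace_rank_one: "trace (rank_one x y) = cinner y x"
  using parseval[OF trace_basis, of y x] trace_has_sum[OF trace_class_rank_one[of x y]]
  by (auto simp: cinner_simps intro: has_sum_unique)

definition basis_projection :: "'a::complex_hilbert set \<Rightarrow> 'a bounded_op"
  where "basis_projection F = (\<Sum>e\<in>F. rank_one e e)"

lemma op_apply_op_sum: "op_apply (\<Sum>i\<in>I. A i) x = (\<Sum>i\<in>I. op_apply (A i) x)"
  by (induction I rule: infinite_finite_induct) simp_all

lemma basis_projection_apply:
  assumes "is_onb E" "finite F" "F \<subseteq> E" "e \<in> E"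
  shows "op_apply (basis_projection F) e = (if e \<in> F then e else 0)"
proof -
  have "cinner f e *\<^sub>C f = (if f = e then e else 0)" if "f \<in> F" for f
    using assms that by (auto simp: is_onb_def scaleC_one subset_iff)
  then have "op_apply (basis_projection F) e = (\<Sum>f\<in>F. if f = e then e else 0)"
    by (simp add: basis_projection_def op_apply_op_sum cong: sum.cong)
  then show ?thesis using assms(2) by simp
qed

text \<open>With \<open>\<bar>Z\<bar> = Q\<^sup>2\<close>, the error \<open>\<bar>Z\<bar> (1 - P\<^sub>F)\<close> is the product of \<open>Q\<close> and \<open>Q (1 - P\<^sub>F)\<close>; the Hilbert--Schmidt norm
  of the latter is a tail of the convergent sum of the \<open>\<parallel>Q e\<parallel>\<^sup>2\<close>.\<close>

lemma basis_projection_approximation: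
  assumes Z: "trace_class Z" and E: "is_onb E" and \<epsilon>: "0 < \<epsilon>"
  obtains F\<^sub>0 where "finite F\<^sub>0" "F\<^sub>0 \<subseteq> E"
    "\<And>F. finite F \<Longrightarrow> F\<^sub>0 \<subseteq> F \<Longrightarrow> F \<subseteq> E \<Longrightarrow> nuclear_le (Z * (1 - basis_projection F)) \<epsilon>"
proof -
  obtain K where K: "nuclear_le (abs_op Z) K" using Z nuclear_le_abs_op trace_class_iff by blast
  have K0: "0 \<le> K" by (rule nuclear_le_nonneg[OF K])
  obtain Q where Q: "positive_op Q" "Q * Q = abs_op Z" using positive_sqrt_exists[OF abs_op_positive] by metis
  define q where "q = (\<lambda>e. (norm (op_apply Q e))\<^sup>2)"
  have q: "q e = Re (cinner e (op_apply (abs_op Z) e))" for e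
    by (simp add: q_def positive_sqrt_norm[OF Q(1)] Q(2))
  have "q summable_on E"
    unfolding q by (rule summable_on_Re[OF nuclear_le_summable(1)[OF K E]])
  then obtain s where s: "(q has_sum s) E" by (auto simp: summable_on_def)
  have hsQ: "hilbert_schmidt_le E Q ((sqrt s)\<^sup>2)"
    using s finite_sum_le_has_sum[OF s] has_sum_nonneg[OF s]
    by (simp add: hilbert_schmidt_le_def q_def)
  define b where "b = \<epsilon> / (sqrt s + 1)"
  have s0: "0 \<le> s" using has_sum_nonneg[OF s] by (simp add: q_def)
  then have b: "b > 0" using \<epsilon> by (simp add: b_def add_nonneg_pos)
  have "\<forall>\<^sub>F F in finite_subsets_at_top E. dist (sum q F) s < b\<^sup>2"
    using s b unfolding has_sum_def by (intro tendstoD) auto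
  then obtain F\<^sub>0 where F\<^sub>0: "finite F\<^sub>0" "F\<^sub>0 \<subseteq> E" "dist (sum q F\<^sub>0) s < b\<^sup>2"
    unfolding eventually_finite_subsets_at_top by blast
  show thesis
  proof (rule that[OF F\<^sub>0(1,2)])
    fix F assume F: "finite F" "F\<^sub>0 \<subseteq> F" "F \<subseteq> E"
    define D where "D = Q * (1 - basis_projection F)"
    have "hilbert_schmidt_le E D (b\<^sup>2)"
      unfolding hilbert_schmidt_le_def
    proof (intro allI impI)
      fix G assume G: "finite G" "G \<subseteq> E"
      have "(\<Sum>e\<in>G. (norm (op_apply D e))\<^sup>2) = (\<Sum>e\<in>G. if e \<in> F then 0 else q e)"
        using G by (intro sum.cong) (auto simp: D_def basis_projection_apply[OF E F(1,3)] subset_iff q_def)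
      also have "\<dots> = sum q (G - F)"
        using G(1) by (simp add: sum.If_cases Diff_eq)
      also have "\<dots> \<le> sum q (G - F\<^sub>0)"
        using G F by (intro sum_mono2) (auto simp: q_def)
      also have "\<dots> = sum q ((G - F\<^sub>0) \<union> F\<^sub>0) - sum q F\<^sub>0"
        using G F\<^sub>0 by (subst sum.union_disjoint) auto
      also have "\<dots> \<le> s - sum q F\<^sub>0"
        using G F\<^sub>0 by (intro diff_right_mono finite_sum_le_has_sum[OF s]) (auto simp: q_def)
      also have "\<dots> \<le> b\<^sup>2" using F\<^sub>0(3) by (simp add: dist_real_def)
      finally show "(\<Sum>e\<in>G. (norm (op_apply D e))\<^sup>2) \<le> b\<^sup>2" .
    qed
    then have "nuclear_le (Q * D) (sqrt s * b)"
      using b s0 by (intro nuclear_le_hilbert_schmidt_mult[OF E hsQ hilbert_schmidt_le_adj[OF E]]) auto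
    then have "nuclear_le (abs_op Z * (1 - basis_projection F)) (sqrt s * b)"
      by (simp add: D_def mult.assoc[symmetric] Q(2))
    moreover have "sqrt s * b \<le> \<epsilon>"
      using \<epsilon> s0 by (simp add: b_def divide_simps add_nonneg_pos)
    ultimately show "nuclear_le (Z * (1 - basis_projection F)) \<epsilon>"
      using nuclear_le_of_abs_op_mult nuclear_le_mono by blast
  qed
qed

lemma trace_class_basis_projection: "trace_class (basis_projection F)"
  unfolding basis_projection_def by (intro trace_class_sum trace_class_rank_one)

text \<open>For operators of rank one cyclicity is Parseval's identity. Therefore \<open>Tr (Z P\<^sub>F B)\<close> is the partial sum
  over \<open>F\<close> of the series for \<open>Tr (B Z)\<close>, and it converges to \<open>Tr (Z B)\<close> because \<open>Z P\<^sub>F \<rightarrow> Z\<close> in trace norm.\<close>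

theorem trace_mult_commute:
  assumes Z: "trace_class Z"
  shows "trace (Z * B) = trace (B * Z)"
proof -
  have part: "trace (Z * basis_projection F * B) = (\<Sum>e\<in>F. cinner e (op_apply (B * Z) e))" for F
  proof -
    have eq: "Z * basis_projection F * B = (\<Sum>e\<in>F. rank_one (op_apply Z e) (op_apply (adj B) e))"
      by (simp add: basis_projection_def sum_distrib_left sum_distrib_right mult_rank_one rank_one_mult)
    show ?thesis
      unfolding eq by (subst trace_sum) (simp_all add: trace_class_rank_one trace_rank_one cinner_adj_left)
  qed
  have "((\<lambda>e. cinner e (op_apply (B * Z) e)) has_sum trace (Z * B)) trace_basis"
    unfolding has_sum_def
  proof (rule tendstoI)
    fix \<epsilon> :: real assume \<epsilon>: "0 < \<epsilon>"
    define \<delta> where "\<delta> = \<epsilon> / (norm B + 1)"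
    have \<delta>: "\<delta> > 0" "\<delta> * norm B < \<epsilon>"
      using \<epsilon> by (simp_all add: \<delta>_def divide_simps add_nonneg_pos)
    obtain F\<^sub>0 where F\<^sub>0: "finite F\<^sub>0" "F\<^sub>0 \<subseteq> trace_basis" "\<And>F. finite F \<Longrightarrow> F\<^sub>0 \<subseteq> F \<Longrightarrow> F \<subseteq> trace_basis \<Longrightarrow>
        nuclear_le (Z * (1 - basis_projection F)) \<delta>"
      using basis_projection_approximation[OF Z trace_basis \<delta>(1)] by blast
    have "dist (\<Sum>e\<in>F. cinner e (op_apply (B * Z) e)) (trace (Z * B)) < \<epsilon>"
      if F: "finite F" "F\<^sub>0 \<subseteq> F" "F \<subseteq> trace_basis" for F
    proof -
      have "Z * B = Z * basis_projection F * B + Z * (1 - basis_projection F) * B"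
        by (simp add: algebra_simps)
      moreover have "trace_class (Z * basis_projection F * B)" "trace_class (Z * (1 - basis_projection F) * B)"
        using Z by (simp_all add: trace_class_mult_right)
      ultimately have "trace (Z * B) - trace (Z * basis_projection F * B) = trace (Z * (1 - basis_projection F) * B)"
        using trace_add by (metis add_diff_cancel_left')
      moreover have "cmod (trace (Z * (1 - basis_projection F) * B)) \<le> \<delta> * norm B"
        by (intro cmod_trace_le nuclear_le_mult_right F\<^sub>0 F)
      ultimately show ?thesis
        using \<delta>(2) by (simp add: dist_norm norm_minus_commute part)
    qed
    then show "\<forall>\<^sub>F F in finite_subsets_at_top trace_basis.
        dist (\<Sum>e\<in>F. cinner e (op_apply (B * Z) e)) (trace (Z * B)) < \<epsilon>"
      unfolding eventually_finite_subsets_at_top using F\<^sub>0(1,2) by blast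
  qed
  then show ?thesis
    using trace_has_sum[OF trace_class_mult_left[OF Z, of B]] has_sum_unique by blast
qed

text \<open>Split \<open>S Y\<close> by a finite rank projection \<open>P\<^sub>F\<close>. The part \<open>S Y (1 - P\<^sub>F)\<close> is small in trace norm and \<open>R\<close> a contraction;
  on the other part \<open>R S\<close> is small in norm and \<open>Y P\<^sub>F\<close> a fixed trace class operator.\<close>

lemma trace_regularized_small:
  assumes SY: "trace_class (S * Y)" and \<delta>: "0 < \<delta>"
  obtains \<eta> where "0 < \<eta>"
    "\<And>R. norm R \<le> 1 \<Longrightarrow> norm (R * S) \<le> \<eta> \<Longrightarrow> cmod (trace (R * (S * Y))) \<le> \<delta>"
proof -
  obtain F where F: "nuclear_le (S * Y * (1 - basis_projection F)) (\<delta> / 2)"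
    using basis_projection_approximation[OF SY trace_basis, of "\<delta> / 2"] \<delta> by (metis half_gt_zero order_refl)
  obtain K where K: "nuclear_le (Y * basis_projection F) K"
    using trace_class_mult_left[OF trace_class_basis_projection] trace_class_iff by blast
  have K0: "0 \<le> K" by (rule nuclear_le_nonneg[OF K])
  show thesis
  proof (rule that[of "\<delta> / (2 * (K + 1))"])
    show "0 < \<delta> / (2 * (K + 1))" using \<delta> K0 by simp
    fix R assume R: "norm R \<le> 1" "norm (R * S) \<le> \<delta> / (2 * (K + 1))"
    have "nuclear_le ((R * S) * (Y * basis_projection F)) (\<delta> / 2)"
    proof (rule nuclear_le_mono[OF nuclear_le_mult_left[OF K]])
      have "norm (R * S) * K \<le> \<delta> / (2 * (K + 1)) * K" using R(2) K0 by (rule mult_right_mono)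
      also have "\<dots> \<le> \<delta> / 2" using \<delta> K0 by (simp add: divide_simps)
      finally show "norm (R * S) * K \<le> \<delta> / 2" .
    qed
    moreover have "nuclear_le (R * (S * Y * (1 - basis_projection F))) (\<delta> / 2)"
      using R(1) \<delta> by (intro nuclear_le_mono[OF nuclear_le_mult_left[OF F]]) (simp add: mult_left_le_one_le)
    ultimately have "nuclear_le ((R * S) * (Y * basis_projection F) + R * (S * Y * (1 - basis_projection F))) (\<delta> / 2 + \<delta> / 2)"
      by (rule nuclear_le_add)
    also have "(R * S) * (Y * basis_projection F) + R * (S * Y * (1 - basis_projection F)) = R * (S * Y)"
      by (simp add: algebra_simps)
    finally show "cmod (trace (R * (S * Y))) \<le> \<delta>" using cmod_trace_le by fastforce
  qed
qed

text \<open>Neither factor is trace class here, so \<open>trace_mult_commute\<close> does not apply. It does apply after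
  insertion of \<open>f = S (S\<^sup>2 + \<epsilon>)\<^sup>-\<^sup>1 S\<close>, which gives \<open>Tr (Y S f) = Tr (f S Y)\<close>; the complement \<open>\<rho> = 1 - f\<close> is a
  contraction with \<open>\<parallel>\<rho> S\<parallel> \<le> sqrt \<epsilon>\<close>, so both sides converge as \<open>\<epsilon> \<rightarrow> 0\<close>.\<close>

theorem trace_selfadjoint_commute:
  assumes S: "adj S = S" and YS: "trace_class (Y * S)" and SY: "trace_class (S * Y)"
  shows "trace (Y * S) = trace (S * Y)"
proof -
  have SY': "trace_class (S * adj Y)" using trace_class_adj[OF YS] by (simp add: adj_mult S)
  have "cmod (trace (Y * S) - trace (S * Y)) \<le> 0 + \<delta>" if \<delta>: "0 < \<delta>" for \<delta>
  proof -
    obtain \<eta>1 where \<eta>1: "0 < \<eta>1" "\<And>R. norm R \<le> 1 \<Longrightarrow> norm (R * S) \<le> \<eta>1 \<Longrightarrow> cmod (trace (R * (S * Y))) \<le> \<delta> / 2"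
      using trace_regularized_small[OF SY, of "\<delta> / 2"] \<delta> by auto
    obtain \<eta>2 where \<eta>2: "0 < \<eta>2" "\<And>R. norm R \<le> 1 \<Longrightarrow> norm (R * S) \<le> \<eta>2 \<Longrightarrow> cmod (trace (R * (S * adj Y))) \<le> \<delta> / 2"
      using trace_regularized_small[OF SY', of "\<delta> / 2"] \<delta> by auto
    define \<eta> where "\<eta> = min \<eta>1 \<eta>2"
    define \<epsilon> where "\<epsilon> = \<eta>\<^sup>2"
    have \<eta>: "\<eta> > 0" "\<epsilon> > 0" using \<eta>1 \<eta>2 by (simp_all add: \<eta>_def \<epsilon>_def)
    have pos: "positive_op (S * S)" using positive_op_adj_mult[of S] by (simp add: S)
    obtain Z where Z: "S * S * Z + \<epsilon> *\<^sub>R Z = 1" "Z * (S * S) + \<epsilon> *\<^sub>R Z = 1"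
      "norm (S * S * Z) \<le> 1" "norm (\<epsilon> *\<^sub>R Z) \<le> 1" "adj Z = Z"
      using positive_resolvent[OF pos \<eta>(2)] by blast
    define \<rho> where "\<rho> = \<epsilon> *\<^sub>R Z"
    have comm: "Z * S = S * Z"
    proof -
      have "Z * S = Z * S * (S * S * Z + \<epsilon> *\<^sub>R Z)" by (simp add: Z)
      also have "\<dots> = (Z * (S * S) + \<epsilon> *\<^sub>R Z) * S * Z" by (simp add: algebra_simps)
      also have "\<dots> = S * Z" by (simp add: Z)
      finally show ?thesis .
    qed
    have f: "1 - \<rho> = S * S * Z" using Z(1) by (simp add: \<rho>_def diff_eq_eq)
    have adj\<rho>: "adj \<rho> = \<rho>" by (simp add: \<rho>_def adj_scaleR Z(5))
    have \<rho>1: "norm \<rho> \<le> 1" using Z(4) by (simp add: \<rho>_def)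
    have \<rho>S: "norm (\<rho> * S) \<le> \<eta>"
    proof (rule norm_op_bound)
      fix x
      define z where "z = op_apply \<rho> x"
      have "\<rho> * S = S * \<rho>" by (simp add: \<rho>_def comm)
      then have "op_apply (\<rho> * S) x = op_apply S z" by (simp add: z_def)
      then have "(norm (op_apply (\<rho> * S) x))\<^sup>2 = Re (cinner z (op_apply (S * S * \<rho>) x))"
        using cinner_adj_left[of S z] by (simp add: norm_power2_cinner S z_def)
      also have "S * S * \<rho> = \<epsilon> *\<^sub>R (S * S * Z)" by (simp add: \<rho>_def)
      also have "Re (cinner z (op_apply (\<epsilon> *\<^sub>R (S * S * Z)) x)) = \<epsilon> * Re (cinner z (op_apply (S * S * Z) x))"
        by (simp add: cinner_simps)
      also have "\<dots> \<le> \<epsilon> * (norm x * norm x)"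
      proof (rule mult_left_mono)
        have "Re (cinner z (op_apply (S * S * Z) x)) \<le> norm z * norm (op_apply (S * S * Z) x)"
          by (rule order.trans[OF complex_Re_le_cmod cinner_cauchy_schwarz])
        also have "\<dots> \<le> norm x * norm x"
          using norm_op_apply[of \<rho> x] norm_op_apply[of "S * S * Z" x] mult_right_mono[OF \<rho>1, of "norm x"]
            mult_right_mono[OF Z(3), of "norm x"] by (intro mult_mono) (auto simp: z_def)
        finally show "Re (cinner z (op_apply (S * S * Z) x)) \<le> norm x * norm x" .
      qed (use \<eta> in simp)
      also have "\<dots> = (\<eta> * norm x)\<^sup>2" by (simp add: \<epsilon>_def power2_eq_square mult_ac)
      finally show "norm (op_apply (\<rho> * S) x) \<le> \<eta> * norm x"
        using \<eta> by (intro power2_le_imp_le[of "norm _"]) simp_all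
    qed (use \<eta> in simp)
    have "Y * S = Y * S * (S * (Z * S)) + Y * S * \<rho>"
    proof -
      have "S * (Z * S) = 1 - \<rho>" unfolding f by (simp add: comm mult.assoc)
      then have "Y * S = Y * S * (S * (Z * S) + \<rho>)" by simp
      then show ?thesis by (simp only: distrib_left)
    qed
    moreover have "trace_class (Y * S * (S * (Z * S)))" "trace_class (Y * S * \<rho>)"
      using YS by (auto intro: trace_class_mult_right)
    ultimately have 1: "trace (Y * S) = trace (Y * S * (S * (Z * S))) + trace (Y * S * \<rho>)"
      using trace_add by metis
    have "S * Y = S * (S * Z) * (S * Y) + \<rho> * (S * Y)"
      unfolding mult.assoc[symmetric] f[symmetric] by (simp add: algebra_simps)
    moreover have "trace_class (S * (S * Z) * (S * Y))" "trace_class (\<rho> * (S * Y))"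
      using SY by (auto intro: trace_class_mult_left)
    ultimately have 2: "trace (S * Y) = trace (S * (S * Z) * (S * Y)) + trace (\<rho> * (S * Y))"
      using trace_add by metis
    have "trace (Y * S * (S * (Z * S))) = trace (S * (Z * S) * (Y * S))"
      by (rule trace_mult_commute[OF YS])
    also have "S * (Z * S) * (Y * S) = (S * Z) * (S * Y) * S" by (simp add: mult.assoc)
    also have "trace \<dots> = trace (S * ((S * Z) * (S * Y)))"
      by (rule trace_mult_commute[OF trace_class_mult_left[OF SY]])
    finally have 3: "trace (Y * S * (S * (Z * S))) = trace (S * (S * Z) * (S * Y))" by (simp add: mult.assoc)
    \<comment> \<open>The lemma on small traces has the regularizing factor on the left; adjoints move it there.\<close>
    have "adj (\<rho> * (S * adj Y)) = Y * S * \<rho>" by (simp add: adj_mult adj\<rho> S mult.assoc)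
    then have "cmod (trace (Y * S * \<rho>)) = cmod (trace (\<rho> * (S * adj Y)))"
      using trace_adj[OF trace_class_mult_left[OF SY', of \<rho>]] by simp
    then have "cmod (trace (Y * S * \<rho>)) \<le> \<delta> / 2" "cmod (trace (\<rho> * (S * Y))) \<le> \<delta> / 2"
      using \<eta>1(2)[OF \<rho>1] \<eta>2(2)[OF \<rho>1] \<rho>S by (auto simp: \<eta>_def)
    moreover have "trace (Y * S) - trace (S * Y) = trace (Y * S * \<rho>) - trace (\<rho> * (S * Y))"
      by (simp add: 1 2 3)
    ultimately show ?thesis using norm_triangle_ineq4[of "trace (Y * S * \<rho>)" "trace (\<rho> * (S * Y))"] by simp
  qed
  then have "cmod (trace (Y * S) - trace (S * Y)) \<le> 0" by (rule field_le_epsilon)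
  then show ?thesis by simp
qed


section \<open>The norms on elementary tensors of length one and two\<close>

lemma clinearD: "clinear f \<Longrightarrow> f (x + y) = f x + f y" "clinear f \<Longrightarrow> f (c *\<^sub>C x) = c *\<^sub>C f x"
  by (simp_all add: Vector_Spaces.linear_iff)

lemma clinear_zero: "clinear f \<Longrightarrow> f 0 = 0"
  using clinearD(2)[of f 0 0] by simp

lemma clinear_minus: "clinear f \<Longrightarrow> f (- x) = - f x"
  using clinearD(1)[of f x "- x"] by (simp add: clinear_zero eq_neg_iff_add_eq_0 add.commute)

lemma clinear_diff: "clinear f \<Longrightarrow> f (x - y) = f x - f y"
  using clinearD(1)[of f x "- y"] by (simp add: clinear_minus)

lemma clinear_sum_arg: "clinear f \<Longrightarrow> f (\<Sum>i\<in>I. g i) = (\<Sum>i\<in>I. f (g i))"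
  by (induction I rule: infinite_finite_induct) (simp_all add: clinear_zero clinearD)

lemma clinear_scaleR: "clinear f \<Longrightarrow> f (r *\<^sub>R x) = r *\<^sub>R f x"
  by (simp add: scaleR_scaleC clinearD)

lemma clinear_letter:
  "clinear (\<lambda>a. elem_tensor [a])" "clinear (\<lambda>a. elem_tensor [a, y])" "clinear (\<lambda>b. elem_tensor [x, b])"
proof -
  have *: "clinear (\<lambda>a. elem_tensor (xs[k := a]))" if "k < length xs" for xs :: "'v::complex_vector list" and k
    using multilinear_elem_tensor that unfolding multilinear_def by blast
  from *[of 0 "[0]"] *[of 0 "[0, y]"] *[of 1 "[x, 0]"]
  show "clinear (\<lambda>a. elem_tensor [a])" "clinear (\<lambda>a. elem_tensor [a, y])" "clinear (\<lambda>b. elem_tensor [x, b])"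
    by simp_all
qed

lemma clinear_tensor_mult: "clinear (tensor_mult :: 'h::complex_hilbert bounded_op tensor \<Rightarrow> _)"
  unfolding tensor_mult_def
  by (rule clinear_tensor_lift)
    (simp add: multilinear_def Vector_Spaces.linear_iff vector_space_scaleC prod_list_update_split
      distrib_left distrib_right scaleC_mult_left scaleC_mult_right)

lemma scaleC_minus_one: "(- 1 :: complex) *\<^sub>C x = - x"
  using cvec.scale_minus_left[of 1 x] by (simp add: scaleC_one)

text \<open>The contribution of a word to the norm of a representation. Only \<open>m = 0\<close> and \<open>m = 1\<close> enter the homology group
  in degree zero, and there the cyclic shifts can be written out.\<close>

definition word_cost :: "nat \<Rightarrow> 'h::complex_hilbert bounded_op list \<Rightarrow> real"
  where "word_cost m xs = (\<Sum>i\<le>m. trace_norm (tensor_mult ((cyclic_shift ^^ i) (elem_tensor xs)))) + prod_list (map norm xs)"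

lemma word_cost_0: "word_cost 0 [x] = trace_norm x + norm x"
  by (simp add: word_cost_def tensor_mult_elem)

lemma word_cost_1: "trace_class (y * x) \<Longrightarrow> word_cost 1 [x, y] = trace_norm (x * y) + trace_norm (y * x) + norm x * norm y"
  by (simp add: word_cost_def tensor_mult_elem cyclic_shift_elem scaleC_minus_one clinear_minus[OF clinear_tensor_mult])

lemma admissible_0: "admissible 0 xs \<longleftrightarrow> (\<exists>x. xs = [x] \<and> trace_class x)"
  by (cases xs) (auto simp: admissible_def)

lemma admissible_1: "admissible 1 xs \<longleftrightarrow> (\<exists>x y. xs = [x, y] \<and> trace_class (x * y) \<and> trace_class (y * x))"
proof
  assume adm: "admissible 1 xs"
  then have "length xs = Suc (Suc 0)" by (simp add: admissible_def)
  then obtain x y where xs: "xs = [x, y]" by (metis length_0_conv length_Suc_conv)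
  have tc: "trace_class (prod_list (drop i xs @ take i xs))" if "i \<le> 1" for i
    using adm that unfolding admissible_def by blast
  show "\<exists>x y. xs = [x, y] \<and> trace_class (x * y) \<and> trace_class (y * x)"
    using tc[of 0] tc[of 1] by (simp add: xs)
next
  assume "\<exists>x y. xs = [x, y] \<and> trace_class (x * y) \<and> trace_class (y * x)"
  then obtain x y where xs: "xs = [x, y]" "trace_class (x * y)" "trace_class (y * x)" by blast
  have "trace_class (prod_list (drop i xs @ take i xs))" if "i \<le> 1" for i
  proof -
    have "i = 0 \<or> i = 1" using that by auto
    then show ?thesis using xs by auto
  qed
  then show "admissible 1 xs" by (simp add: admissible_def xs(1))
qed

lemma trace_norm_scaleC_le: "trace_class x \<Longrightarrow> trace_norm (c *\<^sub>C x) \<le> cmod c * trace_norm x"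
  using nuclear_le_scaleC[OF nuclear_le_trace_norm, of x c] nuclear_le_iff by blast

lemma norm_op_scaleC_le: "norm (c *\<^sub>C x) \<le> cmod c * norm x" for x :: "'a::complex_hilbert bounded_op"
  by (rule norm_op_bound) (simp_all add: norm_scaleC mult.assoc mult_left_mono norm_op_apply)

lemma small_degree_cases:
  assumes "m \<le> 1" "admissible m xs"
  obtains x where "m = 0" "xs = [x]" "trace_class x"
  | x y where "m = 1" "xs = [x, y]" "trace_class (x * y)" "trace_class (y * x)"
proof (cases "m = 0")
  case True
  then show thesis using assms(2) admissible_0 that(1) by blast
next
  case False
  then have "m = 1" using assms(1) by simp
  then show thesis using assms(2) admissible_1 that(2) by metis
qed

lemma word_cost_nonneg:
  assumes "m \<le> 1" "admissible m xs"
  shows "0 \<le> word_cost m xs"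
  using assms by (cases rule: small_degree_cases) (simp_all add: word_cost_0 word_cost_1[simplified] trace_norm_nonneg)

lemma admissible_scale:
  assumes m: "m \<le> 1" and xs: "admissible m xs"
  obtains ys where "admissible m ys" "elem_tensor ys = c *\<^sub>C elem_tensor xs" "word_cost m ys \<le> cmod c * word_cost m xs"
  using m xs
proof (cases rule: small_degree_cases)
  case (1 x)
  have "word_cost m [c *\<^sub>C x] \<le> cmod c * word_cost m xs"
    using 1 trace_norm_scaleC_le[of x c] norm_op_scaleC_le[of c x] by (simp add: word_cost_0 distrib_left)
  then show thesis
    using that[of "[c *\<^sub>C x]"] 1 clinearD(2)[OF clinear_letter(1), of c x] by (simp add: admissible_0 trace_class_scaleC)
next
  case (2 x y)
  have tc: "trace_class (c *\<^sub>C x * y)" "trace_class (y * (c *\<^sub>C x))"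
    using 2 by (simp_all add: scaleC_mult_left scaleC_mult_right trace_class_scaleC)
  have "norm (c *\<^sub>C x) * norm y \<le> cmod c * (norm x * norm y)"
    using mult_right_mono[OF norm_op_scaleC_le[of c x], of "norm y"] by (simp add: mult.assoc)
  then have "word_cost 1 [c *\<^sub>C x, y] \<le> cmod c * word_cost 1 [x, y]"
    unfolding word_cost_1[OF tc(2)] word_cost_1[OF 2(4)]
    using trace_norm_scaleC_le[OF 2(3), of c] trace_norm_scaleC_le[OF 2(4), of c]
    by (simp add: scaleC_mult_left scaleC_mult_right distrib_left)
  then show thesis
    using that[of "[c *\<^sub>C x, y]"] 2 tc clinearD(2)[OF clinear_letter(2), of c x y] by (auto simp: admissible_1 simp del: One_nat_def)
qed

text \<open>Absorbing scalars into a letter turns linear combinations into plain sums of admissible words.\<close>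

definition represents :: "nat \<Rightarrow> 'h::complex_hilbert bounded_op tensor \<Rightarrow> 'h bounded_op list list \<Rightarrow> bool"
  where "represents m x js \<longleftrightarrow> (\<forall>xs\<in>set js. admissible m xs) \<and> x = (\<Sum>xs\<leftarrow>js. elem_tensor xs)"

abbreviation total_cost :: "nat \<Rightarrow> 'h::complex_hilbert bounded_op list list \<Rightarrow> real"
  where "total_cost m js \<equiv> (\<Sum>xs\<leftarrow>js. word_cost m xs)"

lemma K_norm_eq: "K_norm m x = Inf {total_cost m js | js. represents m x js}"
  by (simp add: K_norm_def word_cost_def represents_def)

lemma represents_zero: "represents m 0 []"
  by (simp add: represents_def)

lemma represents_add: "represents m x js \<Longrightarrow> represents m y ks \<Longrightarrow> represents m (x + y) (js @ ks)"
  by (auto simp: represents_def)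

lemma represents_scale:
  assumes m: "m \<le> 1" and js: "represents m x js"
  obtains ks where "represents m (c *\<^sub>C x) ks" "total_cost m ks \<le> cmod c * total_cost m js"
proof -
  have "\<exists>ks. represents m (c *\<^sub>C x) ks \<and> total_cost m ks \<le> cmod c * total_cost m js"
    using js
  proof (induction js arbitrary: x)
    case Nil
    then show ?case by (auto simp: represents_def intro: exI[of _ "[]"])
  next
    case (Cons xs js)
    define y where "y = (\<Sum>xs\<leftarrow>js. elem_tensor xs)"
    have x: "x = elem_tensor xs + y" "admissible m xs" "represents m y js"
      using Cons.prems by (auto simp: represents_def y_def)
    obtain ks where ks: "represents m (c *\<^sub>C y) ks" "total_cost m ks \<le> cmod c * total_cost m js"
      using Cons.IH x(3) by blast
    obtain ys where ys: "admissible m ys" "elem_tensor ys = c *\<^sub>C elem_tensor xs" "word_cost m ys \<le> cmod c * word_cost m xs"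
      by (rule admissible_scale[OF m x(2)])
    have "represents m (c *\<^sub>C x) (ys # ks)"
      using ks(1) ys by (auto simp: represents_def x(1) scaleC_add_right)
    moreover have "total_cost m (ys # ks) \<le> cmod c * total_cost m (xs # js)"
      using ks(2) ys(3) by (simp add: distrib_left)
    ultimately show ?case by blast
  qed
  then show thesis using that by blast
qed

lemma total_cost_nonneg: "m \<le> 1 \<Longrightarrow> represents m x js \<Longrightarrow> 0 \<le> total_cost m js"
  by (auto simp: represents_def intro!: sum_list_nonneg word_cost_nonneg)

lemma K_alg_iff:
  assumes m: "m \<le> 1"
  shows "x \<in> K_alg m \<longleftrightarrow> (\<exists>js. represents m x js)"
proof
  assume "x \<in> K_alg m"
  then show "\<exists>js. represents m x js"
    unfolding K_alg_def
  proof (induction rule: cvec.span_induct_alt)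
    case base
    show ?case using represents_zero by blast
  next
    case (step c z y)
    then obtain xs where "z = elem_tensor xs" "admissible m xs" by blast
    then have "represents m z [xs]" by (simp add: represents_def)
    then obtain ks where "represents m (c *\<^sub>C z) ks" using represents_scale[OF m] by metis
    with step show ?case using represents_add by blast
  qed
next
  assume "\<exists>js. represents m x js"
  then obtain js where "represents m x js" by blast
  then show "x \<in> K_alg m"
  proof (induction js arbitrary: x)
    case Nil
    then show ?case by (simp add: represents_def K_alg_def cvec.span_zero)
  next
    case (Cons xs js)
    then have "x = elem_tensor xs + (\<Sum>xs\<leftarrow>js. elem_tensor xs)" "admissible m xs"
      "(\<Sum>xs\<leftarrow>js. elem_tensor xs) \<in> K_alg m"
      by (auto simp: represents_def)
    then show ?case unfolding K_alg_def by (auto intro!: cvec.span_add intro: cvec.span_base)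
  qed
qed

lemma K_norm_le:
  assumes "m \<le> 1" "represents m x js"
  shows "K_norm m x \<le> total_cost m js"
  unfolding K_norm_eq using assms total_cost_nonneg[OF assms(1)]
  by (intro cInf_lower bdd_belowI[of _ 0]) auto

lemma K_norm_approximation:
  assumes m: "m \<le> 1" and x: "x \<in> K_alg m" and e: "0 < e"
  obtains js where "represents m x js" "total_cost m js < K_norm m x + e"
proof -
  have "{total_cost m js | js. represents m x js} \<noteq> {}" using x K_alg_iff[OF m] by blast
  from cInf_lessD[OF this, of "K_norm m x + e"] e show thesis
    unfolding K_norm_eq[symmetric] using that by auto
qed

lemma K_norm_nonneg:
  assumes "m \<le> 1" "x \<in> K_alg m"
  shows "0 \<le> K_norm m x"
  unfolding K_norm_eq using assms K_alg_iff[OF assms(1)] total_cost_nonneg[OF assms(1)]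
  by (intro cInf_greatest) auto

lemma K_alg_add: "x \<in> K_alg m \<Longrightarrow> y \<in> K_alg m \<Longrightarrow> x + y \<in> K_alg m"
  unfolding K_alg_def by (rule cvec.span_add)

lemma K_alg_scaleC: "x \<in> K_alg m \<Longrightarrow> c *\<^sub>C x \<in> K_alg m"
  unfolding K_alg_def by (rule cvec.span_scale)

lemma K_alg_minus: "x \<in> K_alg m \<Longrightarrow> - x \<in> K_alg m"
  unfolding K_alg_def by (rule cvec.span_neg)

lemma K_alg_diff: "x \<in> K_alg m \<Longrightarrow> y \<in> K_alg m \<Longrightarrow> x - y \<in> K_alg m"
  unfolding K_alg_def by (rule cvec.span_diff)

lemma K_alg_zero: "0 \<in> K_alg m"
  unfolding K_alg_def by (rule cvec.span_zero)

lemma K_alg_sum: "(\<And>i. i \<in> I \<Longrightarrow> f i \<in> K_alg m) \<Longrightarrow> (\<Sum>i\<in>I. f i) \<in> K_alg m"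
  unfolding K_alg_def by (rule cvec.span_sum)

lemma K_norm_triangle:
  assumes m: "m \<le> 1" and x: "x \<in> K_alg m" and y: "y \<in> K_alg m"
  shows "K_norm m (x + y) \<le> K_norm m x + K_norm m y"
proof (rule field_le_epsilon)
  fix e :: real assume "0 < e"
  then have e: "0 < e / 2" by simp
  obtain js where js: "represents m x js" "total_cost m js < K_norm m x + e / 2"
    by (rule K_norm_approximation[OF m x e])
  obtain ks where ks: "represents m y ks" "total_cost m ks < K_norm m y + e / 2"
    by (rule K_norm_approximation[OF m y e])
  show "K_norm m (x + y) \<le> K_norm m x + K_norm m y + e"
    using K_norm_le[OF m represents_add[OF js(1) ks(1)]] js ks by simp
qed

lemma K_norm_scaleC:
  assumes m: "m \<le> 1" and x: "x \<in> K_alg m"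
  shows "K_norm m (c *\<^sub>C x) \<le> cmod c * K_norm m x"
proof (rule field_le_epsilon)
  fix e :: real assume e: "0 < e"
  define d where "d = e / (cmod c + 1)"
  have d: "0 < d" "cmod c * d \<le> e" using e by (simp_all add: d_def divide_simps add_nonneg_pos)
  obtain js where js: "represents m x js" "total_cost m js < K_norm m x + d"
    by (rule K_norm_approximation[OF m x d(1)])
  obtain ks where ks: "represents m (c *\<^sub>C x) ks" "total_cost m ks \<le> cmod c * total_cost m js"
    by (rule represents_scale[OF m js(1)])
  have "K_norm m (c *\<^sub>C x) \<le> cmod c * total_cost m js" using K_norm_le[OF m ks(1)] ks(2) by simp
  also have "\<dots> \<le> cmod c * (K_norm m x + d)" using js(2) by (intro mult_left_mono) simp_all
  finally show "K_norm m (c *\<^sub>C x) \<le> cmod c * K_norm m x + e" using d by (simp add: distrib_left)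
qed

lemma K_norm_scaleR:
  assumes "m \<le> 1" "x \<in> K_alg m"
  shows "K_norm m (r *\<^sub>R x) \<le> \<bar>r\<bar> * K_norm m x"
  using K_norm_scaleC[OF assms, of "of_real r"] by (simp add: scaleR_scaleC)

lemma K_norm_minus:
  assumes "m \<le> 1" "x \<in> K_alg m"
  shows "K_norm m (- x) = K_norm m x"
  using K_norm_scaleR[OF assms, of "- 1"] K_norm_scaleR[OF assms(1) K_alg_minus[OF assms(2)], of "- 1"] by simp

lemma K_norm_commute:
  assumes "m \<le> 1" "x \<in> K_alg m" "y \<in> K_alg m"
  shows "K_norm m (x - y) = K_norm m (y - x)"
  using K_norm_minus[OF assms(1) K_alg_diff[OF assms(2,3)]] by simp

lemma K_norm_zero: "m \<le> 1 \<Longrightarrow> K_norm m 0 = 0"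
  using K_norm_le[OF _ represents_zero, of m]
  by (intro order.antisym K_norm_nonneg K_alg_zero) simp_all

lemma K_norm_sum:
  assumes m: "m \<le> 1" and x: "\<And>i. i \<in> I \<Longrightarrow> f i \<in> K_alg m"
  shows "K_norm m (\<Sum>i\<in>I. f i) \<le> (\<Sum>i\<in>I. K_norm m (f i))"
  using x
proof (induction I rule: infinite_finite_induct)
  case (insert i I)
  then show ?case
    using K_norm_triangle[OF m, of "f i" "\<Sum>i\<in>I. f i"] K_alg_sum[of I f m] by fastforce
qed (simp_all add: K_norm_zero[OF m])

lemma K_norm_word_1:
  assumes "trace_class (x * y)" "trace_class (y * x)"
  shows "elem_tensor [x, y] \<in> K_alg 1"
    "K_norm 1 (elem_tensor [x, y]) \<le> trace_norm (x * y) + trace_norm (y * x) + norm x * norm y"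
proof -
  have "represents 1 (elem_tensor [x, y]) [[x, y]]" using assms by (auto simp: represents_def admissible_1 simp del: One_nat_def)
  then show "elem_tensor [x, y] \<in> K_alg 1"
    "K_norm 1 (elem_tensor [x, y]) \<le> trace_norm (x * y) + trace_norm (y * x) + norm x * norm y"
    using K_norm_le[of 1 _ "[[x, y]]"] K_alg_iff[of 1] word_cost_1[OF assms(2)] by auto
qed

lemma K_alg_word_0: "trace_class x \<Longrightarrow> elem_tensor [x] \<in> K_alg 0"
  unfolding K_alg_def by (rule cvec.span_base) (auto simp: admissible_0)

lemma K_norm_word_0: "nuclear_le x K \<Longrightarrow> K_norm 0 (elem_tensor [x]) \<le> 2 * K"
  using K_norm_le[of 0 "elem_tensor [x]" "[[x]]"] norm_le_nuclear_le[of x K]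
  by (simp add: represents_def admissible_0 nuclear_le_iff word_cost_0)


section \<open>The Hochschild boundary in degree one\<close>

text \<open>The boundary is computed on arbitrary representatives of a tensor, so even its linearity in degree one
  requires multilinearity on words of every length.\<close>

lemma multilinear_boundary_word: "multilinear (boundary_word :: 'h::complex_hilbert bounded_op list \<Rightarrow> _)"
  unfolding multilinear_def
proof (intro allI impI)
  fix xs :: "'h bounded_op list" and k
  assume k: "k < length xs"
  have face: "clinear (\<lambda>a. c *\<^sub>C elem_tensor (\<psi> a))"
    if "\<exists>ys j L. j < length ys \<and> clinear L \<and> (\<forall>a. \<psi> a = ys[j := L a])" for \<psi> :: "'h bounded_op \<Rightarrow> 'h bounded_op list" and c
    using that
  proof (elim exE conjE)
    fix ys j L assume j: "j < length ys" and L: "clinear L" and \<psi>: "\<forall>a. \<psi> a = ys[j := L a]"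
    have lin: "clinear (\<lambda>b. elem_tensor (ys[j := b]))"
      using multilinear_elem_tensor j unfolding multilinear_def by blast
    show ?thesis
      unfolding \<psi>[rule_format] Vector_Spaces.linear_iff
      by (simp add: vector_space_scaleC clinearD[OF L] clinearD[OF lin] scaleC_add_right scaleC_scaleC mult.commute)
  qed
  show "clinear (\<lambda>a. boundary_word (xs[k := a]))"
  proof (cases "length xs = 1")
    case True
    then show ?thesis by (simp add: boundary_word_def Let_def Vector_Spaces.linear_iff vector_space_scaleC)
  next
    case False
    then obtain m where m: "length xs = m + 1" "0 < m" using k by (cases "length xs") auto
    have inner: "clinear (\<lambda>a. \<Sum>i<m. (- 1) ^ i *\<^sub>C elem_tensor
        (take i (xs[k := a]) @ [xs[k := a] ! i * xs[k := a] ! (i + 1)] @ drop (i + 2) (xs[k := a])))"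
      using m k by (intro clinear_sum face inner_face_update) simp_all
    have outer: "clinear (\<lambda>a. (- 1) ^ m *\<^sub>C elem_tensor
        ([xs[k := a] ! m * xs[k := a] ! 0] @ take (m - 1) (drop 1 (xs[k := a]))))"
      using m k by (intro face outer_face_update) simp_all
    have "boundary_word (xs[k := a]) = (\<Sum>i<m. (- 1) ^ i *\<^sub>C elem_tensor
        (take i (xs[k := a]) @ [xs[k := a] ! i * xs[k := a] ! (i + 1)] @ drop (i + 2) (xs[k := a])))
      + (- 1) ^ m *\<^sub>C elem_tensor ([xs[k := a] ! m * xs[k := a] ! 0] @ take (m - 1) (drop 1 (xs[k := a])))" for a
      using m by (simp add: boundary_word_def)
    then show ?thesis
      by (simp only: Vector_Spaces.linear_iff vector_space_scaleC clinearD[OF inner] clinearD[OF outer]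
          scaleC_add_right) (simp add: algebra_simps)
  qed
qed

lemma clinear_hochschild_boundary: "clinear (hochschild_boundary :: 'h::complex_hilbert bounded_op tensor \<Rightarrow> _)"
  unfolding hochschild_boundary_def by (rule clinear_tensor_lift[OF multilinear_boundary_word])

lemma hochschild_boundary_word_1:
  "hochschild_boundary (elem_tensor [x, y]) = elem_tensor [x * y - y * x]"
  by (simp add: hochschild_boundary_elem boundary_word_def scaleC_minus_one scaleC_one
      clinear_diff[OF clinear_letter(1)])

text \<open>On an admissible word \<open>x \<otimes> y\<close> the boundary \<open>x y - y x\<close> has trace norm at most \<open>\<parallel>x y\<parallel>\<^sub>1 + \<parallel>y x\<parallel>\<^sub>1\<close>; the factor two
  pays for the operator norm in the norm of \<open>K\<^sub>0\<close>.\<close>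

lemma hochschild_boundary_K_alg:
  assumes x: "x \<in> K_alg 1"
  shows "hochschild_boundary x \<in> K_alg 0" "K_norm 0 (hochschild_boundary x) \<le> 2 * K_norm 1 x"
proof -
  have rep: "hochschild_boundary z \<in> K_alg 0 \<and> K_norm 0 (hochschild_boundary z) \<le> 2 * total_cost 1 js"
    if "represents 1 z js" for z js
    using that
  proof (induction js arbitrary: z)
    case Nil
    then show ?case by (simp add: represents_def clinear_zero[OF clinear_hochschild_boundary] K_alg_zero K_norm_zero)
  next
    case (Cons xs js)
    define w where "w = (\<Sum>xs\<leftarrow>js. elem_tensor xs)"
    have z: "z = elem_tensor xs + w" "admissible 1 xs" "represents 1 w js"
      using Cons.prems by (auto simp: represents_def w_def)
    then obtain a b where xs: "xs = [a, b]" "trace_class (a * b)" "trace_class (b * a)"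
      unfolding admissible_1 by blast
    have ab: "elem_tensor [a * b - b * a] \<in> K_alg 0"
      using xs by (simp add: K_alg_word_0 trace_class_diff)
    have "K_norm 0 (elem_tensor [a * b - b * a]) \<le> 2 * (trace_norm (a * b) + trace_norm (b * a))"
      using xs by (intro K_norm_word_0 nuclear_le_diff nuclear_le_trace_norm)
    also have "\<dots> \<le> 2 * word_cost 1 xs" unfolding xs(1) word_cost_1[OF xs(3)] by simp
    finally show ?case
      using Cons.IH[OF z(3)] ab K_norm_triangle[of 0 "elem_tensor [a * b - b * a]" "hochschild_boundary w"]
      by (simp add: z(1) clinearD[OF clinear_hochschild_boundary] xs(1) hochschild_boundary_word_1 K_alg_add)
  qed
  obtain js where "represents 1 x js" using x K_alg_iff[of 1] by auto
  with rep show "hochschild_boundary x \<in> K_alg 0" by blast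
  show "K_norm 0 (hochschild_boundary x) \<le> 2 * K_norm 1 x"
  proof (rule field_le_epsilon)
    fix e :: real assume "0 < e"
    then obtain js where "represents 1 x js" "total_cost 1 js < K_norm 1 x + e / 2"
      using K_norm_approximation[OF _ x, of "e / 2"] by auto
    then show "K_norm 0 (hochschild_boundary x) \<le> 2 * K_norm 1 x + e" using rep[of x js] by simp
  qed
qed


section \<open>Completions and the boundary map between them\<close>

lemma carrier_cauchy_group:
  "X \<in> carrier (cauchy_group m) \<longleftrightarrow>
    (\<forall>k. X k \<in> K_alg m) \<and> (\<forall>\<epsilon>>0. \<exists>N. \<forall>i\<ge>N. \<forall>j\<ge>N. K_norm m (X i - X j) < \<epsilon>)"
  by (simp add: cauchy_group_def)

lemma cauchy_group_simps [simp]: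
  "X \<otimes>\<^bsub>cauchy_group m\<^esub> Y = (\<lambda>k. X k + Y k)" "\<one>\<^bsub>cauchy_group m\<^esub> = (\<lambda>k. 0)"
  by (simp_all add: cauchy_group_def)

lemma cauchy_group_add:
  assumes m: "m \<le> 1" and X: "X \<in> carrier (cauchy_group m)" and Y: "Y \<in> carrier (cauchy_group m)"
  shows "(\<lambda>k. X k + Y k) \<in> carrier (cauchy_group m)"
  unfolding carrier_cauchy_group
proof (intro conjI allI impI)
  have K: "X k \<in> K_alg m" "Y k \<in> K_alg m" for k using X Y by (auto simp: carrier_cauchy_group)
  show "X k + Y k \<in> K_alg m" for k using K by (rule K_alg_add)
  fix \<epsilon> :: real assume "0 < \<epsilon>"
  then have e: "0 < \<epsilon> / 2" by simp
  obtain N where N: "\<forall>i\<ge>N. \<forall>j\<ge>N. K_norm m (X i - X j) < \<epsilon> / 2" using X e unfolding carrier_cauchy_group by blast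
  obtain M where M: "\<forall>i\<ge>M. \<forall>j\<ge>M. K_norm m (Y i - Y j) < \<epsilon> / 2" using Y e unfolding carrier_cauchy_group by blast
  have "K_norm m ((X i + Y i) - (X j + Y j)) < \<epsilon>" if "i \<ge> max N M" "j \<ge> max N M" for i j
  proof -
    have "K_norm m ((X i - X j) + (Y i - Y j)) \<le> K_norm m (X i - X j) + K_norm m (Y i - Y j)"
      by (intro K_norm_triangle m K_alg_diff K)
    also have "K_norm m (X i - X j) < \<epsilon> / 2" using N that by simp
    also have "K_norm m (Y i - Y j) < \<epsilon> / 2" using M that by simp
    finally show ?thesis by (simp add: algebra_simps)
  qed
  then show "\<exists>N. \<forall>i\<ge>N. \<forall>j\<ge>N. K_norm m ((X i + Y i) - (X j + Y j)) < \<epsilon>" by blast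
qed

lemma cauchy_group_uminus:
  assumes m: "m \<le> 1" and X: "X \<in> carrier (cauchy_group m)"
  shows "(\<lambda>k. - X k) \<in> carrier (cauchy_group m)"
proof -
  have K: "X k \<in> K_alg m" for k using X by (simp add: carrier_cauchy_group)
  have "K_norm m (- X i - - X j) = K_norm m (X i - X j)" for i j
    using K_norm_commute[OF m K K, of j i] by simp
  then show ?thesis using X by (simp add: carrier_cauchy_group K_alg_minus)
qed

lemma cauchy_group_zero: "m \<le> 1 \<Longrightarrow> (\<lambda>k. 0) \<in> carrier (cauchy_group m)"
  by (simp add: carrier_cauchy_group K_alg_zero K_norm_zero)

lemma comm_group_cauchy_group: "m \<le> 1 \<Longrightarrow> comm_group (cauchy_group m)"
proof (rule comm_groupI)
  fix X assume m: "m \<le> 1" and X: "X \<in> carrier (cauchy_group m)"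
  show "\<exists>Y\<in>carrier (cauchy_group m). Y \<otimes>\<^bsub>cauchy_group m\<^esub> X = \<one>\<^bsub>cauchy_group m\<^esub>"
    by (rule bexI[OF _ cauchy_group_uminus[OF m X]]) simp
qed (simp_all add: cauchy_group_add cauchy_group_zero ac_simps)

lemma inv_cauchy_group:
  assumes m: "m \<le> 1" and X: "X \<in> carrier (cauchy_group m)"
  shows "inv\<^bsub>cauchy_group m\<^esub> X = (\<lambda>k. - X k)"
proof -
  interpret comm_group "cauchy_group m" by (rule comm_group_cauchy_group[OF m])
  show ?thesis
    by (rule inv_equality[OF _ X cauchy_group_uminus[OF m X]]) simp
qed

lemma null_sequences_iff:
  assumes m: "m \<le> 1"
  shows "X \<in> null_sequences m \<longleftrightarrow> (\<forall>k. X k \<in> K_alg m) \<and> (\<lambda>k. K_norm m (X k)) \<longlonglongrightarrow> 0"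
proof -
  have "X \<in> carrier (cauchy_group m)" if K: "\<And>k. X k \<in> K_alg m" and lim: "(\<lambda>k. K_norm m (X k)) \<longlonglongrightarrow> 0"
    unfolding carrier_cauchy_group
  proof (intro conjI allI impI K)
    fix \<epsilon> :: real assume "0 < \<epsilon>"
    then have "\<forall>\<^sub>F k in sequentially. K_norm m (X k) < \<epsilon> / 2"
      by (intro order_tendstoD[OF lim]) simp
    then obtain N where N: "\<And>k. k \<ge> N \<Longrightarrow> K_norm m (X k) < \<epsilon> / 2" by (auto simp: eventually_sequentially)
    have "K_norm m (X i - X j) < \<epsilon>" if "i \<ge> N" "j \<ge> N" for i j
      using K_norm_triangle[OF m K K_alg_minus[OF K], of i j] K_norm_minus[OF m K, of j] N[OF that(1)] N[OF that(2)] by simp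
    then show "\<exists>N. \<forall>i\<ge>N. \<forall>j\<ge>N. K_norm m (X i - X j) < \<epsilon>" by blast
  qed
  then show ?thesis by (auto simp: null_sequences_def carrier_cauchy_group)
qed

lemma subgroup_null_sequences:
  assumes m: "m \<le> 1"
  shows "subgroup (null_sequences m) (cauchy_group m :: (nat \<Rightarrow> 'h::complex_hilbert bounded_op tensor) monoid)"
proof -
  interpret comm_group "cauchy_group m :: (nat \<Rightarrow> 'h bounded_op tensor) monoid" by (rule comm_group_cauchy_group[OF m])
  show ?thesis
  proof (rule subgroupI)
    show "null_sequences m \<subseteq> carrier (cauchy_group m :: (nat \<Rightarrow> 'h bounded_op tensor) monoid)"
      by (auto simp: null_sequences_def)
    have "(\<lambda>k. 0 :: 'h bounded_op tensor) \<in> null_sequences m" by (simp add: null_sequences_iff[OF m] K_alg_zero K_norm_zero[OF m])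
    then show "null_sequences m \<noteq> ({} :: (nat \<Rightarrow> 'h bounded_op tensor) set)" by blast
  next
    fix X :: "nat \<Rightarrow> 'h bounded_op tensor" assume "X \<in> null_sequences m"
    moreover from this have "X \<in> carrier (cauchy_group m)" by (simp add: null_sequences_def)
    ultimately show "inv\<^bsub>cauchy_group m\<^esub> X \<in> null_sequences m"
      by (simp add: inv_cauchy_group[OF m] null_sequences_iff[OF m] K_alg_minus K_norm_minus[OF m])
  next
    fix X Y :: "nat \<Rightarrow> 'h bounded_op tensor" assume XY: "X \<in> null_sequences m" "Y \<in> null_sequences m"
    have K: "X k \<in> K_alg m" "Y k \<in> K_alg m" for k using XY by (auto simp: null_sequences_iff[OF m])
    have "(\<lambda>k. K_norm m (X k) + K_norm m (Y k)) \<longlonglongrightarrow> 0 + 0"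
      using XY by (intro tendsto_add) (auto simp: null_sequences_iff[OF m])
    then have "(\<lambda>k. K_norm m (X k + Y k)) \<longlonglongrightarrow> 0"
      using K_norm_triangle[OF m K] K_norm_nonneg[OF m K_alg_add[OF K]]
      by (intro Lim_null_comparison[of "\<lambda>k. K_norm m (X k + Y k)" "\<lambda>k. K_norm m (X k) + K_norm m (Y k)"]) auto
    then show "X \<otimes>\<^bsub>cauchy_group m\<^esub> Y \<in> null_sequences m"
      using K by (simp add: null_sequences_iff[OF m] K_alg_add)
  qed
qed

lemma normal_null_sequences: "m \<le> 1 \<Longrightarrow> null_sequences m \<lhd> cauchy_group m"
  by (rule comm_group.subgroup_imp_normal[OF comm_group_cauchy_group subgroup_null_sequences])

lemma group_K_completion: "m \<le> 1 \<Longrightarrow> group (K_completion m)"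
  unfolding K_completion_def by (rule normal.factorgroup_is_group[OF normal_null_sequences])

lemma carrier_K_completion: "carrier (K_completion m) = K_class m ` carrier (cauchy_group m)"
  by (simp add: K_completion_def carrier_FactGroup K_class_def[abs_def])

lemma K_class_add:
  assumes m: "m \<le> 1" and "X \<in> carrier (cauchy_group m)" "Y \<in> carrier (cauchy_group m)"
  shows "K_class m X \<otimes>\<^bsub>K_completion m\<^esub> K_class m Y = K_class m (\<lambda>k. X k + Y k)"
  using normal.rcos_sum[OF normal_null_sequences[OF m] assms(2,3)]
  by (simp add: K_completion_def K_class_def)

lemma K_class_eqI:
  assumes m: "m \<le> 1" and Y: "Y \<in> carrier (cauchy_group m)" and null: "(\<lambda>k. X k - Y k) \<in> null_sequences m"
  shows "K_class m X = K_class m Y"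
proof -
  interpret comm_group "cauchy_group m" by (rule comm_group_cauchy_group[OF m])
  have c: "(\<lambda>k. X k - Y k) \<in> carrier (cauchy_group m)" using null by (simp add: null_sequences_def)
  have "K_class m X = null_sequences m #>\<^bsub>cauchy_group m\<^esub> ((\<lambda>k. X k - Y k) \<otimes>\<^bsub>cauchy_group m\<^esub> Y)"
    by (simp add: K_class_def)
  also have "\<dots> = null_sequences m #>\<^bsub>cauchy_group m\<^esub> (\<lambda>k. X k - Y k) #>\<^bsub>cauchy_group m\<^esub> Y"
    by (rule coset_mult_assoc[symmetric, OF _ c Y]) (auto simp: null_sequences_def)
  also have "\<dots> = K_class m Y"
    unfolding K_class_def by (subst coset_join2[OF c subgroup_null_sequences[OF m] null]) (rule refl)
  finally show ?thesis .
qed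

lemma boundary_cauchy:
  assumes X: "X \<in> carrier (cauchy_group 1)"
  shows "(\<lambda>k. hochschild_boundary (X k)) \<in> carrier (cauchy_group 0)"
  unfolding carrier_cauchy_group
proof (intro conjI allI impI)
  have K: "X k \<in> K_alg 1" for k using X by (simp add: carrier_cauchy_group)
  show "hochschild_boundary (X k) \<in> K_alg 0" for k by (rule hochschild_boundary_K_alg[OF K])
  fix \<epsilon> :: real assume "0 < \<epsilon>"
  then have "0 < \<epsilon> / 2" by simp
  then obtain N where N: "\<forall>i\<ge>N. \<forall>j\<ge>N. K_norm 1 (X i - X j) < \<epsilon> / 2"
    using X unfolding carrier_cauchy_group by blast
  have "K_norm 0 (hochschild_boundary (X i) - hochschild_boundary (X j)) < \<epsilon>" if "i \<ge> N" "j \<ge> N" for i j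
  proof -
    have "K_norm 1 (X i - X j) < \<epsilon> / 2" using N that by blast
    then show ?thesis
      using hochschild_boundary_K_alg(2)[OF K_alg_diff[OF K K], of i j]
      by (simp add: clinear_diff[OF clinear_hochschild_boundary])
  qed
  then show "\<exists>N. \<forall>i\<ge>N. \<forall>j\<ge>N. K_norm 0 (hochschild_boundary (X i) - hochschild_boundary (X j)) < \<epsilon>" by blast
qed

lemma boundary_null:
  assumes X: "X \<in> null_sequences 1"
  shows "(\<lambda>k. hochschild_boundary (X k)) \<in> null_sequences 0"
proof -
  have K: "X k \<in> K_alg 1" for k using X null_sequences_iff[of 1] by auto
  have lim: "(\<lambda>k. K_norm 1 (X k)) \<longlonglongrightarrow> 0" using X null_sequences_iff[of 1] by auto
  have "(\<lambda>k. 2 * K_norm 1 (X k)) \<longlonglongrightarrow> 2 * 0" by (intro tendsto_intros lim)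
  then have "(\<lambda>k. K_norm 0 (hochschild_boundary (X k))) \<longlonglongrightarrow> 0"
  proof (intro Lim_null_comparison[of "\<lambda>k. K_norm 0 (hochschild_boundary (X k))" "\<lambda>k. 2 * K_norm 1 (X k)"] always_eventually allI)
    show "norm (K_norm 0 (hochschild_boundary (X k))) \<le> 2 * K_norm 1 (X k)" for k
      using hochschild_boundary_K_alg[OF K, of k] K_norm_nonneg[OF zero_le_one, of "hochschild_boundary (X k)"] by simp
  qed simp
  then show ?thesis using hochschild_boundary_K_alg(1)[OF K] by (simp add: null_sequences_iff)
qed

text \<open>Continuity of the boundary makes all members of a class contribute the same class, which collapses
  the union in the definition.\<close>

lemma K_boundary_class:
  assumes X: "X \<in> carrier (cauchy_group 1)"
  shows "K_boundary 1 (K_class 1 X) = K_class 0 (\<lambda>k. hochschild_boundary (X k))"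
proof -
  have eq: "K_class 0 (\<lambda>k. hochschild_boundary (Y k)) = K_class 0 (\<lambda>k. hochschild_boundary (X k))"
    if Y: "Y \<in> K_class 1 X" for Y
  proof -
    obtain Z where Z: "Z \<in> null_sequences 1" "Y = (\<lambda>k. Z k + X k)"
      using Y by (auto simp: K_class_def r_coset_def)
    show ?thesis
      using boundary_null[OF Z(1)]
      by (intro K_class_eqI boundary_cauchy X) (simp_all add: Z(2) clinearD[OF clinear_hochschild_boundary])
  qed
  have "(\<lambda>k. 0) \<in> null_sequences 1" by (simp add: null_sequences_iff K_alg_zero K_norm_zero)
  then have "X \<in> K_class 1 X" unfolding K_class_def r_coset_def by fastforce
  then have "K_class 1 X \<noteq> {}" by blast
  then show ?thesis
    unfolding K_boundary_def diff_self_eq_0 by (rule SUP_eq_const) (rule eq)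
qed

lemma subgroup_boundaries0: "subgroup boundaries0 (K_completion 0 :: (nat \<Rightarrow> 'h::complex_hilbert bounded_op tensor) set monoid)"
proof -
  let ?K1 = "K_completion 1 :: (nat \<Rightarrow> 'h bounded_op tensor) set monoid"
  let ?K0 = "K_completion 0 :: (nat \<Rightarrow> 'h bounded_op tensor) set monoid"
  have "K_boundary 1 \<in> hom ?K1 ?K0"
  proof (rule homI)
    fix \<xi> assume "\<xi> \<in> carrier ?K1"
    then obtain X where X: "X \<in> carrier (cauchy_group 1)" "\<xi> = K_class 1 X" by (auto simp: carrier_K_completion)
    then show "K_boundary 1 \<xi> \<in> carrier ?K0"
      by (auto simp: K_boundary_class[simplified] carrier_K_completion boundary_cauchy[simplified])
  next
    fix \<xi> \<eta> assume "\<xi> \<in> carrier ?K1" "\<eta> \<in> carrier ?K1"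
    then obtain X Y where X: "X \<in> carrier (cauchy_group 1)" "\<xi> = K_class 1 X"
      and Y: "Y \<in> carrier (cauchy_group 1)" "\<eta> = K_class 1 Y"
      by (auto simp: carrier_K_completion)
    show "K_boundary 1 (\<xi> \<otimes>\<^bsub>?K1\<^esub> \<eta>) = K_boundary 1 \<xi> \<otimes>\<^bsub>?K0\<^esub> K_boundary 1 \<eta>"
      unfolding X(2) Y(2) K_class_add[OF order_refl X(1) Y(1)] K_boundary_class[OF X(1)] K_boundary_class[OF Y(1)]
        K_boundary_class[OF cauchy_group_add[OF order_refl X(1) Y(1)]]
        K_class_add[OF zero_le_one boundary_cauchy[OF X(1)] boundary_cauchy[OF Y(1)]]
      by (simp add: clinearD[OF clinear_hochschild_boundary])
  qed
  then interpret group_hom ?K1 ?K0 "K_boundary 1"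
    by (intro group_hom.intro group_hom_axioms.intro group_K_completion) simp_all
  show ?thesis
    unfolding boundaries0_def by (rule subgroup_img_is_subgroup[OF G.subgroup_self])
qed

lemma H0_class_trivialI:
  assumes S: "S \<in> carrier (cauchy_group 1)" and A: "trace_class A"
    and lim: "(\<lambda>k. hochschild_boundary (S k) - elem_tensor [A]) \<in> null_sequences 0"
  shows "H0_class A = \<one>\<^bsub>H0_lambda\<^esub>"
proof -
  have cA: "(\<lambda>_. elem_tensor [A]) \<in> carrier (cauchy_group 0)"
    using A by (simp add: carrier_cauchy_group K_alg_word_0 K_norm_zero)
  have "K0_of A = K_class 0 (\<lambda>k. hochschild_boundary (S k))"
    unfolding K0_of_def by (rule K_class_eqI[symmetric, OF _ cA lim]) simp
  also have "\<dots> = K_boundary 1 (K_class 1 S)" by (rule K_boundary_class[OF S, symmetric])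
  finally have mem: "K0_of A \<in> boundaries0"
    unfolding boundaries0_def carrier_K_completion using S by blast
  have "K0_of A \<in> carrier (K_completion 0)"
    using cA by (simp add: K0_of_def carrier_K_completion)
  from group.coset_join2[OF group_K_completion this subgroup_boundaries0 mem]
  show ?thesis by (simp add: H0_class_def H0_lambda_def)
qed


section \<open>Continuous paths and their Riemann sums\<close>

text \<open>The Heine--Cantor theorem for a distance between parameters, such as the trace norm or the norm of \<open>K\<^sub>1\<close> of
  the difference of two points of a path.\<close>

lemma uniformly_continuous_pseudometric:
  fixes d :: "real \<Rightarrow> real \<Rightarrow> real"
  assumes sym: "\<And>s t. s \<in> {0..1} \<Longrightarrow> t \<in> {0..1} \<Longrightarrow> d s t = d t s"
    and triangle: "\<And>r s t. r \<in> {0..1} \<Longrightarrow> s \<in> {0..1} \<Longrightarrow> t \<in> {0..1} \<Longrightarrow> d r t \<le> d r s + d s t"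
    and refl: "\<And>t. t \<in> {0..1} \<Longrightarrow> d t t = 0"
    and cont: "\<And>t. t \<in> {0..1} \<Longrightarrow> ((\<lambda>s. d s t) \<longlongrightarrow> 0) (at t within {0..1})"
    and e: "0 < e"
  obtains \<delta> where "0 < \<delta>" "\<And>s t. s \<in> {0..1} \<Longrightarrow> t \<in> {0..1} \<Longrightarrow> \<bar>s - t\<bar> < \<delta> \<Longrightarrow> d s t < e"
proof -
  have "\<exists>r>0. \<forall>s\<in>{0..1}. \<bar>s - t\<bar> < r \<longrightarrow> d s t < e / 2" if t: "t \<in> {0..1}" for t
  proof -
    have "\<forall>\<^sub>F s in at t within {0..1}. d s t < e / 2"
      by (rule order_tendstoD[OF cont[OF t]]) (use e in simp)
    then obtain r where r: "r > 0" "\<And>s. s \<in> {0..1} \<Longrightarrow> s \<noteq> t \<Longrightarrow> dist s t < r \<Longrightarrow> d s t < e / 2"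
      unfolding eventually_at by blast
    have "d s t < e / 2" if "s \<in> {0..1}" "\<bar>s - t\<bar> < r" for s
      using r(2)[of s] refl[OF t] e that by (cases "s = t") (auto simp: dist_real_def)
    with r(1) show ?thesis by blast
  qed
  then obtain r where r: "\<And>t. t \<in> {0..1} \<Longrightarrow> r t > 0"
    "\<And>s t. t \<in> {0..1} \<Longrightarrow> s \<in> {0..1} \<Longrightarrow> \<bar>s - t\<bar> < r t \<Longrightarrow> d s t < e / 2"
    by metis
  obtain \<delta> where \<delta>: "0 < \<delta>" "\<And>x. x \<in> {0..1} \<Longrightarrow> \<exists>G\<in>(\<lambda>t. ball t (r t)) ` {0..1}. ball x \<delta> \<subseteq> G"
  proof (rule Heine_Borel_lemma[of "{0..1::real}" "(\<lambda>t. ball t (r t)) ` {0..1}"])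
    show "{0..1} \<subseteq> \<Union> ((\<lambda>t. ball t (r t)) ` {0..1})" using r(1) by fastforce
  qed auto
  show thesis
  proof (rule that[OF \<delta>(1)])
    fix s t :: real assume st: "s \<in> {0..1}" "t \<in> {0..1}" "\<bar>s - t\<bar> < \<delta>"
    obtain u where u: "u \<in> {0..1}" "ball s \<delta> \<subseteq> ball u (r u)" using \<delta>(2)[OF st(1)] by blast
    have "s \<in> ball s \<delta>" "t \<in> ball s \<delta>" using st(3) \<delta>(1) by (auto simp: dist_real_def)
    then have "\<bar>s - u\<bar> < r u" "\<bar>t - u\<bar> < r u"
      using u(2) by (auto simp: dist_real_def abs_minus_commute subset_iff)
    then have "d s u < e / 2" "d t u < e / 2" using r(2)[OF u(1)] st by blast+
    then show "d s t < e" using triangle[OF st(1) u(1) st(2)] sym[OF u(1) st(2)] by linarith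
  qed
qed

lemma eventually_at_withinI: "(\<And>s. s \<in> S \<Longrightarrow> P s) \<Longrightarrow> \<forall>\<^sub>F s in at t within S. P s"
  unfolding eventually_at_filter by (rule always_eventually) blast

lemma trace_norm_zero [simp]: "trace_norm 0 = 0"
  using nuclear_le_zero nuclear_le_iff
  by (intro order.antisym trace_norm_nonneg trace_class_zero) blast

lemma bounded_linear_op_apply_left: "bounded_linear (\<lambda>A. op_apply A x)"
  by (rule bounded_linear_intro[where K = "norm x"]) (simp_all add: norm_op_apply)

abbreviation null_at :: "real \<Rightarrow> (real \<Rightarrow> real) \<Rightarrow> bool"
  where "null_at t g \<equiv> (g \<longlongrightarrow> 0) (at t within {0..1})"

text \<open>Paths in the trace class that are continuous in trace norm, and paths of operators whose
  differences are small in trace norm without the operators being trace class.\<close>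

definition trace_path :: "(real \<Rightarrow> 'a::complex_hilbert bounded_op) \<Rightarrow> bool"
  where "trace_path F \<longleftrightarrow> (\<forall>t\<in>{0..1}. trace_class (F t)) \<and> trace_norm_continuous_on {0..1} F"

definition trace_continuous :: "(real \<Rightarrow> 'a::complex_hilbert bounded_op) \<Rightarrow> bool"
  where "trace_continuous F \<longleftrightarrow>
    (\<forall>t\<in>{0..1}. \<exists>g. null_at t g \<and> (\<forall>s\<in>{0..1}. nuclear_le (F s - F t) (g s)))"

lemma trace_continuousE:
  assumes "trace_continuous F" "t \<in> {0..1}"
  obtains g where "null_at t g" "\<And>s. s \<in> {0..1} \<Longrightarrow> nuclear_le (F s - F t) (g s)"
  using assms unfolding trace_continuous_def by blast

lemma trace_path_iff: "trace_path F \<longleftrightarrow> (\<forall>t\<in>{0..1}. trace_class (F t)) \<and> trace_continuous F"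
proof
  assume F: "trace_path F"
  then have tc: "trace_class (F s - F t)" if "s \<in> {0..1}" "t \<in> {0..1}" for s t
    using that by (simp add: trace_path_def trace_class_diff)
  have "trace_continuous F"
    unfolding trace_continuous_def
  proof
    fix t :: real assume t: "t \<in> {0..1}"
    show "\<exists>g. null_at t g \<and> (\<forall>s\<in>{0..1}. nuclear_le (F s - F t) (g s))"
      using F t tc by (intro exI[of _ "\<lambda>s. trace_norm (F s - F t)"])
        (simp add: trace_path_def trace_norm_continuous_on_def nuclear_le_trace_norm)
  qed
  then show "(\<forall>t\<in>{0..1}. trace_class (F t)) \<and> trace_continuous F" using F by (simp add: trace_path_def)
next
  assume F: "(\<forall>t\<in>{0..1}. trace_class (F t)) \<and> trace_continuous F"
  have "null_at t (\<lambda>s. trace_norm (F s - F t))" if t: "t \<in> {0..1}" for t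
  proof -
    obtain g where g: "null_at t g" "\<And>s. s \<in> {0..1} \<Longrightarrow> nuclear_le (F s - F t) (g s)"
      using F t by (auto elim: trace_continuousE)
    show ?thesis
    proof (rule Lim_null_comparison[OF _ g(1)])
      show "\<forall>\<^sub>F s in at t within {0..1}. norm (trace_norm (F s - F t)) \<le> g s"
      proof (rule eventually_at_withinI)
        fix s :: real assume "s \<in> {0..1}"
        from g(2)[OF this] show "norm (trace_norm (F s - F t)) \<le> g s"
          using trace_norm_nonneg[of "F s - F t"] by (simp add: nuclear_le_iff)
      qed
    qed
  qed
  then show "trace_path F" using F by (simp add: trace_path_def trace_norm_continuous_on_def)
qed

lemma trace_pathD:
  "trace_path F \<Longrightarrow> t \<in> {0..1} \<Longrightarrow> trace_class (F t)" "trace_path F \<Longrightarrow> trace_continuous F"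
  by (simp_all add: trace_path_iff)

lemma trace_continuous_add:
  assumes F: "trace_continuous F" and G: "trace_continuous G"
  shows "trace_continuous (\<lambda>t. F t + G t)"
  unfolding trace_continuous_def
proof
  fix t :: real assume t: "t \<in> {0..1}"
  obtain f where f: "null_at t f" "\<And>s. s \<in> {0..1} \<Longrightarrow> nuclear_le (F s - F t) (f s)"
    using trace_continuousE[OF F t] by blast
  obtain g where g: "null_at t g" "\<And>s. s \<in> {0..1} \<Longrightarrow> nuclear_le (G s - G t) (g s)"
    using trace_continuousE[OF G t] by blast
  have "null_at t (\<lambda>s. f s + g s)" using tendsto_add[OF f(1) g(1)] by simp
  moreover have "nuclear_le (F s + G s - (F t + G t)) (f s + g s)" if "s \<in> {0..1}" for s
    using nuclear_le_add[OF f(2) g(2)] that by (simp add: algebra_simps)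
  ultimately show "\<exists>g. null_at t g \<and> (\<forall>s\<in>{0..1}. nuclear_le (F s + G s - (F t + G t)) (g s))"
    by blast
qed

lemma trace_path_add: "trace_path F \<Longrightarrow> trace_path G \<Longrightarrow> trace_path (\<lambda>t. F t + G t)"
  by (simp add: trace_path_iff trace_continuous_add trace_class_add)

lemma trace_path_mult_left:
  assumes F: "trace_path F" and B: "continuous_on {0..1} B"
  shows "trace_path (\<lambda>t. B t * F t)"
  unfolding trace_path_iff
proof
  show "\<forall>t\<in>{0..1}. trace_class (B t * F t)" using F by (simp add: trace_path_iff trace_class_mult_left)
  show "trace_continuous (\<lambda>t. B t * F t)"
    unfolding trace_continuous_def
  proof
    fix t :: real assume t: "t \<in> {0..1}"
    obtain g where g: "null_at t g" "\<And>s. s \<in> {0..1} \<Longrightarrow> nuclear_le (F s - F t) (g s)"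
      using trace_continuousE[OF trace_pathD(2)[OF F] t] by blast
    have Bt: "(B \<longlongrightarrow> B t) (at t within {0..1})" using B t by (simp add: continuous_on_def)
    have "((\<lambda>s. norm (B s) * g s + norm (B s - B t) * trace_norm (F t)) \<longlongrightarrow>
        norm (B t) * 0 + norm (B t - B t) * trace_norm (F t)) (at t within {0..1})"
      by (intro tendsto_intros Bt g(1))
    moreover have "nuclear_le (B s * F s - B t * F t) (norm (B s) * g s + norm (B s - B t) * trace_norm (F t))" if "s \<in> {0..1}" for s
      using nuclear_le_add[OF nuclear_le_mult_left[OF g(2)[OF that], of "B s"]
          nuclear_le_mult_left[OF nuclear_le_trace_norm[OF trace_pathD(1)[OF F t]], of "B s - B t"]]
      by (simp add: algebra_simps)
    ultimately show "\<exists>g. null_at t g \<and> (\<forall>s\<in>{0..1}. nuclear_le (B s * F s - B t * F t) (g s))"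
      by (intro exI[of _ "\<lambda>s. norm (B s) * g s + norm (B s - B t) * trace_norm (F t)"]) simp
  qed
qed

lemma trace_path_adj: "trace_path F \<Longrightarrow> trace_path (\<lambda>t. adj (F t))"
  unfolding trace_path_iff trace_continuous_def adj_diff[symmetric]
  using trace_class_adj nuclear_le_adj by meson

lemma trace_path_mult_right:
  assumes "trace_path F" "continuous_on {0..1} B"
  shows "trace_path (\<lambda>t. F t * B t)"
  using trace_path_adj[OF trace_path_mult_left[OF trace_path_adj[OF assms(1)]
        bounded_linear.continuous_on[OF bounded_linear_adj assms(2)]]]
  by (simp add: adj_mult)

lemma trace_path_minus: "trace_path F \<Longrightarrow> trace_path (\<lambda>t. - F t)"
  using trace_path_mult_left[of F "\<lambda>t. - 1"] by (simp add: continuous_on_const)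

lemma trace_path_diff: "trace_path F \<Longrightarrow> trace_path G \<Longrightarrow> trace_path (\<lambda>t. F t - G t)"
  using trace_path_add[OF _ trace_path_minus, of F G] by simp

lemma trace_path_cong: "(\<And>t. t \<in> {0..1} \<Longrightarrow> F t = G t) \<Longrightarrow> trace_path F \<longleftrightarrow> trace_path G"
  by (simp add: trace_path_iff trace_continuous_def)

lemma trace_path_uniform:
  assumes F: "trace_path F" and e: "0 < e"
  obtains \<delta> where "0 < \<delta>"
    "\<And>s t. s \<in> {0..1} \<Longrightarrow> t \<in> {0..1} \<Longrightarrow> \<bar>s - t\<bar> < \<delta> \<Longrightarrow> nuclear_le (F s - F t) e"
proof -
  have tc: "trace_class (F s - F t)" if "s \<in> {0..1}" "t \<in> {0..1}" for s t
    using F that by (simp add: trace_path_iff trace_class_diff)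
  obtain \<delta> where \<delta>: "0 < \<delta>"
    "\<And>s t. s \<in> {0..1} \<Longrightarrow> t \<in> {0..1} \<Longrightarrow> \<bar>s - t\<bar> < \<delta> \<Longrightarrow> trace_norm (F s - F t) < e"
  proof (rule uniformly_continuous_pseudometric[of "\<lambda>s t. trace_norm (F s - F t)" e])
    show "trace_norm (F s - F t) = trace_norm (F t - F s)" if "s \<in> {0..1}" "t \<in> {0..1}" for s t
      using trace_norm_minus[OF tc[OF that]] by simp
    show "trace_norm (F r - F t) \<le> trace_norm (F r - F s) + trace_norm (F s - F t)"
      if "r \<in> {0..1}" "s \<in> {0..1}" "t \<in> {0..1}" for r s t
      using nuclear_le_add[OF nuclear_le_trace_norm[OF tc] nuclear_le_trace_norm[OF tc], of r s s t] that
      by (simp add: nuclear_le_iff)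
    show "trace_norm (F t - F t) = 0" for t
      by simp
    show "null_at t (\<lambda>s. trace_norm (F s - F t))" if "t \<in> {0..1}" for t
      using F that by (simp add: trace_path_def trace_norm_continuous_on_def)
  qed (use e in auto)
  show thesis
    using \<delta>(2) tc by (intro that[OF \<delta>(1)]) (simp add: nuclear_le_iff less_imp_le)
qed

lemma trace_path_bounded:
  assumes F: "trace_path F"
  obtains C where "\<And>t. t \<in> {0..1} \<Longrightarrow> nuclear_le (F t) C"
proof -
  have tc: "trace_class (F t)" if "t \<in> {0..1}" for t using F that by (simp add: trace_path_iff)
  have tri: "trace_norm (F s) \<le> trace_norm (F t) + trace_norm (F s - F t)" if "s \<in> {0..1}" "t \<in> {0..1}" for s t
    using nuclear_le_add[OF nuclear_le_trace_norm[OF tc[OF that(2)]] nuclear_le_trace_norm[OF trace_class_diff[OF tc[OF that(1)] tc[OF that(2)]]]]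
    by (simp add: nuclear_le_iff)
  have "continuous_on {0..1} (\<lambda>t. trace_norm (F t))"
    unfolding continuous_on_def
  proof
    fix t :: real assume t: "t \<in> {0..1}"
    have lim: "null_at t (\<lambda>s. trace_norm (F s - F t))"
      using F t by (simp add: trace_path_def trace_norm_continuous_on_def)
    have "norm (trace_norm (F s) - trace_norm (F t)) \<le> trace_norm (F s - F t)" if s: "s \<in> {0..1}" for s
      using tri[OF s t] tri[OF t s] trace_norm_minus[OF trace_class_diff[OF tc[OF s] tc[OF t]]] by simp
    then have "null_at t (\<lambda>s. trace_norm (F s) - trace_norm (F t))"
      by (intro Lim_null_comparison[OF _ lim] eventually_at_withinI)
    then show "((\<lambda>s. trace_norm (F s)) \<longlongrightarrow> trace_norm (F t)) (at t within {0..1})"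
      by (simp add: LIM_zero_iff)
  qed
  then obtain z where "\<forall>t\<in>{0..1}. trace_norm (F t) \<le> trace_norm (F z)"
    using continuous_attains_sup[of "{0..1::real}" "\<lambda>t. trace_norm (F t)"] by auto
  then show thesis using tc by (intro that[of "trace_norm (F z)"]) (simp add: nuclear_le_iff)
qed

text \<open>The functionals bounding the trace norm reduce the mean value inequality to the scalar one.\<close>

lemma nuclear_le_mean_value:
  fixes G :: "real \<Rightarrow> 'a::complex_hilbert bounded_op"
  assumes G: "\<And>r. r \<in> {0..1} \<Longrightarrow> (G has_vector_derivative X r) (at r within {0..1})"
    and st: "s \<in> {0..1}" "t \<in> {0..1}"
    and bound: "\<And>r. r \<in> closed_segment s t \<Longrightarrow> nuclear_le (X r - D) C"
  shows "nuclear_le (G t - G s - (t - s) *\<^sub>R D) (C * \<bar>t - s\<bar>)"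
  unfolding nuclear_le_def
proof (intro allI impI)
  fix I and x y :: "'a \<Rightarrow> 'a" assume fr: "finite_rank_le 1 I x y"
  define \<phi> where "\<phi> = (\<lambda>A. \<Sum>i\<in>I. cinner (y i) (op_apply A (x i)))"
  have bl: "bounded_linear \<phi>"
    unfolding \<phi>_def
    by (intro bounded_linear_sum bounded_linear_compose[OF bounded_linear_cinner_right]
        bounded_linear_op_apply_left)
  have seg: "closed_segment s t \<subseteq> {0..1}"
    using st by (intro closed_segment_subset) auto
  have "norm (\<phi> (G t - t *\<^sub>R D) - \<phi> (G s - s *\<^sub>R D)) \<le> C * norm (t - s)"
  proof (rule differentiable_bound)
    show "convex (closed_segment s t)" by simp
    show "s \<in> closed_segment s t" "t \<in> closed_segment s t" by simp_all
    fix r assume r: "r \<in> closed_segment s t"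
    have "((\<lambda>r. G r - r *\<^sub>R D) has_vector_derivative X r - 1 *\<^sub>R D) (at r within closed_segment s t)"
      using has_vector_derivative_within_subset[OF G seg, of r] r seg
      by (auto intro!: derivative_eq_intros)
    then have "((\<lambda>r. \<phi> (G r - r *\<^sub>R D)) has_vector_derivative \<phi> (X r - 1 *\<^sub>R D)) (at r within closed_segment s t)"
      by (rule bounded_linear.has_vector_derivative[OF bl])
    then show "((\<lambda>r. \<phi> (G r - r *\<^sub>R D)) has_derivative (\<lambda>h. h *\<^sub>R \<phi> (X r - D))) (at r within closed_segment s t)"
      by (simp add: has_vector_derivative_def)
    have le: "norm (\<phi> (X r - D)) \<le> C" using nuclear_leD[OF bound[OF r] fr] by (simp add: \<phi>_def)
    show "onorm (\<lambda>h. h *\<^sub>R \<phi> (X r - D)) \<le> C"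
    proof (rule onorm_bound)
      show "0 \<le> C" by (rule nuclear_le_nonneg[OF bound[OF r]])
      show "norm (h *\<^sub>R \<phi> (X r - D)) \<le> C * norm h" for h
        using mult_right_mono[OF le, of "\<bar>h\<bar>"] by (simp add: mult.commute)
    qed
  qed
  also have "\<phi> (G t - t *\<^sub>R D) - \<phi> (G s - s *\<^sub>R D) = \<phi> (G t - G s - (t - s) *\<^sub>R D)"
    by (simp only: bounded_linear.axioms(1)[OF bl] linear_diff linear_scale scaleR_left_diff_distrib) simp
  finally show "cmod (\<Sum>i\<in>I. cinner (y i) (op_apply (G t - G s - (t - s) *\<^sub>R D) (x i))) \<le> C * \<bar>t - s\<bar>"
    by (simp add: \<phi>_def)
qed

lemma trace_continuous_of_derivative:
  assumes G: "\<And>r. r \<in> {0..1} \<Longrightarrow> (G has_vector_derivative X r) (at r within {0..1})"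
    and X: "trace_path X"
  shows "trace_continuous G"
  unfolding trace_continuous_def
proof
  fix t :: real assume t: "t \<in> {0..1}"
  obtain C where C: "\<And>r. r \<in> {0..1} \<Longrightarrow> nuclear_le (X r) C" using trace_path_bounded[OF X] by blast
  have "nuclear_le (G s - G t) (C * \<bar>s - t\<bar>)" if s: "s \<in> {0..1}" for s
  proof -
    have seg: "closed_segment t s \<subseteq> {0..1}" using s t by (intro closed_segment_subset) auto
    have "nuclear_le (G s - G t - (s - t) *\<^sub>R 0) (C * \<bar>s - t\<bar>)"
    proof (rule nuclear_le_mean_value[OF G t s])
      fix r assume "r \<in> closed_segment t s"
      then show "nuclear_le (X r - 0) C" using C[of r] seg by auto
    qed
    then show ?thesis by simp
  qed
  moreover have "((\<lambda>s. C * \<bar>s - t\<bar>) \<longlongrightarrow> C * \<bar>t - t\<bar>) (at t within {0..1})"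
    by (intro tendsto_intros)
  ultimately show "\<exists>g. null_at t g \<and> (\<forall>s\<in>{0..1}. nuclear_le (G s - G t) (g s))"
    by (intro exI[of _ "\<lambda>s. C * \<bar>s - t\<bar>"]) simp
qed

definition riemann_sum :: "(real \<Rightarrow> 'v::real_vector) \<Rightarrow> nat \<Rightarrow> 'v"
  where "riemann_sum f k = (\<Sum>j<k. (1 / real k) *\<^sub>R f (real j / real k))"

lemma riemann_sum_point: "j < k \<Longrightarrow> real j / real k \<in> {0..1}"
  by (simp add: divide_le_eq)

text \<open>On each subinterval the increment of \<open>G\<close> is compared with the corresponding summand by the mean value
  inequality; uniform continuity of \<open>X\<close> in trace norm makes the total error small.\<close>

lemma fundamental_theorem_trace_norm:
  assumes G: "\<And>r. r \<in> {0..1} \<Longrightarrow> (G has_vector_derivative X r) (at r within {0..1})"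
    and X: "trace_path X" and e: "0 < e"
  obtains N where "\<And>k. k \<ge> N \<Longrightarrow> nuclear_le (G 1 - G 0 - riemann_sum X (Suc k)) e"
proof -
  obtain \<delta> where \<delta>: "0 < \<delta>"
    "\<And>s t. s \<in> {0..1} \<Longrightarrow> t \<in> {0..1} \<Longrightarrow> \<bar>s - t\<bar> < \<delta> \<Longrightarrow> nuclear_le (X s - X t) e"
    using trace_path_uniform[OF X e] by blast
  obtain N where N: "inverse (real (Suc N)) < \<delta>" using reals_Archimedean[OF \<delta>(1)] by blast
  show thesis
  proof (rule that[of N])
    fix k assume k: "k \<ge> N"
    define K where "K = real (Suc k)"
    have K: "K > 0" by (simp add: K_def)
    have "1 / K \<le> inverse (real (Suc N))" using k by (simp add: K_def inverse_eq_divide frac_le)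
    with N have K\<delta>: "1 / K < \<delta>" by simp
    have step: "nuclear_le (G (real (Suc j) / K) - G (real j / K) - (1 / K) *\<^sub>R X (real j / K)) (e * (1 / K))"
      if j: "j < Suc k" for j
    proof -
      have p: "real j / K \<in> {0..1}" "real (Suc j) / K \<in> {0..1}"
        using j by (auto simp: K_def divide_le_eq)
      have len: "real (Suc j) / K - real j / K = 1 / K" by (simp add: diff_divide_distrib[symmetric])
      have "nuclear_le (G (real (Suc j) / K) - G (real j / K) - (real (Suc j) / K - real j / K) *\<^sub>R X (real j / K))
          (e * \<bar>real (Suc j) / K - real j / K\<bar>)"
      proof (rule nuclear_le_mean_value[OF G p])
        fix r assume r: "r \<in> closed_segment (real j / K) (real (Suc j) / K)"
        then have "real j / K \<le> r" "r \<le> real (Suc j) / K"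
          using K by (auto simp: closed_segment_eq_real_ivl divide_right_mono split: if_splits)
        then show "nuclear_le (X r - X (real j / K)) e"
          using p len K\<delta> by (intro \<delta>(2)) auto
      qed
      then show ?thesis using K unfolding len by simp
    qed
    have "nuclear_le (\<Sum>j<Suc k. G (real (Suc j) / K) - G (real j / K) - (1 / K) *\<^sub>R X (real j / K)) (\<Sum>j<Suc k. e * (1 / K))"
      by (intro nuclear_le_sum step) simp
    moreover have "(\<Sum>j<Suc k. e * (1 / K)) = e" using K by (simp add: K_def)
    moreover have "(\<Sum>j<Suc k. G (real (Suc j) / K) - G (real j / K) - (1 / K) *\<^sub>R X (real j / K)) = G 1 - G 0 - riemann_sum X (Suc k)"
    proof -
      have "(\<Sum>j<Suc k. G (real (Suc j) / K) - G (real j / K)) = G (real (Suc k) / K) - G (real 0 / K)"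
        by (rule sum_lessThan_telescope)
      also have "\<dots> = G 1 - G 0" using K by (simp add: K_def)
      finally show ?thesis by (simp only: sum_subtractf riemann_sum_def K_def[symmetric])
    qed
    ultimately show "nuclear_le (G 1 - G 0 - riemann_sum X (Suc k)) e" by simp
  qed
qed


section \<open>Continuous paths in the completion in degree one\<close>

definition K_path :: "(real \<Rightarrow> 'h::complex_hilbert bounded_op tensor) \<Rightarrow> bool"
  where "K_path \<Theta> \<longleftrightarrow> (\<forall>t\<in>{0..1}. \<Theta> t \<in> K_alg 1) \<and>
    (\<forall>t\<in>{0..1}. null_at t (\<lambda>s. K_norm 1 (\<Theta> s - \<Theta> t)))"

lemma K_pathI:
  assumes K: "\<And>t. t \<in> {0..1} \<Longrightarrow> \<Theta> t \<in> K_alg 1"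
    and lim: "\<And>t. t \<in> {0..1} \<Longrightarrow> \<exists>g. null_at t g \<and> (\<forall>s\<in>{0..1}. K_norm 1 (\<Theta> s - \<Theta> t) \<le> g s)"
  shows "K_path \<Theta>"
  unfolding K_path_def
proof (intro conjI ballI K)
  fix t :: real assume t: "t \<in> {0..1}"
  obtain g where g: "null_at t g" "\<And>s. s \<in> {0..1} \<Longrightarrow> K_norm 1 (\<Theta> s - \<Theta> t) \<le> g s"
    using lim[OF t] by blast
  have "norm (K_norm 1 (\<Theta> s - \<Theta> t)) \<le> g s" if "s \<in> {0..1}" for s
    using g(2)[OF that] K_norm_nonneg[OF order_refl K_alg_diff[OF K[OF that] K[OF t]]] by simp
  then show "null_at t (\<lambda>s. K_norm 1 (\<Theta> s - \<Theta> t))"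
    by (intro Lim_null_comparison[OF _ g(1)] eventually_at_withinI)
qed

lemma K_path_add:
  assumes \<Theta>: "K_path \<Theta>" and \<Psi>: "K_path \<Psi>"
  shows "K_path (\<lambda>t. \<Theta> t + \<Psi> t)"
proof (rule K_pathI)
  have K: "\<Theta> t \<in> K_alg 1" "\<Psi> t \<in> K_alg 1" if "t \<in> {0..1}" for t using \<Theta> \<Psi> that by (auto simp: K_path_def)
  then show "\<Theta> t + \<Psi> t \<in> K_alg 1" if "t \<in> {0..1}" for t using that by (simp add: K_alg_add)
  fix t :: real assume t: "t \<in> {0..1}"
  have "((\<lambda>s. K_norm 1 (\<Theta> s - \<Theta> t) + K_norm 1 (\<Psi> s - \<Psi> t)) \<longlongrightarrow> 0 + 0) (at t within {0..1})"
    using \<Theta> \<Psi> t by (intro tendsto_add) (auto simp: K_path_def)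
  moreover have "K_norm 1 (\<Theta> s + \<Psi> s - (\<Theta> t + \<Psi> t)) \<le> K_norm 1 (\<Theta> s - \<Theta> t) + K_norm 1 (\<Psi> s - \<Psi> t)"
    if s: "s \<in> {0..1}" for s
    using K_norm_triangle[OF order_refl K_alg_diff[OF K(1)[OF s] K(1)[OF t]] K_alg_diff[OF K(2)[OF s] K(2)[OF t]]]
    by (simp add: add_diff_add)
  ultimately show "\<exists>g. null_at t g \<and> (\<forall>s\<in>{0..1}. K_norm 1 (\<Theta> s + \<Psi> s - (\<Theta> t + \<Psi> t)) \<le> g s)"
    by (intro exI[of _ "\<lambda>s. K_norm 1 (\<Theta> s - \<Theta> t) + K_norm 1 (\<Psi> s - \<Psi> t)"]) simp
qed

lemma K_path_scaleR:
  assumes \<Theta>: "K_path \<Theta>"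
  shows "K_path (\<lambda>t. r *\<^sub>R \<Theta> t)"
proof (rule K_pathI)
  have K: "\<Theta> t \<in> K_alg 1" if "t \<in> {0..1}" for t using \<Theta> that by (simp add: K_path_def)
  then show "r *\<^sub>R \<Theta> t \<in> K_alg 1" if "t \<in> {0..1}" for t using that by (simp add: scaleR_scaleC K_alg_scaleC)
  fix t :: real assume t: "t \<in> {0..1}"
  have "((\<lambda>s. \<bar>r\<bar> * K_norm 1 (\<Theta> s - \<Theta> t)) \<longlongrightarrow> \<bar>r\<bar> * 0) (at t within {0..1})"
    using \<Theta> t by (intro tendsto_intros) (simp add: K_path_def)
  moreover have "K_norm 1 (r *\<^sub>R \<Theta> s - r *\<^sub>R \<Theta> t) \<le> \<bar>r\<bar> * K_norm 1 (\<Theta> s - \<Theta> t)" if s: "s \<in> {0..1}" for s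
    using K_norm_scaleR[OF order_refl K_alg_diff[OF K[OF s] K[OF t]], of r] by (simp add: scaleR_diff_right)
  ultimately show "\<exists>g. null_at t g \<and> (\<forall>s\<in>{0..1}. K_norm 1 (r *\<^sub>R \<Theta> s - r *\<^sub>R \<Theta> t) \<le> g s)"
    by (intro exI[of _ "\<lambda>s. \<bar>r\<bar> * K_norm 1 (\<Theta> s - \<Theta> t)"]) simp
qed

lemma K_path_diff: "K_path \<Theta> \<Longrightarrow> K_path \<Psi> \<Longrightarrow> K_path (\<lambda>t. \<Theta> t - \<Psi> t)"
  using K_path_add[OF _ K_path_scaleR, of \<Theta> \<Psi> "- 1"] by simp

lemma K_path_sum: "(\<And>i. i \<in> I \<Longrightarrow> K_path (\<Theta> i)) \<Longrightarrow> K_path (\<lambda>t. \<Sum>i\<in>I. \<Theta> i t)"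
proof (induction I rule: infinite_finite_induct)
  case (insert i I)
  then show ?case by (simp add: K_path_add)
qed (simp_all add: K_path_def K_alg_zero K_norm_zero)

text \<open>In \<open>x\<^sub>s \<otimes> y\<^sub>s - x\<^sub>t \<otimes> y\<^sub>t = (x\<^sub>s - x\<^sub>t) \<otimes> y\<^sub>s + x\<^sub>t \<otimes> (y\<^sub>s - y\<^sub>t)\<close> both words are admissible because the
  differences of \<open>x\<close> are trace class, which covers the path \<open>M\<^sup>n\<close> of the main theorem.\<close>

lemma K_path_word:
  assumes x: "trace_continuous x" and y: "continuous_on {0..1} y"
    and xy: "trace_path (\<lambda>t. x t * y t)" and yx: "trace_path (\<lambda>t. y t * x t)"
  shows "K_path (\<lambda>t. elem_tensor [x t, y t])"
proof (rule K_pathI)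
  show "elem_tensor [x t, y t] \<in> K_alg 1" if "t \<in> {0..1}" for t
    using that xy yx by (intro K_norm_word_1) (auto dest: trace_pathD(1))
  fix t :: real assume t: "t \<in> {0..1}"
  obtain g where g: "null_at t g" "\<And>s. s \<in> {0..1} \<Longrightarrow> nuclear_le (x s - x t) (g s)"
    using trace_continuousE[OF x t] by blast
  obtain g1 where g1: "null_at t g1" "\<And>s. s \<in> {0..1} \<Longrightarrow> nuclear_le (x s * y s - x t * y t) (g1 s)"
    using trace_continuousE[OF trace_pathD(2)[OF xy] t] by blast
  obtain g2 where g2: "null_at t g2" "\<And>s. s \<in> {0..1} \<Longrightarrow> nuclear_le (y s * x s - y t * x t) (g2 s)"
    using trace_continuousE[OF trace_pathD(2)[OF yx] t] by blast
  define h where "h = (\<lambda>s. (g s * norm (y s) + norm (y s) * g s + g s * norm (y s)) +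
    ((g1 s + g s * norm (y s)) + (g2 s + norm (y s) * g s) + norm (x t) * norm (y s - y t)))"
  have yt: "(y \<longlongrightarrow> y t) (at t within {0..1})" using y t by (simp add: continuous_on_def)
  have "(h \<longlongrightarrow> (0 * norm (y t) + norm (y t) * 0 + 0 * norm (y t)) +
    ((0 + 0 * norm (y t)) + (0 + norm (y t) * 0) + norm (x t) * norm (y t - y t))) (at t within {0..1})"
    unfolding h_def by (intro tendsto_intros g(1) g1(1) g2(1) yt)
  then have "null_at t h" by simp
  moreover have "K_norm 1 (elem_tensor [x s, y s] - elem_tensor [x t, y t]) \<le> h s" if s: "s \<in> {0..1}" for s
  proof -
    have n1: "nuclear_le ((x s - x t) * y s) (g s * norm (y s))" by (rule nuclear_le_mult_right[OF g(2)[OF s]])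
    have n2: "nuclear_le (y s * (x s - x t)) (norm (y s) * g s)" by (rule nuclear_le_mult_left[OF g(2)[OF s]])
    have n3: "nuclear_le (x t * (y s - y t)) (g1 s + g s * norm (y s))"
      using nuclear_le_diff[OF g1(2)[OF s] n1] by (simp add: algebra_simps)
    have n4: "nuclear_le ((y s - y t) * x t) (g2 s + norm (y s) * g s)"
      using nuclear_le_diff[OF g2(2)[OF s] n2] by (simp add: algebra_simps)
    have tc: "trace_class ((x s - x t) * y s)" "trace_class (y s * (x s - x t))"
      "trace_class (x t * (y s - y t))" "trace_class ((y s - y t) * x t)"
      using n1 n2 n3 n4 by (simp_all add: nuclear_le_iff)
    have le: "trace_norm ((x s - x t) * y s) \<le> g s * norm (y s)" "trace_norm (y s * (x s - x t)) \<le> norm (y s) * g s"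
      "trace_norm (x t * (y s - y t)) \<le> g1 s + g s * norm (y s)" "trace_norm ((y s - y t) * x t) \<le> g2 s + norm (y s) * g s"
      using n1 n2 n3 n4 by (simp_all add: nuclear_le_iff)
    have w1: "elem_tensor [x s - x t, y s] \<in> K_alg 1" by (rule K_norm_word_1(1)[OF tc(1,2)])
    have w1_le: "K_norm 1 (elem_tensor [x s - x t, y s]) \<le> g s * norm (y s) + norm (y s) * g s + g s * norm (y s)"
      by (rule order.trans[OF K_norm_word_1(2)[OF tc(1,2)]])
        (intro add_mono le mult_right_mono norm_le_nuclear_le[OF g(2)[OF s]], simp)
    have w2: "elem_tensor [x t, y s - y t] \<in> K_alg 1" by (rule K_norm_word_1(1)[OF tc(3,4)])
    have w2_le: "K_norm 1 (elem_tensor [x t, y s - y t]) \<le> (g1 s + g s * norm (y s)) + (g2 s + norm (y s) * g s) + norm (x t) * norm (y s - y t)"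
      by (rule order.trans[OF K_norm_word_1(2)[OF tc(3,4)]]) (intro add_mono le order_refl)
    have "elem_tensor [x s, y s] - elem_tensor [x t, y t] = elem_tensor [x s - x t, y s] + elem_tensor [x t, y s - y t]"
      by (simp add: clinear_diff[OF clinear_letter(2)] clinear_diff[OF clinear_letter(3)])
    then show ?thesis
      using K_norm_triangle[OF order_refl w1 w2] add_mono[OF w1_le w2_le] by (simp add: h_def)
  qed
  ultimately show "\<exists>g. null_at t g \<and>
      (\<forall>s\<in>{0..1}. K_norm 1 (elem_tensor [x s, y s] - elem_tensor [x t, y t]) \<le> g s)" by blast
qed

lemma K_path_trace_word:
  assumes x: "trace_path x" and y: "continuous_on {0..1} y"
  shows "K_path (\<lambda>t. elem_tensor [x t, y t])"
  by (intro K_path_word trace_pathD(2) trace_path_mult_left trace_path_mult_right x y)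

lemma riemann_sum_refine:
  assumes k: "0 < k" and m: "0 < m"
  shows "riemann_sum f (k * m) = (\<Sum>j<k. \<Sum>i<m. (1 / real (k * m)) *\<^sub>R f (real (j * m + i) / real (k * m)))"
proof -
  define F where "F = (\<lambda>l. (1 / real (k * m)) *\<^sub>R f (real l / real (k * m)))"
  have block: "sum F {j * m..<j * m + m} = (\<Sum>i<m. F (j * m + i))" for j
    using sum.shift_bounds_nat_ivl[of F 0 "j * m" m] by (simp add: lessThan_atLeast0 add.commute)
  have "riemann_sum f (k * m) = (\<Sum>j<k. sum F {j * m..<j * m + m})"
    unfolding riemann_sum_def F_def[symmetric] by (rule sum.nat_group[symmetric])
  then show ?thesis unfolding block by (simp add: F_def)
qed

text \<open>Two Riemann sums are both close to the one for the common refinement of their partitions.\<close>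

lemma riemann_sum_refinement_close:
  assumes \<Theta>: "K_path \<Theta>" and km: "0 < k" "0 < m"
    and \<delta>: "1 / real k < \<delta>" "\<And>s t. s \<in> {0..1} \<Longrightarrow> t \<in> {0..1} \<Longrightarrow> \<bar>s - t\<bar> < \<delta> \<Longrightarrow> K_norm 1 (\<Theta> s - \<Theta> t) < e"
  shows "K_norm 1 (riemann_sum \<Theta> k - riemann_sum \<Theta> (k * m)) \<le> e"
proof -
  have K: "\<Theta> t \<in> K_alg 1" if "t \<in> {0..1}" for t using \<Theta> that by (simp add: K_path_def)
  define c where "c = 1 / real (k * m)"
  define p where "p = (\<lambda>j i. real (j * m + i) / real (k * m))"
  have c: "0 \<le> c" "real m * c = 1 / real k" using km by (simp_all add: c_def)
  have "riemann_sum \<Theta> k = (\<Sum>j<k. \<Sum>i<m. c *\<^sub>R \<Theta> (real j / real k))"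
    by (simp add: riemann_sum_def c(2)[symmetric] sum_constant_scaleR)
  then have eq: "riemann_sum \<Theta> k - riemann_sum \<Theta> (k * m) = (\<Sum>j<k. \<Sum>i<m. c *\<^sub>R (\<Theta> (real j / real k) - \<Theta> (p j i)))"
    by (simp add: riemann_sum_refine[OF km] sum_subtractf[symmetric] scaleR_diff_right c_def p_def)
  have summand: "c *\<^sub>R (\<Theta> (real j / real k) - \<Theta> (p j i)) \<in> K_alg 1 \<and> K_norm 1 (c *\<^sub>R (\<Theta> (real j / real k) - \<Theta> (p j i))) \<le> c * e"
    if ji: "j < k" "i < m" for j i
  proof -
    have "j * m + i < Suc j * m" using ji by simp
    also have "Suc j * m \<le> k * m" using ji by (intro mult_right_mono) auto
    finally have "p j i \<in> {0..1}" unfolding p_def by (rule riemann_sum_point)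
    moreover have q: "real j / real k \<in> {0..1}" using ji(1) by (rule riemann_sum_point)
    moreover have "\<bar>real j / real k - p j i\<bar> < \<delta>"
    proof -
      have "p j i - real j / real k = real i / real m * (1 / real k)"
        using km by (simp add: p_def field_simps)
      moreover have "real i / real m * (1 / real k) \<le> 1 * (1 / real k)"
        using ji km by (intro mult_right_mono) (simp_all add: divide_le_eq)
      moreover have "0 \<le> real i / real m * (1 / real k)" by simp
      ultimately show ?thesis using \<delta>(1) by linarith
    qed
    ultimately have "K_norm 1 (\<Theta> (real j / real k) - \<Theta> (p j i)) < e" "\<Theta> (real j / real k) - \<Theta> (p j i) \<in> K_alg 1"
      using \<delta>(2)[of "real j / real k" "p j i"] K_alg_diff[OF K K, of "real j / real k" "p j i"] by blast+
    then show ?thesis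
      using K_norm_scaleR[OF order_refl, of "\<Theta> (real j / real k) - \<Theta> (p j i)" c] c(1)
        mult_left_mono[of "K_norm 1 (\<Theta> (real j / real k) - \<Theta> (p j i))" e c]
      by (simp add: scaleR_scaleC K_alg_scaleC)
  qed
  have "K_norm 1 (riemann_sum \<Theta> k - riemann_sum \<Theta> (k * m)) \<le> (\<Sum>j<k. \<Sum>i<m. c * e)"
    unfolding eq using summand
    by (intro order.trans[OF K_norm_sum[OF order_refl]] sum_mono K_alg_sum) auto
  also have "\<dots> = e" using km by (simp add: c_def)
  finally show ?thesis .
qed

lemma riemann_sum_K_alg: "K_path \<Theta> \<Longrightarrow> riemann_sum \<Theta> k \<in> K_alg 1"
  unfolding riemann_sum_def scaleR_scaleC K_path_def
  using riemann_sum_point by (intro K_alg_sum K_alg_scaleC) auto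

lemma riemann_sums_cauchy:
  assumes \<Theta>: "K_path \<Theta>"
  shows "(\<lambda>k. riemann_sum \<Theta> (Suc k)) \<in> carrier (cauchy_group 1)"
  unfolding carrier_cauchy_group
proof (intro conjI allI impI riemann_sum_K_alg[OF \<Theta>])
  fix \<epsilon> :: real assume "0 < \<epsilon>"
  then have e: "0 < \<epsilon> / 3" by simp
  have K: "\<Theta> t \<in> K_alg 1" if "t \<in> {0..1}" for t using \<Theta> that by (simp add: K_path_def)
  obtain \<delta> where \<delta>: "0 < \<delta>"
    "\<And>s t. s \<in> {0..1} \<Longrightarrow> t \<in> {0..1} \<Longrightarrow> \<bar>s - t\<bar> < \<delta> \<Longrightarrow> K_norm 1 (\<Theta> s - \<Theta> t) < \<epsilon> / 3"
  proof (rule uniformly_continuous_pseudometric[of "\<lambda>s t. K_norm 1 (\<Theta> s - \<Theta> t)" "\<epsilon> / 3"])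
    show "K_norm 1 (\<Theta> s - \<Theta> t) = K_norm 1 (\<Theta> t - \<Theta> s)" if "s \<in> {0..1}" "t \<in> {0..1}" for s t
      using that by (intro K_norm_commute K) auto
    show "K_norm 1 (\<Theta> r - \<Theta> t) \<le> K_norm 1 (\<Theta> r - \<Theta> s) + K_norm 1 (\<Theta> s - \<Theta> t)"
      if "r \<in> {0..1}" "s \<in> {0..1}" "t \<in> {0..1}" for r s t
      using K_norm_triangle[OF order_refl K_alg_diff[OF K K] K_alg_diff[OF K K], of r s s t] that by simp
    show "null_at t (\<lambda>s. K_norm 1 (\<Theta> s - \<Theta> t))" if "t \<in> {0..1}" for t
      using \<Theta> that by (simp add: K_path_def)
  qed (use e in \<open>auto simp: K_norm_zero\<close>)
  obtain N where N: "inverse (real (Suc N)) < \<delta>" using reals_Archimedean[OF \<delta>(1)] by blast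
  have small: "1 / real (Suc k) < \<delta>" if "k \<ge> N" for k
  proof -
    have "1 / real (Suc k) \<le> inverse (real (Suc N))" using that by (simp add: inverse_eq_divide frac_le)
    with N show ?thesis by simp
  qed
  let ?R = "riemann_sum \<Theta>"
  have "K_norm 1 (?R (Suc i) - ?R (Suc j)) < \<epsilon>" if ij: "i \<ge> N" "j \<ge> N" for i j
  proof -
    have a: "K_norm 1 (?R (Suc i) - ?R (Suc i * Suc j)) \<le> \<epsilon> / 3"
      by (rule riemann_sum_refinement_close[OF \<Theta> _ _ small[OF ij(1)] \<delta>(2)]) auto
    have "K_norm 1 (?R (Suc j) - ?R (Suc j * Suc i)) \<le> \<epsilon> / 3"
      by (rule riemann_sum_refinement_close[OF \<Theta> _ _ small[OF ij(2)] \<delta>(2)]) auto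
    then have b: "K_norm 1 (?R (Suc i * Suc j) - ?R (Suc j)) \<le> \<epsilon> / 3"
      by (subst K_norm_commute[OF order_refl riemann_sum_K_alg[OF \<Theta>] riemann_sum_K_alg[OF \<Theta>]]) (simp only: mult.commute)
    have "?R (Suc i) - ?R (Suc j) = (?R (Suc i) - ?R (Suc i * Suc j)) + (?R (Suc i * Suc j) - ?R (Suc j))" by simp
    then have "K_norm 1 (?R (Suc i) - ?R (Suc j)) \<le> \<epsilon> / 3 + \<epsilon> / 3"
      using K_norm_triangle[OF order_refl K_alg_diff[OF riemann_sum_K_alg[OF \<Theta>] riemann_sum_K_alg[OF \<Theta>]]
          K_alg_diff[OF riemann_sum_K_alg[OF \<Theta>] riemann_sum_K_alg[OF \<Theta>]], of "Suc i" "Suc i * Suc j" "Suc i * Suc j" "Suc j"] a b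
      by (simp only:)
    then show ?thesis using e by linarith
  qed
  then show "\<exists>N. \<forall>i\<ge>N. \<forall>j\<ge>N. K_norm 1 (?R (Suc i) - ?R (Suc j)) < \<epsilon>" by blast
qed


section \<open>Operator matrices\<close>

lemma op_pair_eqI: "(\<And>x y. op_apply A (x, y) = op_apply B (x, y)) \<Longrightarrow> A = B"
  by (rule op_eqI) (metis surj_pair)

lemma block_op_diff:
  "block_op A B C D - block_op A' B' C' D' = block_op (A - A') (B - B') (C - C') (D - D')"
  by (rule op_pair_eqI) (simp add: op_apply_block_op algebra_simps)

lemma block_op_split: "block_op A B C D = (block_op A 0 0 0 + block_op 0 B 0 0) + (block_op 0 0 C 0 + block_op 0 0 0 D)"
  by (rule op_pair_eqI) (simp add: op_apply_block_op)

lemma block_diagonal_mult: "block_op A 0 0 D * block_op A' 0 0 D' = block_op (A * A') 0 0 (D * D')"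
  by (rule op_pair_eqI) (simp add: op_apply_block_op)

lemma block_antidiagonal_mult: "block_op 0 B C 0 * block_op A 0 0 D = block_op 0 (B * D) (C * A) 0"
  by (rule op_pair_eqI) (simp add: op_apply_block_op)

lemma block_diagonal_power: "block_op A 0 0 D ^ n = block_op (A ^ n) 0 0 (D ^ n)"
proof (induction n)
  case 0
  show ?case by (rule op_pair_eqI) (simp add: op_apply_block_op)
qed (simp add: block_diagonal_mult)

lemma bounded_linear_block_op:
  "bounded_linear (\<lambda>A :: 'a::complex_hilbert bounded_op. block_op A 0 0 0)"
  "bounded_linear (\<lambda>B :: 'a bounded_op. block_op 0 B 0 0)"
  "bounded_linear (\<lambda>C :: 'a bounded_op. block_op 0 0 C 0)"
  "bounded_linear (\<lambda>D :: 'a bounded_op. block_op 0 0 0 D)"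
proof -
  have fst: "norm (op_apply A (fst p)) \<le> norm A * norm p" for A :: "'a bounded_op" and p :: "'a \<times> 'a"
    using norm_op_apply[of A "fst p"] mult_left_mono[OF norm_fst_le[of "fst p" "snd p"], of "norm A"] by simp
  have snd: "norm (op_apply A (snd p)) \<le> norm A * norm p" for A :: "'a bounded_op" and p :: "'a \<times> 'a"
    using norm_op_apply[of A "snd p"] mult_left_mono[OF norm_snd_le[of "snd p" "fst p"], of "norm A"] by simp
  have norm: "norm (block_op A 0 0 0) \<le> norm A" "norm (block_op 0 A 0 0) \<le> norm A"
    "norm (block_op 0 0 A 0) \<le> norm A" "norm (block_op 0 0 0 A) \<le> norm A" for A :: "'a bounded_op"
    using fst[of A "(_, _)"] snd[of A "(_, _)"]
    by (auto intro!: norm_op_bound simp: op_apply_block_op norm_Pair)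
  show "bounded_linear (\<lambda>A :: 'a bounded_op. block_op A 0 0 0)"
    "bounded_linear (\<lambda>B :: 'a bounded_op. block_op 0 B 0 0)"
    "bounded_linear (\<lambda>C :: 'a bounded_op. block_op 0 0 C 0)"
    "bounded_linear (\<lambda>D :: 'a bounded_op. block_op 0 0 0 D)"
    by (rule bounded_linear_intro[where K = 1];
        (rule op_pair_eqI)?; simp add: op_apply_block_op norm)+
qed

lemma has_vector_derivative_block_op:
  assumes "(A has_vector_derivative A') F" "(B has_vector_derivative B') F"
    "(C has_vector_derivative C') F" "(D has_vector_derivative D') F"
  shows "((\<lambda>t. block_op (A t) (B t) (C t) (D t)) has_vector_derivative block_op A' B' C' D') F"
proof -
  have "((\<lambda>t. (block_op (A t) 0 0 0 + block_op 0 (B t) 0 0) + (block_op 0 0 (C t) 0 + block_op 0 0 0 (D t)))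
      has_vector_derivative (block_op A' 0 0 0 + block_op 0 B' 0 0) + (block_op 0 0 C' 0 + block_op 0 0 0 D')) F"
    by (intro has_vector_derivative_add bounded_linear.has_vector_derivative[OF bounded_linear_block_op(1)]
        bounded_linear.has_vector_derivative[OF bounded_linear_block_op(2)]
        bounded_linear.has_vector_derivative[OF bounded_linear_block_op(3)]
        bounded_linear.has_vector_derivative[OF bounded_linear_block_op(4)] assms)
  then show ?thesis by (simp only: block_op_split[symmetric])
qed

text \<open>Families of vectors are transported along the isometries \<open>J\<close> and \<open>J'\<close>. As a family is indexed by the
  space itself, its indices are moved to \<open>H \<oplus> H\<close> as well.\<close>

lemma nuclear_le_compression:
  fixes B :: "('a::complex_hilbert \<times> 'a) bounded_op" and A :: "'a bounded_op"
  assumes B: "nuclear_le B K"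
    and J: "\<And>p x. cinner p (J x) = cinner (q p) x" "\<And>p. norm (q p) \<le> norm p"
    and J': "\<And>p y. cinner (J' y) p = cinner y (q' p)" "\<And>p. norm (q' p) \<le> norm p"
    and A: "\<And>x y. cinner (J' y) (op_apply B (J x)) = cinner y (op_apply A x)"
  shows "nuclear_le A K"
  unfolding nuclear_le_def
proof (intro allI impI)
  fix I and x y :: "'a \<Rightarrow> 'a" assume fr: "finite_rank_le 1 I x y"
  define I' where "I' = (\<lambda>i. (i, 0 :: 'a)) ` I"
  have reindex: "(\<Sum>p\<in>I'. f (fst p)) = (\<Sum>i\<in>I. f i)" for f :: "'a \<Rightarrow> complex"
    unfolding I'_def by (subst sum.reindex) (auto simp: inj_on_def)
  have "finite_rank_le 1 I' (\<lambda>p. J (x (fst p))) (\<lambda>p. J' (y (fst p)))"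
    unfolding finite_rank_le_def
  proof (intro conjI allI)
    show "finite I'" using fr by (simp add: finite_rank_le_def I'_def)
    fix u v
    have "cmod (\<Sum>i\<in>I. cinner (q v) (x i) * cinner (y i) (q' u)) \<le> norm (q' u) * norm (q v)"
      using fr by (simp add: finite_rank_le_def)
    also have "\<dots> \<le> norm u * norm v" by (intro mult_mono J J') simp_all
    finally show "cmod (\<Sum>p\<in>I'. cinner v (J (x (fst p))) * cinner (J' (y (fst p))) u) \<le> 1 * norm u * norm v"
      by (simp add: J(1) J'(1) reindex[of "\<lambda>i. cinner (q v) (x i) * cinner (y i) (q' u)"])
  qed
  from nuclear_leD[OF B this]
  show "cmod (\<Sum>i\<in>I. cinner (y i) (op_apply A (x i))) \<le> K"
    by (simp add: A reindex[of "\<lambda>i. cinner (y i) (op_apply A (x i))"])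
qed

lemma nuclear_le_block_op:
  assumes "nuclear_le (block_op A B C D) K"
  shows "nuclear_le A K" "nuclear_le B K" "nuclear_le C K" "nuclear_le D K"
proof -
  have fst: "norm (fst p) \<le> norm p" for p :: "'a \<times> 'a" using norm_fst_le[of "fst p" "snd p"] by simp
  have snd: "norm (snd p) \<le> norm p" for p :: "'a \<times> 'a" using norm_snd_le[of "snd p" "fst p"] by simp
  show "nuclear_le A K"
    by (rule nuclear_le_compression[OF assms, of "\<lambda>x. (x, 0)" fst "\<lambda>x. (x, 0)" fst])
      (simp_all add: cinner_prod_def op_apply_block_op fst snd)
  show "nuclear_le B K"
    by (rule nuclear_le_compression[OF assms, of "\<lambda>x. (0, x)" snd "\<lambda>x. (x, 0)" fst])
      (simp_all add: cinner_prod_def op_apply_block_op fst snd)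
  show "nuclear_le C K"
    by (rule nuclear_le_compression[OF assms, of "\<lambda>x. (x, 0)" fst "\<lambda>x. (0, x)" snd])
      (simp_all add: cinner_prod_def op_apply_block_op fst snd)
  show "nuclear_le D K"
    by (rule nuclear_le_compression[OF assms, of "\<lambda>x. (0, x)" snd "\<lambda>x. (0, x)" snd])
      (simp_all add: cinner_prod_def op_apply_block_op fst snd)
qed

lemma trace_path_block_op:
  assumes "trace_path (\<lambda>t. block_op (A t) (B t) (C t) (D t))"
  shows "trace_path A" "trace_path B" "trace_path C" "trace_path D"
proof -
  note tc = trace_pathD(1)[OF assms]
  have tn: "\<exists>g. null_at t g \<and>
      (\<forall>s\<in>{0..1}. nuclear_le (block_op (A s - A t) (B s - B t) (C s - C t) (D s - D t)) (g s))" if "t \<in> {0..1}" for t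
    using trace_pathD(2)[OF assms] that by (simp add: trace_continuous_def block_op_diff)
  show "trace_path A" unfolding trace_path_iff trace_continuous_def
    using tc tn nuclear_le_block_op(1) trace_class_iff by metis
  show "trace_path B" unfolding trace_path_iff trace_continuous_def
    using tc tn nuclear_le_block_op(2) trace_class_iff by metis
  show "trace_path C" unfolding trace_path_iff trace_continuous_def
    using tc tn nuclear_le_block_op(3) trace_class_iff by metis
  show "trace_path D" unfolding trace_path_iff trace_continuous_def
    using tc tn nuclear_le_block_op(4) trace_class_iff by metis
qed


section \<open>The derivative as a sum of commutators\<close>

lemma has_vector_derivative_op_power:
  fixes P :: "real \<Rightarrow> 'a::complex_hilbert bounded_op"
  assumes P: "(P has_vector_derivative P') (at t within S)"
  shows "((\<lambda>s. P s ^ n) has_vector_derivative (\<Sum>k<n. P t ^ k * P' * P t ^ (n - 1 - k))) (at t within S)"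
proof (induction n)
  case (Suc n)
  have "((\<lambda>s. P s * P s ^ n) has_vector_derivative
      P t * (\<Sum>k<n. P t ^ k * P' * P t ^ (n - 1 - k)) + P' * P t ^ n) (at t within S)"
    by (rule has_vector_derivative_mult[OF P Suc])
  also have "P t * (\<Sum>k<n. P t ^ k * P' * P t ^ (n - 1 - k)) + P' * P t ^ n
      = (\<Sum>k<Suc n. P t ^ k * P' * P t ^ (Suc n - 1 - k))"
    by (simp add: sum.lessThan_Suc_shift sum_distrib_left mult.assoc del: sum.lessThan_Suc)
  finally show ?case by simp
qed simp

lemma one_minus_power_factor:
  fixes M :: "'a::complex_hilbert bounded_op"
  shows "(1 - M) * (\<Sum>k<n. M ^ k) = 1 - M ^ n"
  by (induction n) (simp_all add: distrib_left left_diff_distrib)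

lemma intertwine_power:
  fixes u P M :: "'a::monoid_mult"
  assumes "u * P = M * u"
  shows "u * P ^ k = M ^ k * u"
proof (induction k)
  case (Suc k)
  have "u * P ^ Suc k = M * (u * P ^ k)" by (simp add: assms mult.assoc[symmetric])
  then show ?case by (simp add: Suc mult.assoc)
qed simp

definition commutator :: "'a::complex_hilbert bounded_op \<Rightarrow> 'a bounded_op \<Rightarrow> 'a bounded_op"
  where "commutator A B = A * B - B * A"

lemma power_derivative_mult_power:
  fixes P P' :: "'a::complex_hilbert bounded_op"
  shows "(\<Sum>k<n. P ^ k * P' * P ^ (n - 1 - k)) * P ^ n
    = real n *\<^sub>R (P' * P ^ (2 * n - 1)) - (\<Sum>k<n. commutator (P' * P ^ (2 * n - 1 - k)) (P ^ k))"
proof -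
  have "P ^ k * P' * P ^ (n - 1 - k) * P ^ n = P' * P ^ (2 * n - 1) - commutator (P' * P ^ (2 * n - 1 - k)) (P ^ k)"
    if "k < n" for k
  proof -
    have "P ^ (n - 1 - k) * P ^ n = P ^ (2 * n - 1 - k)" "P ^ (2 * n - 1 - k) * P ^ k = P ^ (2 * n - 1)"
      using that by (simp_all add: power_add[symmetric] mult_2)
    then show ?thesis by (simp add: commutator_def mult.assoc)
  qed
  then have "(\<Sum>k<n. P ^ k * P' * P ^ (n - 1 - k)) * P ^ n
      = (\<Sum>k<n. P' * P ^ (2 * n - 1) - commutator (P' * P ^ (2 * n - 1 - k)) (P ^ k))"
    by (simp add: sum_distrib_right)
  then show ?thesis by (simp add: sum_subtractf sum_constant_scaleR)
qed

text \<open>Write \<open>X = X P\<^sup>n + X (1 - P\<^sup>n)\<close> and \<open>1 - P\<^sup>n = v Q u\<close>, and likewise for \<open>W\<close> with \<open>1 - M\<^sup>n = u v Q\<close>.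
  The first summands are, up to commutators with powers, \<open>n P' P\<^sup>2\<^sup>n\<^sup>-\<^sup>1\<close> and \<open>n M' M\<^sup>2\<^sup>n\<^sup>-\<^sup>1\<close>, and intertwining turns their
  difference into commutators with \<open>u\<close> and \<open>v\<close>. The second ones give \<open>[X v Q, u] + (u X - W u) v Q\<close>, where
  the differentiated intertwining relation applies.\<close>

lemma derivative_difference_commutators:
  fixes u v a b P M P' M' X W Q :: "'a::complex_hilbert bounded_op"
  assumes P: "P = 1 - v * u" and M: "M = 1 - u * v"
    and P': "P' = - (v * a + b * u)" and M': "M' = - (u * b + a * v)"
    and X: "X = (\<Sum>k<n. P ^ k * P' * P ^ (n - 1 - k))" and W: "W = (\<Sum>k<n. M ^ k * M' * M ^ (n - 1 - k))"
    and Q: "Q = (\<Sum>k<n. M ^ k)"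
    and rel: "u * X - W * u = M ^ n * a - a * P ^ n"
  shows "X - W = (\<Sum>k<n. commutator (M' * M ^ (2 * n - 1 - k)) (M ^ k) - commutator (P' * P ^ (2 * n - 1 - k)) (P ^ k))
    + real n *\<^sub>R (commutator (a * P ^ (2 * n - 1)) v - commutator (b * M ^ (2 * n - 1)) u)
    + (commutator (X * v * Q) u + commutator (M ^ n) (a * v * Q))"
proof -
  define N where "N = 2 * n - 1"
  have uP: "u * P ^ k = M ^ k * u" for k by (rule intertwine_power) (simp add: P M algebra_simps)
  have vM: "v * M ^ k = P ^ k * v" for k by (rule intertwine_power) (simp add: P M algebra_simps)
  have uvQ: "u * v * Q = 1 - M ^ n" using one_minus_power_factor[of M n] by (simp add: Q M)
  have Qu: "Q * u = u * (\<Sum>k<n. P ^ k)" by (simp add: Q sum_distrib_left sum_distrib_right uP)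
  have vQu: "v * Q * u = 1 - P ^ n"
    using one_minus_power_factor[of P n] by (simp add: P Qu mult.assoc)
  have QM: "Q * M ^ n = M ^ n * Q"
    by (simp add: Q sum_distrib_left sum_distrib_right power_add[symmetric] add.commute)
  have leading: "P' * P ^ N - M' * M ^ N = commutator (a * P ^ N) v - commutator (b * M ^ N) u"
    unfolding P' M' commutator_def by (simp add: algebra_simps uP vM)
  have "X * (v * Q * u) - W * (u * v * Q) = commutator (X * v * Q) u + (u * X - W * u) * v * Q"
    by (simp add: commutator_def algebra_simps)
  also have "(u * X - W * u) * v * Q = M ^ n * a * v * Q - a * (v * M ^ n) * Q"
    unfolding rel by (simp add: vM left_diff_distrib mult.assoc)
  also have "\<dots> = commutator (M ^ n) (a * v * Q)"
    by (simp add: commutator_def mult.assoc QM)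
  finally have second: "X * (v * Q * u) - W * (u * v * Q) = commutator (X * v * Q) u + commutator (M ^ n) (a * v * Q)" .
  have first: "X * P ^ n - W * M ^ n = real n *\<^sub>R (P' * P ^ N - M' * M ^ N)
      + (\<Sum>k<n. commutator (M' * M ^ (N - k)) (M ^ k) - commutator (P' * P ^ (N - k)) (P ^ k))"
    unfolding X W N_def power_derivative_mult_power by (simp add: scaleR_diff_right sum_subtractf)
  have split: "X - W = (X * P ^ n - W * M ^ n) + (X * (v * Q * u) - W * (u * v * Q))"
    unfolding vQu uvQ by (simp add: right_diff_distrib)
  show ?thesis
    unfolding N_def[symmetric] split first second leading by (simp only: ac_simps)
qed

lemma trace_commutator_zero: "trace_class A \<Longrightarrow> trace (commutator A B) = 0"
  using trace_mult_commute[of A B]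
  by (simp add: commutator_def trace_diff trace_class_mult_left trace_class_mult_right)

lemma trace_class_commutator: "trace_class A \<Longrightarrow> trace_class (commutator A B)"
  by (simp add: commutator_def trace_class_diff trace_class_mult_left trace_class_mult_right)


section \<open>Homotopy invariance of the homological index\<close>

lemma vector_derivative_unit_interval:
  "(f has_vector_derivative f') (at t within {0..1}) \<Longrightarrow> t \<in> {0..1} \<Longrightarrow> vector_derivative f (at t within {0..1}) = f'"
  using vector_derivative_within_cbox[of 0 1 t f f'] by simp

theorem theorem5p2:
  fixes T :: "real \<Rightarrow> 'h::complex_hilbert bounded_op" and n :: nat
  assumes C1: "\<exists>T'. (\<forall>t\<in>{0..1}. (T has_vector_derivative T' t) (at t within {0..1}))
                    \<and> continuous_on {0..1} T'"
    and n: "n \<ge> 1"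
    and difference: "\<forall>t\<in>{0..1}. trace_class (R_plus (T t) ^ n - R_minus (T t) ^ n)"
    and dR: "\<forall>t\<in>{0..1}. trace_class
               (vector_derivative (\<lambda>s. R_total (T s) ^ n) (at t within {0..1}))"
    and dT_R: "\<forall>t\<in>{0..1}. trace_class
               (vector_derivative (\<lambda>s. T_total (T s)) (at t within {0..1}) * R_total (T t) ^ n)"
    and dR_cont: "trace_norm_continuous_on {0..1}
               (\<lambda>t. vector_derivative (\<lambda>s. R_total (T s) ^ n) (at t within {0..1}))"
    and dT_R_cont: "trace_norm_continuous_on {0..1}
               (\<lambda>t. vector_derivative (\<lambda>s. T_total (T s)) (at t within {0..1}) * R_total (T t) ^ n)"
  shows "trace_class
           (R_plus (T 0) ^ n - R_minus (T 0) ^ n - R_plus (T 1) ^ n + R_minus (T 1) ^ n)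
       \<and> H0_class (R_plus (T 0) ^ n - R_minus (T 0) ^ n - R_plus (T 1) ^ n + R_minus (T 1) ^ n)
           = \<one>\<^bsub>H0_lambda\<^esub>
       \<and> H_Ind n (T 0) = H_Ind n (T 1)"
proof -
  let ?I = "{0..1::real}"
  obtain a where u: "\<And>t. t \<in> ?I \<Longrightarrow> (T has_vector_derivative a t) (at t within ?I)"
    and a_cont: "continuous_on ?I a"
    using C1 by blast
  define v where "v = (\<lambda>t. adj (T t))"
  define b where "b = (\<lambda>t. adj (a t))"
  define P where "P = (\<lambda>t. R_plus (T t))"
  define M where "M = (\<lambda>t. R_minus (T t))"
  define P' where "P' = (\<lambda>t. - (v t * a t + b t * T t))"
  define M' where "M' = (\<lambda>t. - (T t * b t + a t * v t))"
  define X where "X = (\<lambda>t. \<Sum>k<n. P t ^ k * P' t * P t ^ (n - 1 - k))"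
  define W where "W = (\<lambda>t. \<Sum>k<n. M t ^ k * M' t * M t ^ (n - 1 - k))"
  define Q where "Q = (\<lambda>t. \<Sum>k<n. M t ^ k)"
  have P_eq: "P t = 1 - v t * T t" and M_eq: "M t = 1 - T t * v t" for t
    by (simp_all add: P_def M_def v_def R_plus_def R_minus_def)

  have v: "(v has_vector_derivative b t) (at t within ?I)" if "t \<in> ?I" for t
    unfolding v_def b_def by (rule bounded_linear.has_vector_derivative[OF bounded_linear_adj u[OF that]])
  have dP: "(P has_vector_derivative P' t) (at t within ?I)" if "t \<in> ?I" for t
    using has_vector_derivative_diff[OF has_vector_derivative_const has_vector_derivative_mult[OF v[OF that] u[OF that]], of 1]
    by (simp add: P_eq[abs_def] P'_def)
  have dM: "(M has_vector_derivative M' t) (at t within ?I)" if "t \<in> ?I" for t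
    using has_vector_derivative_diff[OF has_vector_derivative_const has_vector_derivative_mult[OF u[OF that] v[OF that]], of 1]
    by (simp add: M_eq[abs_def] M'_def)
  have dPn: "((\<lambda>s. P s ^ n) has_vector_derivative X t) (at t within ?I)" if "t \<in> ?I" for t
    unfolding X_def by (rule has_vector_derivative_op_power[OF dP[OF that]])
  have dMn: "((\<lambda>s. M s ^ n) has_vector_derivative W t) (at t within ?I)" if "t \<in> ?I" for t
    unfolding W_def by (rule has_vector_derivative_op_power[OF dM[OF that]])

  have uP: "T t * P t ^ k = M t ^ k * T t" for t k
    by (rule intertwine_power) (simp add: P_eq M_eq algebra_simps)
  have vM: "v t * M t ^ k = P t ^ k * v t" for t k
    by (rule intertwine_power) (simp add: P_eq M_eq algebra_simps)
  \<comment> \<open>Uniqueness of the derivative of the two sides of the intertwining relation.\<close>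
  have rel: "T t * X t - W t * T t = M t ^ n * a t - a t * P t ^ n" if t: "t \<in> ?I" for t
  proof -
    have "((\<lambda>s. T s * P s ^ n) has_vector_derivative T t * X t + a t * P t ^ n) (at t within ?I)"
      by (rule has_vector_derivative_mult[OF u[OF t] dPn[OF t]])
    moreover have "((\<lambda>s. T s * P s ^ n) has_vector_derivative M t ^ n * a t + W t * T t) (at t within ?I)"
      unfolding uP by (rule has_vector_derivative_mult[OF dMn[OF t] u[OF t]])
    ultimately have "T t * X t + a t * P t ^ n = M t ^ n * a t + W t * T t"
      using t by (intro vector_derivative_unique_within_closed_interval[of 0 1 t "\<lambda>s. T s * P s ^ n"]) auto
    then show ?thesis by (simp add: algebra_simps)
  qed

  have cont_T: "continuous_on ?I T" and cont_v: "continuous_on ?I v"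
    and cont_P: "continuous_on ?I P" and cont_M: "continuous_on ?I M"
    by (rule continuous_on_vector_derivative, erule u v dP dM)+
  have cont_pow: "continuous_on ?I (\<lambda>t. P t ^ k)" "continuous_on ?I (\<lambda>t. M t ^ k)" for k
    by (induction k) (auto intro!: continuous_intros cont_P cont_M)
  have cont_Q: "continuous_on ?I Q"
    unfolding Q_def by (intro continuous_intros cont_pow)
  have cont_b: "continuous_on ?I b"
    unfolding b_def by (rule bounded_linear.continuous_on[OF bounded_linear_adj a_cont])

  have R_eq: "R_total (T t) ^ n = block_op (P t ^ n) 0 0 (M t ^ n)" for t
    by (simp add: R_total_def block_diagonal_power P_def M_def)
  have vd_R: "vector_derivative (\<lambda>s. R_total (T s) ^ n) (at t within ?I) = block_op (X t) 0 0 (W t)" if "t \<in> ?I" for t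
    unfolding R_eq
    by (intro vector_derivative_unit_interval has_vector_derivative_block_op has_vector_derivative_const dPn dMn that)
  have vd_T: "vector_derivative (\<lambda>s. T_total (T s)) (at t within ?I) * R_total (T t) ^ n
      = block_op 0 (b t * M t ^ n) (a t * P t ^ n) 0" if "t \<in> ?I" for t
  proof -
    have "vector_derivative (\<lambda>s. T_total (T s)) (at t within ?I) = block_op 0 (b t) (a t) 0"
      unfolding T_total_def
      by (intro vector_derivative_unit_interval has_vector_derivative_block_op has_vector_derivative_const
          u v[unfolded v_def] that)
    then show ?thesis by (simp add: R_eq block_antidiagonal_mult)
  qed
  \<comment> \<open>The hypotheses on the direct sum, taken apart into matrix entries.\<close>
  have "trace_path (\<lambda>t. block_op (X t) 0 0 (W t))"
    using dR dR_cont vd_R by (subst trace_path_cong[of _ "\<lambda>t. vector_derivative (\<lambda>s. R_total (T s) ^ n) (at t within ?I)"])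
      (simp_all add: trace_path_def)
  note tX = trace_path_block_op(1)[OF this] and tW = trace_path_block_op(4)[OF this]
  have "trace_path (\<lambda>t. block_op 0 (b t * M t ^ n) (a t * P t ^ n) 0)"
    using dT_R dT_R_cont vd_T by (subst trace_path_cong[of _ "\<lambda>t. vector_derivative (\<lambda>s. T_total (T s)) (at t within ?I) * R_total (T t) ^ n"])
      (simp_all add: trace_path_def)
  note tb = trace_path_block_op(2)[OF this] and ta = trace_path_block_op(3)[OF this]

  define N where "N = 2 * n - 1"
  have tbN: "trace_path (\<lambda>t. b t * M t ^ m)" and taN: "trace_path (\<lambda>t. a t * P t ^ m)" if "n \<le> m" for m
  proof -
    have "b t * M t ^ m = b t * M t ^ n * M t ^ (m - n)" "a t * P t ^ m = a t * P t ^ n * P t ^ (m - n)" for t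
      using that by (simp_all add: mult.assoc power_add[symmetric])
    then show "trace_path (\<lambda>t. b t * M t ^ m)" "trace_path (\<lambda>t. a t * P t ^ m)"
      using trace_path_mult_right[OF tb cont_pow(2)[of "m - n"]] trace_path_mult_right[OF ta cont_pow(1)[of "m - n"]] by simp_all
  qed
  \<comment> \<open>With exponent at least \<open>n\<close>, intertwining brings the power next to \<open>b\<close> or \<open>a\<close>.\<close>
  have tM': "trace_path (\<lambda>t. M' t * M t ^ m)" and tP': "trace_path (\<lambda>t. P' t * P t ^ m)" if "n \<le> m" for m
  proof -
    have "M' t * M t ^ m = - (T t * (b t * M t ^ m) + a t * P t ^ m * v t)" for t
      by (simp add: M'_def algebra_simps vM)
    then show "trace_path (\<lambda>t. M' t * M t ^ m)"
      using trace_path_minus[OF trace_path_add[OF trace_path_mult_left[OF tbN[OF that] cont_T] trace_path_mult_right[OF taN[OF that] cont_v]]]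
      by simp
    have "P' t * P t ^ m = - (v t * (a t * P t ^ m) + b t * M t ^ m * T t)" for t
      by (simp add: P'_def algebra_simps uP)
    then show "trace_path (\<lambda>t. P' t * P t ^ m)"
      using trace_path_minus[OF trace_path_add[OF trace_path_mult_left[OF taN[OF that] cont_v] trace_path_mult_right[OF tbN[OF that] cont_T]]]
      by simp
  qed
  have tXvQ: "trace_path (\<lambda>t. X t * v t * Q t)"
    by (intro trace_path_mult_right tX cont_v cont_Q)
  \<comment> \<open>The product \<open>M\<^sup>n a\<close> is trace class by the differentiated intertwining relation.\<close>
  have "trace_path (\<lambda>t. (a t * P t ^ n + (T t * X t - W t * T t)) * v t * Q t)"
    by (intro trace_path_mult_right trace_path_add trace_path_diff trace_path_mult_left ta tX tW cont_T cont_v cont_Q)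
  then have tMY: "trace_path (\<lambda>t. M t ^ n * (a t * v t * Q t))"
    by (subst trace_path_cong[of _ "\<lambda>t. (a t * P t ^ n + (T t * X t - W t * T t)) * v t * Q t"])
      (simp_all add: rel mult.assoc)
  have "a t * v t * Q t * M t ^ n = a t * P t ^ n * v t * Q t" for t
  proof -
    have "Q t * M t ^ n = M t ^ n * Q t"
      by (simp add: Q_def sum_distrib_left sum_distrib_right power_add[symmetric] add.commute)
    then show ?thesis by (simp add: mult.assoc vM[symmetric])
  qed
  then have tYM: "trace_path (\<lambda>t. a t * v t * Q t * M t ^ n)"
    by (simp add: trace_path_mult_right ta cont_v cont_Q)

  \<comment> \<open>One word \<open>A \<otimes> B\<close> for each commutator \<open>[A, B]\<close>, with the same coefficients.\<close>
  define \<Theta> where "\<Theta> = (\<lambda>t. (\<Sum>k<n. elem_tensor [M' t * M t ^ (N - k), M t ^ k] - elem_tensor [P' t * P t ^ (N - k), P t ^ k])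
    + real n *\<^sub>R (elem_tensor [a t * P t ^ N, v t] - elem_tensor [b t * M t ^ N, T t])
    + (elem_tensor [X t * v t * Q t, T t] + elem_tensor [M t ^ n, a t * v t * Q t]))"
  have N: "n \<le> N" "\<And>k. k < n \<Longrightarrow> n \<le> N - k" using n by (auto simp: N_def)
  have \<Theta>: "K_path \<Theta>"
    unfolding \<Theta>_def
    by (intro K_path_add K_path_sum K_path_diff K_path_scaleR K_path_trace_word tM' tP' tbN taN tXvQ N cont_pow cont_v cont_T
        K_path_word[OF trace_continuous_of_derivative[OF dMn tW]] tMY tYM continuous_on_mult a_cont cont_Q) auto
  have X_minus_W: "X t - W t = (\<Sum>k<n. commutator (M' t * M t ^ (N - k)) (M t ^ k) - commutator (P' t * P t ^ (N - k)) (P t ^ k))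
    + real n *\<^sub>R (commutator (a t * P t ^ N) (v t) - commutator (b t * M t ^ N) (T t))
    + (commutator (X t * v t * Q t) (T t) + commutator (M t ^ n) (a t * v t * Q t))" if "t \<in> ?I" for t
    unfolding N_def
    by (rule derivative_difference_commutators[OF P_eq M_eq P'_def[THEN fun_cong] M'_def[THEN fun_cong]
          X_def[THEN fun_cong] W_def[THEN fun_cong] Q_def[THEN fun_cong] rel[OF that]])
  have boundary_\<Theta>: "hochschild_boundary (\<Theta> t) = elem_tensor [X t - W t]" if "t \<in> ?I" for t
    unfolding \<Theta>_def X_minus_W[OF that]
    by (simp only: clinearD[OF clinear_hochschild_boundary] clinear_diff[OF clinear_hochschild_boundary]
        clinear_sum_arg[OF clinear_hochschild_boundary] clinear_scaleR[OF clinear_hochschild_boundary]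
        clinearD[OF clinear_letter(1)] clinear_diff[OF clinear_letter(1)]
        clinear_sum_arg[OF clinear_letter(1)] clinear_scaleR[OF clinear_letter(1)]
        hochschild_boundary_word_1 commutator_def)

  define Y where "Y = (\<lambda>t. X t - W t)"
  have tY: "trace_path Y" unfolding Y_def by (rule trace_path_diff[OF tX tW])
  have trY: "trace (Y t) = 0" if t: "t \<in> ?I" for t
  proof -
    \<comment> \<open>Here the self-adjointness of \<open>M\<close> enters: neither factor of the last commutator is trace class.\<close>
    have adjM: "adj (M t) = M t" by (simp add: M_eq v_def adj_diff adj_mult)
    have *: "trace_class (M t ^ n * (a t * v t * Q t))" "trace_class (a t * v t * Q t * M t ^ n)"
      using trace_pathD(1)[OF tMY t] trace_pathD(1)[OF tYM t] by simp_all
    have last: "trace (commutator (M t ^ n) (a t * v t * Q t)) = 0"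
      "trace_class (commutator (M t ^ n) (a t * v t * Q t))"
      unfolding commutator_def using * trace_selfadjoint_commute[OF _ *(2) *(1)]
      by (simp_all add: trace_diff trace_class_diff adj_power adjM)
    have tc: "trace_class (M' t * M t ^ (N - k))" "trace_class (P' t * P t ^ (N - k))" if "k < n" for k
      using that trace_pathD(1)[OF tM' t] trace_pathD(1)[OF tP' t] N by simp_all
    have tc2: "trace_class (a t * P t ^ N)" "trace_class (b t * M t ^ N)" "trace_class (X t * v t * Q t)"
      using trace_pathD(1)[OF taN t] trace_pathD(1)[OF tbN t] trace_pathD(1)[OF tXvQ t] N by simp_all
    have each: "trace_class (commutator (M' t * M t ^ (N - k)) (M t ^ k) - commutator (P' t * P t ^ (N - k)) (P t ^ k))"
      "trace (commutator (M' t * M t ^ (N - k)) (M t ^ k) - commutator (P' t * P t ^ (N - k)) (P t ^ k)) = 0" if "k < n" for k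
      using tc[OF that] by (simp_all add: trace_class_diff trace_class_commutator trace_diff trace_commutator_zero)
    have s: "trace_class (\<Sum>k<n. commutator (M' t * M t ^ (N - k)) (M t ^ k) - commutator (P' t * P t ^ (N - k)) (P t ^ k))"
      "trace (\<Sum>k<n. commutator (M' t * M t ^ (N - k)) (M t ^ k) - commutator (P' t * P t ^ (N - k)) (P t ^ k)) = 0"
      by (rule trace_class_sum, simp add: each, subst trace_sum, simp_all add: each)
    show ?thesis
      unfolding Y_def X_minus_W[OF t] using s tc2 last
      by (simp add: trace_add trace_diff trace_scaleC trace_class_add trace_class_diff trace_class_scaleC
          trace_class_commutator trace_commutator_zero scaleR_scaleC)
  qed

  define G where "G = (\<lambda>t. P t ^ n - M t ^ n)"
  have dG: "(G has_vector_derivative Y t) (at t within ?I)" if "t \<in> ?I" for t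
    unfolding G_def Y_def by (rule has_vector_derivative_diff[OF dPn[OF that] dMn[OF that]])
  define A where "A = R_plus (T 0) ^ n - R_minus (T 0) ^ n - R_plus (T 1) ^ n + R_minus (T 1) ^ n"
  have A: "A = G 0 - G 1" by (simp add: A_def G_def P_def M_def)
  have tcG: "trace_class (G 0)" "trace_class (G 1)"
    using difference by (simp_all add: G_def P_def M_def)
  then have tcA: "trace_class A" unfolding A by (rule trace_class_diff)
  have R_tc: "trace_class (riemann_sum Y k)" and R_tr: "trace (riemann_sum Y k) = 0" for k
  proof -
    have p: "trace_class ((1 / real k) *\<^sub>R Y (real j / real k))" "trace ((1 / real k) *\<^sub>R Y (real j / real k)) = 0" if "j < k" for j
      using trace_pathD(1)[OF tY riemann_sum_point[OF that]] trY[OF riemann_sum_point[OF that]]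
      by (simp_all add: scaleR_scaleC trace_class_scaleC trace_scaleC)
    show "trace_class (riemann_sum Y k)" unfolding riemann_sum_def using p by (intro trace_class_sum) simp
    show "trace (riemann_sum Y k) = 0" unfolding riemann_sum_def using p by (subst trace_sum) simp_all
  qed

  have "cmod (trace A) \<le> 0 + e" if e: "0 < e" for e
  proof -
    obtain k where "nuclear_le (G 1 - G 0 - riemann_sum Y (Suc k)) e"
      using fundamental_theorem_trace_norm[OF dG tY e] by blast
    then have "cmod (trace (- A - riemann_sum Y (Suc k))) \<le> e" by (intro cmod_trace_le) (simp add: A)
    then show ?thesis using tcA R_tc[of "Suc k"] R_tr[of "Suc k"] by (simp add: trace_diff trace_minus trace_class_minus)
  qed
  then have "cmod (trace A) \<le> 0" by (rule field_le_epsilon)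
  then have "trace (G 0) = trace (G 1)" using tcG by (simp add: A trace_diff)
  then have index: "H_Ind n (T 0) = H_Ind n (T 1)"
    by (simp add: H_Ind_def G_def P_eq M_eq v_def)

  have "H0_class A = \<one>\<^bsub>H0_lambda\<^esub>"
  proof (rule H0_class_trivialI[OF cauchy_group_uminus[OF order_refl riemann_sums_cauchy[OF \<Theta>]] tcA])
    \<comment> \<open>The sign is reversed because \<open>A\<close> is the value at \<open>0\<close> minus the value at \<open>1\<close>.\<close>
    have boundary: "hochschild_boundary (- riemann_sum \<Theta> k) - elem_tensor [A] = elem_tensor [G 1 - G 0 - riemann_sum Y k]" for k
    proof -
      have "hochschild_boundary (riemann_sum \<Theta> k) = (\<Sum>j<k. elem_tensor [(1 / real k) *\<^sub>R Y (real j / real k)])"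
        unfolding riemann_sum_def Y_def
        by (simp add: clinear_sum_arg[OF clinear_hochschild_boundary] clinear_scaleR[OF clinear_hochschild_boundary]
            clinear_scaleR[OF clinear_letter(1)] boundary_\<Theta>[OF riemann_sum_point])
      then have "hochschild_boundary (riemann_sum \<Theta> k) = elem_tensor [riemann_sum Y k]"
        by (simp only: riemann_sum_def clinear_sum_arg[OF clinear_letter(1)])
      then show ?thesis
        by (simp add: clinear_minus[OF clinear_hochschild_boundary] A clinear_diff[OF clinear_letter(1)])
    qed
    have K: "elem_tensor [G 1 - G 0 - riemann_sum Y k] \<in> K_alg 0" for k
      by (intro K_alg_word_0 trace_class_diff tcG R_tc)
    have "(\<lambda>k. K_norm 0 (elem_tensor [G 1 - G 0 - riemann_sum Y (Suc k)])) \<longlonglongrightarrow> 0"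
    proof (rule LIMSEQ_I)
      fix r :: real assume "0 < r"
      then have "0 < r / 4" by simp
      then obtain m where m: "\<And>k. k \<ge> m \<Longrightarrow> nuclear_le (G 1 - G 0 - riemann_sum Y (Suc k)) (r / 4)"
        using fundamental_theorem_trace_norm[OF dG tY] by blast
      have "norm (K_norm 0 (elem_tensor [G 1 - G 0 - riemann_sum Y (Suc k)]) - 0) < r" if "k \<ge> m" for k
        using K_norm_word_0[OF m[OF that]] K_norm_nonneg[OF zero_le_one K] \<open>0 < r\<close> by simp
      then show "\<exists>m. \<forall>k\<ge>m. norm (K_norm 0 (elem_tensor [G 1 - G 0 - riemann_sum Y (Suc k)]) - 0) < r" by blast
    qed
    then show "(\<lambda>k. hochschild_boundary (- riemann_sum \<Theta> (Suc k)) - elem_tensor [A]) \<in> null_sequences 0"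
      unfolding boundary using K by (simp add: null_sequences_iff)
  qed
  with tcA index show ?thesis unfolding A_def by blast
qed

end
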